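(* Let $X$ and $Y$ be Polish spaces, with Borel $\sigma$-algebras $\mathscr B(X)$ and $\mathscr B(Y)$, and let $\varphi\colon X\to Y$ be a Borel measurable map. Let $\mathbb B$ be a Banach space having the Radon–Nikodým property and let $\Omega$ be a $\mathbb B$-valued measure on $(X,\mathscr B(X))$ having bounded variation. Then there exists a disintegration $\{\Omega_y\}_{y\in Y}$ of $\Omega$ along $\varphi$.
   Context: A $\mathbb B$-valued measure on a measurable space $(X,\Sigma)$ is a map $\Omega\colon\Sigma\to\mathbb B$ that is countably additive in norm. Its variation is $\|\Omega\|_{\mathbb B}(E):=\sup\sum_{i=1}^n\|\Omega(E_i)\|_{\mathbb B}$ over finite measurable partitions $(E_i)_{i=1}^n$ of $E$; $\Omega$ has bounded variation if $\|\Omega\|_{\mathbb B}(X)<+\infty$, in which case $\|\Omega\|_{\mathbb B}$ is a finite measure. $\Omega\ll\mu$ means $\Omega(N)=0$ whenever $\mu(N)=0$. For a measurable map $\varphi\colon X\to Y$, $\varphi_\#\|\Omega\|_{\mathbb B}$ is the pushforward measure $E\mapsto\|\Omega\|_{\mathbb B}(\varphi^{-1}(E))$. $\mathcal L^\infty(\Sigma)$ is the Banach space of bounded $\Sigma$-measurable functions $X\to\mathbb R$ with the supremum norm. For $\Omega$ of bounded variation, $f\mapsto\int f\,d\Omega\in\mathbb B$ is the unique linear continuous operator on $\mathcal L^\infty(\Sigma)$ with $\int\mathbf 1_E\,d\Omega=\Omega(E)$ for all $E\in\Sigma$. $\mathbb B$ has the Radon–Nikodým property if for every $\sigma$-finite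 measure space $(X,\Sigma,\mu)$ and every $\mathbb B$-valued measure $\Omega$ on $(X,\Sigma)$ of bounded variation with $\Omega\ll\mu$ there exists $g\in L^1(\mu;\mathbb B)$ (Lebesgue–Bochner space) with $\Omega(E)=\int_E g\,d\mu$ for every $E\in\Sigma$. A map from a $\sigma$-finite measure space $(Y,\Sigma_Y,\nu)$ to $\mathbb B$ is strongly measurable if it is $\nu$-measurable (preimages of Borel sets belong to the $\nu$-completion of $\Sigma_Y$) and it is the $\nu$-a.e. norm limit of a sequence of $\mathbb B$-simple maps $\sum_{i=1}^n\mathbf 1_{E_i}v_i$ ($E_i\in\Sigma_Y$ pairwise disjoint, $\nu(E_i)<\infty$, $v_i\in\mathbb B$). Disintegration: let $(X,\Sigma_X)$, $(Y,\Sigma_Y)$ be measurable spaces, $\varphi\colon X\to Y$ measurable, and $\Omega$ a $\mathbb B$-valued measure on $(X,\Sigma_X)$ of bounded variation; put $\nu:=\varphi_\#\|\Omega\|_{\mathbb B}$. A family $\{\Omega_y\}_{y\in Y}$ is a disintegration of $\Omega$ along $\varphi$ if: (i) each $\Omega_y$ is a $\mathbb B$-valued measure on $(X,\Sigma_X)$ of bounded variation, and for $\nu$-a.e. $y\in Y$ one has $\|\Omega_y\|_{\mathbb B}(X)=1$, $\{y\}\in\Sigma_Y$ and $\|\Omega_y\|_{\mathbb B}(X\setminus\varphi^{-1}(\{y\}))=0$; (ii) for every $f\in\mathcal L^\infty(\Sigma_X)$ the map $Y\ni y\mapsto\int f\,d\Omega_y\in\mathbb B$ is strongly measurable with respect to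 $(Y,\Sigma_Y,\nu)$; (iii) $\int f\,d\Omega=\int_Y\big(\int f\,d\Omega_y\big)\,d\nu(y)$ (Bochner integral) for every $f\in\mathcal L^\infty(\Sigma_X)$. Here $\Sigma_X=\mathscr B(X)$ and $\Sigma_Y=\mathscr B(Y)$. *)

theory Defs
  imports "HOL-Analysis.Analysis"
begin

text \<open>
  A Banach-valued measure on \<open>M\<close> is a set function of which only the values on \<open>sets M\<close> matter;
  the \<open>measure\<close> argument \<open>M\<close> of the next definitions only contributes \<open>space M\<close> and \<open>sets M\<close>.
  Convergence of the series is convergence in norm, and \<open>\<Omega> {} = 0\<close> follows.
\<close>

definition vector_measure :: "'x measure \<Rightarrow> ('x set \<Rightarrow> 'b::banach) \<Rightarrow> bool" where
  "vector_measure M \<Omega> \<longleftrightarrow>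
     (\<forall>A::nat \<Rightarrow> 'x set. range A \<subseteq> sets M \<longrightarrow> disjoint_family A \<longrightarrow>
        (\<lambda>n. \<Omega> (A n)) sums \<Omega> (\<Union>n. A n))"

text \<open>
  \<open>partition_on\<close> forbids empty blocks, which contribute nothing to the sum; hence partitions
  can be taken as sets of sets instead of indexed families.
\<close>

definition variation :: "'x measure \<Rightarrow> ('x set \<Rightarrow> 'b::banach) \<Rightarrow> 'x set \<Rightarrow> ennreal" where
  "variation M \<Omega> E =
     (SUP P \<in> {P. finite P \<and> P \<subseteq> sets M \<and> partition_on E P}. \<Sum>A\<in>P. ennreal (norm (\<Omega> A)))"

definition bounded_variation :: "'x measure \<Rightarrow> ('x set \<Rightarrow> 'b::banach) \<Rightarrow> bool" where
  "bounded_variation M \<Omega> \<longleftrightarrow> variation M \<Omega> (space M) < \<infinity>"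

text \<open>
  The variation of a vector measure is countably additive, so \<open>measure_of\<close> does not
  fall back to the zero measure here.
\<close>

definition variation_measure :: "'x measure \<Rightarrow> ('x set \<Rightarrow> 'b::banach) \<Rightarrow> 'x measure" where
  "variation_measure M \<Omega> = measure_of (space M) (sets M) (variation M \<Omega>)"

definition bounded_measurable :: "'x measure \<Rightarrow> ('x \<Rightarrow> real) set" where
  "bounded_measurable M = {f \<in> borel_measurable M. \<exists>K. \<forall>x\<in>space M. \<bar>f x\<bar> \<le> K}"

text \<open>The inserted \<open>0\<close> only matters when \<open>space M\<close> is empty.\<close>

definition sup_norm :: "'x measure \<Rightarrow> ('x \<Rightarrow> real) \<Rightarrow> real" where
  "sup_norm M f = Sup (insert 0 ((\<lambda>x. \<bar>f x\<bar>) ` space M))"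

text \<open>
  Setting the operator to \<open>0\<close> outside \<open>bounded_measurable M\<close> makes it unique as a total function.
  Functions that agree on \<open>space M\<close> are identified by the continuity clause.
\<close>

definition is_integral_operator ::
  "'x measure \<Rightarrow> ('x set \<Rightarrow> 'b::banach) \<Rightarrow> (('x \<Rightarrow> real) \<Rightarrow> 'b) \<Rightarrow> bool" where
  "is_integral_operator M \<Omega> T \<longleftrightarrow>
     (\<forall>f\<in>bounded_measurable M. \<forall>g\<in>bounded_measurable M. T (\<lambda>x. f x + g x) = T f + T g) \<and>
     (\<forall>f\<in>bounded_measurable M. \<forall>c. T (\<lambda>x. c * f x) = c *\<^sub>R T f) \<and>
     (\<exists>C. \<forall>f\<in>bounded_measurable M. norm (T f) \<le> C * sup_norm M f) \<and>
     (\<forall>E\<in>sets M. T (indicator E) = \<Omega> E) \<and>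
     (\<forall>f. f \<notin> bounded_measurable M \<longrightarrow> T f = 0)"

definition vector_integral ::
  "'x measure \<Rightarrow> ('x set \<Rightarrow> 'b::banach) \<Rightarrow> ('x \<Rightarrow> real) \<Rightarrow> 'b" where
  "vector_integral M \<Omega> = (THE T. is_integral_operator M \<Omega> T)"

text \<open>
  The library's \<^const>\<open>has_bochner_integral\<close> requires a second countable codomain. The following
  versions are for arbitrary Banach spaces, where measurability has to be supplemented by a.e.
  approximability by simple maps. The simple maps are exactly those satisfying the hidden library
  constant \<^const>\<open>Bochner_Integration.simple_bochner_integrable\<close>, which needs no separability.
\<close>

definition strongly_measurable :: "'y measure \<Rightarrow> ('y \<Rightarrow> 'b::banach) \<Rightarrow> bool" where
  "strongly_measurable \<nu> f \<longleftrightarrow>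
     f \<in> borel_measurable (completion \<nu>) \<and>
     (\<exists>s. (\<forall>n. Bochner_Integration.simple_bochner_integrable \<nu> (s n)) \<and>
          (AE y in \<nu>. (\<lambda>n. s n y) \<longlonglongrightarrow> f y))"

definition has_Bochner_integral_strong ::
  "'y measure \<Rightarrow> ('y \<Rightarrow> 'b::banach) \<Rightarrow> 'b \<Rightarrow> bool" where
  "has_Bochner_integral_strong \<nu> f v \<longleftrightarrow>
     strongly_measurable \<nu> f \<and>
     (\<exists>s. (\<forall>n. Bochner_Integration.simple_bochner_integrable \<nu> (s n)) \<and>
          (\<lambda>n. \<integral>\<^sup>+ y. ennreal (norm (f y - s n y)) \<partial>completion \<nu>) \<longlonglongrightarrow> 0 \<and>
          (\<lambda>n. Bochner_Integration.simple_bochner_integral \<nu> (s n)) \<longlonglongrightarrow> v)"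

text \<open>
  HOL cannot quantify over types inside a formula, so the carrier type \<open>'u\<close> of the
  measure spaces is a parameter. The \<open>\<sigma>\<close>-algebra and the measure on it are arbitrary.
\<close>

definition radon_nikodym_property_on :: "'u itself \<Rightarrow> 'b::banach itself \<Rightarrow> bool" where
  "radon_nikodym_property_on (_ :: 'u itself) (_ :: 'b itself) \<longleftrightarrow>
     (\<forall>(\<mu> :: 'u measure) (\<Omega> :: 'u set \<Rightarrow> 'b).
        sigma_finite_measure \<mu> \<longrightarrow> vector_measure \<mu> \<Omega> \<longrightarrow> bounded_variation \<mu> \<Omega> \<longrightarrow>
        (\<forall>N\<in>null_sets \<mu>. \<Omega> N = 0) \<longrightarrow>
        (\<exists>g. (\<exists>v. has_Bochner_integral_strong \<mu> g v) \<and>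
             (\<forall>E\<in>sets \<mu>. has_Bochner_integral_strong \<mu> (\<lambda>x. indicator E x *\<^sub>R g x) (\<Omega> E))))"

text \<open>
  The carrier type \<open>real\<close> loses nothing: the property for all \<open>\<sigma>\<close>-finite measure spaces trivially
  implies it for those carried by \<open>real\<close>, and conversely it is classical that already Lebesgue
  measure on \<open>[0, 1]\<close> detects the Radon--Nikodym property. As a hypothesis, the property below is
  therefore at most as strong as the one quantifying over all measure spaces.
\<close>

definition radon_nikodym_property :: "'b::banach itself \<Rightarrow> bool" where
  "radon_nikodym_property B \<longleftrightarrow> radon_nikodym_property_on TYPE(real) B"

definition is_disintegration ::
  "'x measure \<Rightarrow> 'y measure \<Rightarrow> ('x \<Rightarrow> 'y) \<Rightarrow> ('x set \<Rightarrow> 'b::banach) \<Rightarrow>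
   ('y \<Rightarrow> 'x set \<Rightarrow> 'b) \<Rightarrow> bool" where
  "is_disintegration MX MY \<phi> \<Omega> D \<longleftrightarrow>
     (let \<nu> = distr (variation_measure MX \<Omega>) MY \<phi> in
       (\<forall>y\<in>space MY. vector_measure MX (D y) \<and> bounded_variation MX (D y)) \<and>
       (AE y in \<nu>. variation MX (D y) (space MX) = 1 \<and> {y} \<in> sets MY \<and>
          variation MX (D y) (space MX - \<phi> -` {y}) = 0) \<and>
       (\<forall>f\<in>bounded_measurable MX. strongly_measurable \<nu> (\<lambda>y. vector_integral MX (D y) f)) \<and>
       (\<forall>f\<in>bounded_measurable MX.
          has_Bochner_integral_strong \<nu> (\<lambda>y. vector_integral MX (D y) f)
            (vector_integral MX \<Omega> f)))"

end

theory Submission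
  imports Defs
begin

text \<open>
  Let \<open>\<mu>\<close> be the variation of \<open>\<Omega>\<close> and \<open>\<nu>\<close> its pushforward. The Radon--Nikodym property gives a density
  of \<open>\<Omega>\<close> with respect to \<open>\<mu>\<close>, hence simple maps \<open>s n\<close> of norm at most 1 that are Cauchy in
  \<open>L\<^sup>1(\<mu>)\<close> with summable increments and whose indefinite integrals converge to \<open>\<Omega>\<close>. If \<open>\<kappa> y\<close> disintegrates the
  scalar measure \<open>\<mu>\<close>, then for almost every \<open>y\<close> the increments are also summable in \<open>L\<^sup>1(\<kappa> y)\<close>, and
  \<open>\<Omega>\<^sub>y E = lim (\<integral>\<^sub>E s n d\<kappa> y)\<close> is the disintegration. Only integrals of simple maps occur on the fibres, so
  no integration theory for non-separable Banach spaces is needed. Because \<open>\<parallel>\<Omega>\<^sub>y\<parallel> \<le> \<kappa> y\<close>, the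
  fibre measures are concentrated on the fibres of \<open>\<phi>\<close> and have variation at most 1.
\<close>


section \<open>Integrals of scalar functions against simple maps\<close>

text \<open>Three features of the definitions shape the argument. The Radon--Nikodym hypothesis
  speaks only of measure spaces carried by \<open>real\<close>, so \<open>\<Omega>\<close> is pushed
  to the line along a Borel injection with Borel left inverse, and the approximants found there are
  pulled back; the same coding reduces the scalar disintegration to real random variables. Next, one
  null set of fibres has to serve all test functions: if \<open>\<bar>f\<bar> \<le> K\<close>, an
  increment of the integrals of \<open>f\<close> is at most \<open>K\<close> times the increment of
  the maps in \<open>L\<^sup>1(\<kappa> y)\<close>, so summability of the latter, a condition on
  \<open>y\<close> alone, gives convergence for all \<open>f\<close> at once. Finally, every
  \<open>\<Omega>\<^sub>y\<close>, and not only almost every one, must be a measure of bounded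
  variation; on bad fibres the kernel is therefore replaced by the null measure. The bound 1 on the
  approximants comes from averaging: \<open>\<Omega> A / \<mu> A\<close> has norm at most 1.
  Equality of the fibre variation with 1 then follows because \<open>\<nu>\<close> has the same
  total mass as the variation of \<open>\<Omega>\<close>.\<close>

definition simple_int :: "'x measure \<Rightarrow> ('x \<Rightarrow> 'b::real_normed_vector) \<Rightarrow> ('x \<Rightarrow> real) \<Rightarrow> 'b" where
  "simple_int m s f = (\<Sum>v\<in>s ` space m. (\<integral>x. indicator (s -` {v}) x * f x \<partial>m) *\<^sub>R v)"

lemma integrable_fibre:
  fixes f :: "'x \<Rightarrow> real"
  assumes "simple_function m p" "integrable m f"
  shows "integrable m (\<lambda>x. indicator (p -` A) x * f x)"
proof -
  have "integrable m (\<lambda>x. indicator (p -` A \<inter> space m) x *\<^sub>R f x)"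
    using assms by (intro integrable_mult_indicator simple_functionD)
  then show ?thesis
    by (rule Bochner_Integration.integrable_cong[THEN iffD1, rotated -1])
       (auto simp: indicator_def)
qed

text \<open>The fibre of a value \<open>v\<close> of the composite is the disjoint union of the
  fibres of those \<open>c\<close> with \<open>F c = v\<close>, so the sum regroups. This makes
  \<open>simple_int\<close> computable on any finer simple map \<open>p\<close>, in particular on a
  pair of maps serving as their common refinement.\<close>

lemma simple_int_compose:
  fixes F :: "'c \<Rightarrow> 'b::real_normed_vector"
  assumes p: "simple_function m p" and f: "integrable m f"
  shows "simple_int m (\<lambda>x. F (p x)) f =
    (\<Sum>c\<in>p ` space m. (\<integral>x. indicator (p -` {c}) x * f x \<partial>m) *\<^sub>R F c)"
proof -
  let ?i = "\<lambda>c. \<integral>x. indicator (p -` {c}) x * f x \<partial>m"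
  let ?C = "p ` space m"
  have fin: "finite ?C" using p by (rule simple_functionD)
  have "(\<integral>x. indicator ((\<lambda>x. F (p x)) -` {v}) x * f x \<partial>m) = (\<Sum>c\<in>{c\<in>?C. F c = v}. ?i c)" for v
  proof -
    have "(\<integral>x. indicator ((\<lambda>x. F (p x)) -` {v}) x * f x \<partial>m) =
      (\<integral>x. (\<Sum>c\<in>{c\<in>?C. F c = v}. indicator (p -` {c}) x * f x) \<partial>m)"
    proof (rule Bochner_Integration.integral_cong[OF refl])
      fix x assume x: "x \<in> space m"
      have "(\<Sum>c\<in>{c\<in>?C. F c = v}. indicator (p -` {c}) x * f x) =
        (\<Sum>c\<in>{c\<in>?C. F c = v}. if c = p x then f x else 0)"
        by (rule sum.cong) (auto simp: indicator_def)
      also have "\<dots> = indicator ((\<lambda>x. F (p x)) -` {v}) x * f x"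
        using x fin by (subst sum.delta) (auto simp: indicator_def)
      finally show "indicator ((\<lambda>x. F (p x)) -` {v}) x * f x =
        (\<Sum>c\<in>{c\<in>?C. F c = v}. indicator (p -` {c}) x * f x)" by simp
    qed
    also have "\<dots> = (\<Sum>c\<in>{c\<in>?C. F c = v}. ?i c)"
      using p f by (intro Bochner_Integration.integral_sum integrable_fibre)
    finally show ?thesis .
  qed
  then have "simple_int m (\<lambda>x. F (p x)) f =
      (\<Sum>v\<in>F ` ?C. \<Sum>c\<in>{c\<in>?C. F c = v}. ?i c *\<^sub>R F c)"
    unfolding simple_int_def image_image[symmetric, of F p]
    by (intro sum.cong) (auto simp: scaleR_sum_left)
  also have "\<dots> = (\<Sum>c\<in>?C. ?i c *\<^sub>R F c)"
    using fin by (intro sum.group) auto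
  finally show ?thesis .
qed

text \<open>Both maps and their difference are functions of the pair map, so all three integrals
  become sums over the same finite index set.\<close>

lemma simple_int_diff:
  assumes s: "simple_function m s" and t: "simple_function m t" and f: "integrable m f"
  shows "simple_int m s f - simple_int m t f = simple_int m (\<lambda>x. s x - t x) f"
proof -
  have p: "simple_function m (\<lambda>x. (s x, t x))"
    using s t by (rule simple_function_Pair)
  show ?thesis
    using simple_int_compose[OF p f, of fst] simple_int_compose[OF p f, of snd]
      simple_int_compose[OF p f, of "\<lambda>(a, b). a - b"]
    by (simp add: case_prod_beta scaleR_diff_right sum_subtractf)
qed

lemma simple_int_add:
  assumes "simple_function m s" "integrable m f" "integrable m g"
  shows "simple_int m s (\<lambda>x. f x + g x) = simple_int m s f + simple_int m s g"
  using assms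
  by (simp add: simple_int_def integrable_fibre distrib_left scaleR_add_left sum.distrib)

lemma simple_int_cmult:
  "simple_int m s (\<lambda>x. c * f x) = c *\<^sub>R simple_int m s f"
  unfolding simple_int_def scaleR_sum_right by (simp add: mult.left_commute[of _ c])

lemma integrable_mult_simple_norm:
  fixes s :: "'x \<Rightarrow> 'b::real_normed_vector" and f :: "'x \<Rightarrow> real"
  assumes s: "simple_function m s" and f: "integrable m f"
  shows "integrable m (\<lambda>x. \<bar>f x\<bar> * norm (s x))"
\<comment> \<open>The norm of a simple map is bounded by the sum of the norms of its finitely many
  values.\<close>
proof (rule Bochner_Integration.integrable_bound[where f="\<lambda>x. \<bar>f x\<bar> * (\<Sum>v\<in>s ` space m. norm v)"])
  have "simple_function m (\<lambda>x. norm (s x))"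
    using s by (rule simple_function_compose1)
  then show "(\<lambda>x. \<bar>f x\<bar> * norm (s x)) \<in> borel_measurable m"
    using f by (auto intro: borel_measurable_simple_function borel_measurable_times)
  have "finite (s ` space m)" using s by (rule simple_functionD)
  then show "AE x in m. norm (\<bar>f x\<bar> * norm (s x)) \<le> norm (\<bar>f x\<bar> * (\<Sum>v\<in>s ` space m. norm v))"
    by (auto intro!: mult_left_mono member_le_sum simp: abs_mult sum_nonneg)
qed (use f in auto)

text \<open>Triangle inequality over the fibres of \<open>s\<close>, after which the pieces are
  glued together under one scalar integral. The factor \<open>norm (s x)\<close> stays inside for
  two purposes: it is at most 1 for the approximants, and it yields the Cauchy estimate for their
  increments.\<close>

lemma norm_simple_int_le:
  fixes s :: "'x \<Rightarrow> 'b::real_normed_vector"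
  assumes s: "simple_function m s" and f: "integrable m f"
  shows "norm (simple_int m s f) \<le> (\<integral>x. \<bar>f x\<bar> * norm (s x) \<partial>m)"
proof -
  have fin: "finite (s ` space m)" using s by (rule simple_functionD)
  have "norm (simple_int m s f) \<le>
    (\<Sum>v\<in>s ` space m. (\<integral>x. indicator (s -` {v}) x * \<bar>f x\<bar> \<partial>m) * norm v)"
  proof (unfold simple_int_def, rule sum_norm_le)
    fix v
    have "\<bar>\<integral>x. indicator (s -` {v}) x * f x \<partial>m\<bar> \<le> (\<integral>x. \<bar>indicator (s -` {v}) x * f x\<bar> \<partial>m)"
      by (rule integral_abs_bound)
    then show "norm ((\<integral>x. indicator (s -` {v}) x * f x \<partial>m) *\<^sub>R v) \<le>
      (\<integral>x. indicator (s -` {v}) x * \<bar>f x\<bar> \<partial>m) * norm v"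
      by (simp add: abs_mult mult_right_mono)
  qed
  also have "\<dots> = (\<integral>x. (\<Sum>v\<in>s ` space m. indicator (s -` {v}) x * \<bar>f x\<bar> * norm v) \<partial>m)"
    using s f by (subst Bochner_Integration.integral_sum)
      (auto intro!: integrable_fibre integrable_mult_left)
  also have "\<dots> = (\<integral>x. \<bar>f x\<bar> * norm (s x) \<partial>m)"
  proof (rule Bochner_Integration.integral_cong[OF refl])
    fix x assume x: "x \<in> space m"
    have "(\<Sum>v\<in>s ` space m. indicator (s -` {v}) x * \<bar>f x\<bar> * norm v) =
      (\<Sum>v\<in>s ` space m. if v = s x then \<bar>f x\<bar> * norm (s x) else 0)"
      by (rule sum.cong) (auto simp: indicator_def)
    then show "(\<Sum>v\<in>s ` space m. indicator (s -` {v}) x * \<bar>f x\<bar> * norm v) = \<bar>f x\<bar> * norm (s x)"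
      using x fin by simp
  qed
  finally show ?thesis .
qed

text \<open>The bridge between \<open>simple_int\<close> and the integral of simple maps from which
  the Bochner integral is built. Both sides are expanded over the values of the pair of
  \<open>indicator E\<close> and \<open>s\<close>.\<close>

lemma simple_bochner_integral_indicator:
  fixes s :: "'x \<Rightarrow> 'b::real_normed_vector"
  assumes "finite_measure m" and s: "simple_function m s" and E: "E \<in> sets m"
  shows "Bochner_Integration.simple_bochner_integral m (\<lambda>x. indicator E x *\<^sub>R s x) =
    simple_int m s (indicator E)"
proof -
  interpret finite_measure m by fact
  have fE: "simple_function m (\<lambda>x. indicator E x :: real)"
    using E by (rule simple_function_indicator)
  have p: "simple_function m (\<lambda>x. (indicator E x :: real, s x))"
    using fE s by (rule simple_function_Pair)
  let ?g = "\<lambda>x. indicator E x *\<^sub>R s x"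
  have g: "simple_function m ?g"
    using simple_function_compose1[OF p, of "\<lambda>(a, b). a *\<^sub>R b"] by simp
  have 1: "integrable m (\<lambda>x. 1::real)" by simp
  have iE: "integrable m (indicator E :: _ \<Rightarrow> real)"
    using E by (intro integrable_real_indicator) (auto simp: less_top[symmetric])
  have "Bochner_Integration.simple_bochner_integral m ?g = simple_int m ?g (\<lambda>_. 1)"
    unfolding Bochner_Integration.simple_bochner_integral_def simple_int_def
    by (intro sum.cong refl arg_cong2[where f=scaleR])
       (auto simp: Int_def conj_commute intro!: arg_cong[where f="measure m"])
  also have "\<dots> = (\<Sum>c\<in>(\<lambda>x. (indicator E x :: real, s x)) ` space m.
      (\<integral>x. indicator ((\<lambda>x. (indicator E x :: real, s x)) -` {c}) x * 1 \<partial>m) *\<^sub>R (fst c *\<^sub>R snd c))"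
    using simple_int_compose[OF p 1, of "\<lambda>(a, b). a *\<^sub>R b"] by (simp add: case_prod_beta)
  also have "\<dots> = (\<Sum>c\<in>(\<lambda>x. (indicator E x :: real, s x)) ` space m.
      (\<integral>x. indicator ((\<lambda>x. (indicator E x :: real, s x)) -` {c}) x * indicator E x \<partial>m) *\<^sub>R snd c)"
  proof (intro sum.cong refl)
    fix c assume "c \<in> (\<lambda>x. (indicator E x :: real, s x)) ` space m"
    let ?P = "(\<lambda>x. (indicator E x :: real, s x)) -` {c}"
    \<comment> \<open>On the fibre of \<open>c\<close> the indicator of \<open>E\<close> is the
      constant \<open>fst c\<close>, so this factor moves from the vector coefficient into the
      integrand.\<close>
    have "indicator ?P x * indicator E x = (indicator ?P x * 1) * fst c" for x
      by (auto simp: indicator_def)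
    then have "(\<integral>x. indicator ?P x * indicator E x \<partial>m) = (\<integral>x. (indicator ?P x * 1) * fst c \<partial>m)"
      by (rule arg_cong[OF ext])
    also have "\<dots> = (\<integral>x. indicator ?P x * 1 \<partial>m) * fst c"
      by (rule integral_mult_left_zero)
    finally show "(\<integral>x. indicator ?P x * 1 \<partial>m) *\<^sub>R (fst c *\<^sub>R snd c) =
        (\<integral>x. indicator ?P x * indicator E x \<partial>m) *\<^sub>R snd c"
      by simp
  qed
  also have "\<dots> = simple_int m s (indicator E)"
    using simple_int_compose[OF p iE, of snd] by simp
  finally show ?thesis .
qed

section \<open>The variation of a vector measure\<close>

lemma variation_upper:
  assumes "finite P" "P \<subseteq> sets M" "partition_on E P"
  shows "(\<Sum>A\<in>P. ennreal (norm (\<Omega> A))) \<le> variation M \<Omega> E"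
  unfolding variation_def using assms by (intro SUP_upper) auto

lemma variation_least:
  assumes "\<And>P. finite P \<Longrightarrow> P \<subseteq> sets M \<Longrightarrow> partition_on E P \<Longrightarrow>
    (\<Sum>A\<in>P. ennreal (norm (\<Omega> A))) \<le> c"
  shows "variation M \<Omega> E \<le> c"
  unfolding variation_def using assms by (intro SUP_least) auto

lemma vector_measure_empty:
  assumes "vector_measure M \<Omega>"
  shows "\<Omega> {} = 0"
proof -
  have "(\<lambda>n::nat. \<Omega> {}) sums \<Omega> (\<Union>n::nat. {})"
    by (intro assms[unfolded vector_measure_def, rule_format]) (auto simp: disjoint_family_on_def)
  then have "(\<lambda>n::nat. \<Omega> {}) \<longlonglongrightarrow> 0"
    by (intro summable_LIMSEQ_zero sums_summable)
  then show ?thesis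
    by (simp add: LIMSEQ_const_iff)
qed

text \<open>A disjoint family becomes a partition once the remainder of \<open>E\<close> is added as
  a further block. Empty members are dropped first: they have value 0, are not allowed as blocks,
  and may coincide for different indices.\<close>

lemma sum_norm_le_variation:
  fixes A :: "'i \<Rightarrow> 'x set"
  assumes \<Omega>: "vector_measure M \<Omega>" and I: "finite I" and A: "A ` I \<subseteq> sets M"
    and disj: "disjoint_family_on A I" and sub: "(\<Union>i\<in>I. A i) \<subseteq> E" and E: "E \<in> sets M"
  shows "(\<Sum>i\<in>I. ennreal (norm (\<Omega> (A i)))) \<le> variation M \<Omega> E"
proof -
  let ?J = "{i\<in>I. A i \<noteq> {}}"
  let ?R = "E - (\<Union>i\<in>I. A i)"
  let ?P = "A ` ?J \<union> ({?R} - {{}})"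
  have U: "(\<Union>i\<in>I. A i) \<in> sets M" using I A by auto
  have inj: "inj_on A ?J"
    using disj by (auto simp: inj_on_def disjoint_family_on_def)
  have "(\<Sum>i\<in>I. ennreal (norm (\<Omega> (A i)))) = (\<Sum>i\<in>?J. ennreal (norm (\<Omega> (A i))))"
    using I by (intro sum.mono_neutral_right) (auto simp: vector_measure_empty[OF \<Omega>])
  also have "\<dots> = (\<Sum>B\<in>A ` ?J. ennreal (norm (\<Omega> B)))"
    using inj by (simp add: sum.reindex)
  also have "\<dots> \<le> (\<Sum>B\<in>?P. ennreal (norm (\<Omega> B)))"
    using I by (intro sum_mono2) auto
  also have "\<dots> \<le> variation M \<Omega> E"
  proof (rule variation_upper)
    show "finite ?P" using I by auto
    show "?P \<subseteq> sets M" using A E U by auto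
    show "partition_on E ?P"
    proof (rule partition_onI)
      have "\<Union> (A ` ?J) = (\<Union>i\<in>I. A i)" by auto
      moreover have "\<Union> ({R} - {{}}) = R" for R :: "'x set" by auto
      ultimately show "\<Union> ?P = E" using sub by (simp only: Union_Un_distrib) auto
      have AA: "A i \<inter> A j = {}" if "i \<in> I" "j \<in> I" "A i \<noteq> A j" for i j
        using that by (intro disjoint_family_onD[OF disj]) auto
      show "disjnt p q" if pq: "p \<in> ?P" "q \<in> ?P" "p \<noteq> q" for p q
      proof -
        consider "p \<in> A ` ?J" "q \<in> A ` ?J" | "p \<in> A ` ?J" "q = ?R" | "p = ?R" "q \<in> A ` ?J"
          using pq by blast
        then show ?thesis
        proof cases
          case 1
          then show ?thesis using AA pq(3) unfolding disjnt_def by blast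
        qed (unfold disjnt_def, blast+)
      qed
      show "{} \<notin> ?P" by blast
    qed
  qed
  finally show ?thesis .
qed

lemma norm_le_variation:
  assumes "vector_measure M \<Omega>" "E \<in> sets M"
  shows "ennreal (norm (\<Omega> E)) \<le> variation M \<Omega> E"
  using sum_norm_le_variation[of M \<Omega> "{()}" "\<lambda>_. E" E] assms
  by (simp add: disjoint_family_on_def)

lemma variation_mono:
  assumes \<Omega>: "vector_measure M \<Omega>" and "A \<subseteq> B" "B \<in> sets M"
  shows "variation M \<Omega> A \<le> variation M \<Omega> B"
proof (rule variation_least)
  fix P assume P: "finite P" "P \<subseteq> sets M" "partition_on A P"
  then show "(\<Sum>A\<in>P. ennreal (norm (\<Omega> A))) \<le> variation M \<Omega> B"
    using sum_norm_le_variation[OF \<Omega>, of P "\<lambda>x. x" B] assms(2,3)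
    by (auto simp: partition_on_def disjoint_family_on_def disjoint_def)
qed

lemma variation_empty:
  "variation M \<Omega> {} = 0"
proof -
  have "variation M \<Omega> {} \<le> 0"
    by (rule variation_least) (auto simp: partition_on_empty)
  then show ?thesis by simp
qed

text \<open>Partitions of the two sets unite to a partition of the union. The suprema over
  \<open>P\<close> and \<open>Q\<close> are then taken one after the other, which requires both
  collections of partitions to be nonempty.\<close>

lemma variation_add_le:
  assumes \<Omega>: "vector_measure M \<Omega>" and "A \<in> sets M" "B \<in> sets M" "A \<inter> B = {}"
  shows "variation M \<Omega> A + variation M \<Omega> B \<le> variation M \<Omega> (A \<union> B)"
proof -
  let ?S = "\<lambda>E. {P. finite P \<and> P \<subseteq> sets M \<and> partition_on E P}"
  have ne: "?S E \<noteq> {}" if "E \<in> sets M" for E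
  proof (cases "E = {}")
    case True
    then have "{} \<in> ?S E" by (simp add: partition_on_empty)
    then show ?thesis by blast
  next
    case False
    then have "{E} \<in> ?S E" using that by (simp add: partition_on_space)
    then show ?thesis by blast
  qed
  have *: "(\<Sum>D\<in>P. ennreal (norm (\<Omega> D))) + (\<Sum>D\<in>Q. ennreal (norm (\<Omega> D))) \<le> variation M \<Omega> (A \<union> B)"
    if P: "P \<in> ?S A" and Q: "Q \<in> ?S B" for P Q
  proof -
    have PQ: "P \<inter> Q = {}"
    proof (rule ccontr)
      assume "P \<inter> Q \<noteq> {}"
      then obtain D where "D \<in> P" "D \<in> Q" by auto
      then have "D \<subseteq> A" "D \<subseteq> B" "D \<noteq> {}" using P Q by (auto simp: partition_on_def)
      then show False using assms(4) by auto
    qed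
    have "partition_on (A \<union> B) (P \<union> Q)"
    proof (rule partition_onI)
      show "disjnt p q" if pq: "p \<in> P \<union> Q" "q \<in> P \<union> Q" "p \<noteq> q" for p q
      proof -
        have "p \<subseteq> A" if "p \<in> P" for p using P that by (auto simp: partition_on_def)
        moreover have "q \<subseteq> B" if "q \<in> Q" for q using Q that by (auto simp: partition_on_def)
        moreover have "disjoint P" "disjoint Q" using P Q by (auto simp: partition_on_def)
        ultimately have sub: "\<And>p. p \<in> P \<Longrightarrow> p \<subseteq> A" "\<And>q. q \<in> Q \<Longrightarrow> q \<subseteq> B" "disjoint P" "disjoint Q"
          by simp_all
        consider "p \<in> P" "q \<in> P" | "p \<in> P" "q \<in> Q" | "p \<in> Q" "q \<in> P" | "p \<in> Q" "q \<in> Q"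
          using pq by blast
        then show ?thesis
        proof cases
          case 1
          then show ?thesis using sub(3) pq(3) by (simp add: disjoint_def disjnt_def)
        next
          case 2
          then show ?thesis using sub(1)[of p] sub(2)[of q] assms(4) by (auto simp: disjnt_def)
        next
          case 3
          then show ?thesis using sub(1)[of q] sub(2)[of p] assms(4) by (auto simp: disjnt_def)
        next
          case 4
          then show ?thesis using sub(4) pq(3) by (simp add: disjoint_def disjnt_def)
        qed
      qed
    qed (use P Q in \<open>auto simp: partition_on_def\<close>)
    then have "(\<Sum>D\<in>P \<union> Q. ennreal (norm (\<Omega> D))) \<le> variation M \<Omega> (A \<union> B)"
      using P Q by (intro variation_upper) auto
    moreover have "finite P" "finite Q" using P Q by auto
    ultimately show ?thesis
      using sum.union_disjoint[of P Q "\<lambda>D. ennreal (norm (\<Omega> D))"] PQ by metis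
  qed
  have "variation M \<Omega> A + variation M \<Omega> B =
    (SUP P\<in>?S A. (\<Sum>D\<in>P. ennreal (norm (\<Omega> D))) + variation M \<Omega> B)"
    unfolding variation_def[of M \<Omega> A] using ne[OF assms(2)] by (subst ennreal_SUP_add_left) auto
  also have "\<dots> \<le> variation M \<Omega> (A \<union> B)"
  proof (rule SUP_least)
    fix P assume P: "P \<in> ?S A"
    have "(\<Sum>D\<in>P. ennreal (norm (\<Omega> D))) + variation M \<Omega> B =
      (SUP Q\<in>?S B. (\<Sum>D\<in>P. ennreal (norm (\<Omega> D))) + (\<Sum>D\<in>Q. ennreal (norm (\<Omega> D))))"
      unfolding variation_def[of M \<Omega> B] using ne[OF assms(3)] by (subst ennreal_SUP_add_right) auto
    also have "\<dots> \<le> variation M \<Omega> (A \<union> B)"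
      using * P by (intro SUP_least) auto
    finally show "(\<Sum>D\<in>P. ennreal (norm (\<Omega> D))) + variation M \<Omega> B \<le> variation M \<Omega> (A \<union> B)" .
  qed
  finally show ?thesis .
qed

lemma sum_variation_le:
  fixes A :: "nat \<Rightarrow> 'x set"
  assumes \<Omega>: "vector_measure M \<Omega>" and A: "range A \<subseteq> sets M" "disjoint_family A"
  shows "(\<Sum>i<n. variation M \<Omega> (A i)) \<le> variation M \<Omega> (\<Union>i<n. A i)"
proof (induction n)
  case (Suc n)
  have "(\<Sum>i<Suc n. variation M \<Omega> (A i)) \<le> variation M \<Omega> (\<Union>i<n. A i) + variation M \<Omega> (A n)"
    using Suc by (simp add: add_mono)
  also have "\<dots> \<le> variation M \<Omega> ((\<Union>i<n. A i) \<union> A n)"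
  proof (rule variation_add_le[OF \<Omega>])
    show "(\<Union>i<n. A i) \<inter> A n = {}"
    proof -
      have "A i \<inter> A n = {}" if "i < n" for i
        using A(2) that unfolding disjoint_family_on_def by (metis UNIV_I less_irrefl)
      then show ?thesis by blast
    qed
  qed (use A in auto)
  also have "(\<Union>i<n. A i) \<union> A n = (\<Union>i<Suc n. A i)"
    by (auto simp: less_Suc_eq)
  finally show ?case .
qed (simp add: variation_empty)

text \<open>Superadditivity on finite unions gives one inequality. For the other, a partition of the
  union is cut by the \<open>A i\<close>: countable additivity of \<open>\<Omega>\<close> bounds
  each block by its pieces, and after exchanging the sums the pieces inside a fixed
  \<open>A i\<close> form a finite disjoint family.\<close>

lemma variation_countably_additive:
  assumes \<Omega>: "vector_measure M \<Omega>" and A: "range A \<subseteq> sets M" "disjoint_family A"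
  shows "(\<Sum>i. variation M \<Omega> (A i)) = variation M \<Omega> (\<Union>i. A i)"
proof (rule antisym)
  have U: "(\<Union>i. A i) \<in> sets M" using A by auto
  have "(\<Sum>i. variation M \<Omega> (A i)) = (SUP n. \<Sum>i<n. variation M \<Omega> (A i))"
    by (rule suminf_eq_SUP)
  also have "\<dots> \<le> variation M \<Omega> (\<Union>i. A i)"
  proof (rule SUP_least)
    fix n :: nat
    have "(\<Sum>i<n. variation M \<Omega> (A i)) \<le> variation M \<Omega> (\<Union>i<n. A i)"
      by (rule sum_variation_le[OF \<Omega> A])
    also have "\<dots> \<le> variation M \<Omega> (\<Union>i. A i)"
      by (rule variation_mono[OF \<Omega> _ U]) auto
    finally show "(\<Sum>i<n. variation M \<Omega> (A i)) \<le> variation M \<Omega> (\<Union>i. A i)" .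
  qed
  finally show "(\<Sum>i. variation M \<Omega> (A i)) \<le> variation M \<Omega> (\<Union>i. A i)" .
  show "variation M \<Omega> (\<Union>i. A i) \<le> (\<Sum>i. variation M \<Omega> (A i))"
  proof (rule variation_least)
    fix P assume P: "finite P" "P \<subseteq> sets M" "partition_on (\<Union>i. A i) P"
    have le: "ennreal (norm (\<Omega> B)) \<le> (\<Sum>i. ennreal (norm (\<Omega> (B \<inter> A i))))" if "B \<in> P" for B
    proof -
      have "(\<lambda>i. \<Omega> (B \<inter> A i)) sums \<Omega> (\<Union>i. B \<inter> A i)"
      proof (rule \<Omega>[unfolded vector_measure_def, rule_format])
        show "range (\<lambda>i. B \<inter> A i) \<subseteq> sets M" using P A that by auto
        show "disjoint_family (\<lambda>i. B \<inter> A i)"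
          using A(2) by (auto simp: disjoint_family_on_def)
      qed
      moreover have "(\<Union>i. B \<inter> A i) = B"
        using P(3) that by (auto simp: partition_on_def)
      ultimately have s: "(\<lambda>i. \<Omega> (B \<inter> A i)) sums \<Omega> B" by simp
      have "(\<lambda>n. ennreal (norm (\<Sum>i<n. \<Omega> (B \<inter> A i)))) \<longlonglongrightarrow> ennreal (norm (\<Omega> B))"
        using s unfolding sums_def by (intro tendsto_intros) auto
      then show ?thesis
      proof (rule LIMSEQ_le_const2)
        have "ennreal (norm (\<Sum>i<n. \<Omega> (B \<inter> A i))) \<le> (\<Sum>i. ennreal (norm (\<Omega> (B \<inter> A i))))" for n
        proof -
          have "ennreal (norm (\<Sum>i<n. \<Omega> (B \<inter> A i))) \<le> (\<Sum>i<n. ennreal (norm (\<Omega> (B \<inter> A i))))"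
            by (simp add: ennreal_leI norm_sum)
          also have "\<dots> \<le> (\<Sum>i. ennreal (norm (\<Omega> (B \<inter> A i))))"
            by (rule sum_le_suminf) auto
          finally show ?thesis .
        qed
        then show "\<exists>N. \<forall>n\<ge>N. ennreal (norm (\<Sum>i<n. \<Omega> (B \<inter> A i))) \<le>
            (\<Sum>i. ennreal (norm (\<Omega> (B \<inter> A i))))"
          by auto
      qed
    qed
    have "(\<Sum>B\<in>P. ennreal (norm (\<Omega> B))) \<le> (\<Sum>B\<in>P. \<Sum>i. ennreal (norm (\<Omega> (B \<inter> A i))))"
      by (rule sum_mono) (rule le)
    also have "\<dots> = (\<Sum>i. \<Sum>B\<in>P. ennreal (norm (\<Omega> (B \<inter> A i))))"
      by (rule suminf_sum[symmetric]) auto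
    also have "\<dots> \<le> (\<Sum>i. variation M \<Omega> (A i))"
    proof (rule suminf_le)
      fix i
      show "(\<Sum>B\<in>P. ennreal (norm (\<Omega> (B \<inter> A i)))) \<le> variation M \<Omega> (A i)"
      proof (rule sum_norm_le_variation[OF \<Omega> P(1)])
        show "disjoint_family_on (\<lambda>B. B \<inter> A i) P"
          using P(3) unfolding partition_on_def disjoint_def disjoint_family_on_def by blast
      qed (use P A in auto)
    qed auto
    finally show "(\<Sum>B\<in>P. ennreal (norm (\<Omega> B))) \<le> (\<Sum>i. variation M \<Omega> (A i))" .
  qed
qed

lemma sets_variation_measure [measurable_cong]: "sets (variation_measure M \<Omega>) = sets M"
  and space_variation_measure: "space (variation_measure M \<Omega>) = space M"
  by (simp_all add: variation_measure_def)

lemma emeasure_variation_measure: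
  assumes \<Omega>: "vector_measure M \<Omega>" and E: "E \<in> sets M"
  shows "emeasure (variation_measure M \<Omega>) E = variation M \<Omega> E"
  unfolding variation_measure_def
proof (rule emeasure_measure_of_sigma)
  show "sigma_algebra (space M) (sets M)" by (rule sets.sigma_algebra_axioms)
  show "positive (sets M) (variation M \<Omega>)"
    by (simp add: positive_def variation_empty)
  show "countably_additive (sets M) (variation M \<Omega>)"
    by (auto simp: countably_additive_def variation_countably_additive[OF \<Omega>])
qed (fact E)

lemma finite_measure_variation_measure:
  assumes "vector_measure M \<Omega>" "bounded_variation M \<Omega>"
  shows "finite_measure (variation_measure M \<Omega>)"
  using assms
  by (intro finite_measureI)
     (auto simp: space_variation_measure emeasure_variation_measure bounded_variation_def)

lemma norm_le_measure_variation:
  assumes \<Omega>: "vector_measure M \<Omega>" and bv: "bounded_variation M \<Omega>" and E: "E \<in> sets M"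
  shows "norm (\<Omega> E) \<le> measure (variation_measure M \<Omega>) E"
proof -
  interpret finite_measure "variation_measure M \<Omega>"
    by (rule finite_measure_variation_measure[OF \<Omega> bv])
  have "ennreal (norm (\<Omega> E)) \<le> ennreal (measure (variation_measure M \<Omega>) E)"
    using norm_le_variation[OF \<Omega> E] emeasure_variation_measure[OF \<Omega> E]
    by (simp add: emeasure_eq_measure)
  then show ?thesis by (simp add: ennreal_le_iff)
qed

text \<open>Additivity of \<open>m\<close> bounds every sum in the supremum. This is used to get
  bounded variation from domination and to confine the fibre measures to their fibres.\<close>

lemma dominated_variation_le:
  assumes m: "sets m = sets M" and dom: "\<And>E. E \<in> sets M \<Longrightarrow> ennreal (norm (\<Omega> E)) \<le> emeasure m E"
    and E: "E \<in> sets M"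
  shows "variation M \<Omega> E \<le> emeasure m E"
proof (rule variation_least)
  fix P assume P: "finite P" "P \<subseteq> sets M" "partition_on E P"
  have "(\<Sum>A\<in>P. ennreal (norm (\<Omega> A))) \<le> (\<Sum>A\<in>P. emeasure m A)"
    using dom P by (intro sum_mono) auto
  also have "\<dots> = emeasure m (\<Union>A\<in>P. A)"
    using P m by (intro sum_emeasure) (auto simp: partition_on_def disjoint_family_on_def disjoint_def)
  finally show "(\<Sum>A\<in>P. ennreal (norm (\<Omega> A))) \<le> emeasure m E"
    using P by (simp add: partition_on_def)
qed

text \<open>Only finite additivity has to be checked by hand: the tail unions decrease to the empty
  set, so their \<open>m\<close>-measure, and with it the norm of \<open>\<Omega>\<close> on them,
  tends to 0.\<close>

lemma dominated_vector_measure: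
  assumes fin: "finite_measure m" and m: "sets m = sets M"
    and dom: "\<And>E. E \<in> sets M \<Longrightarrow> norm (\<Omega> E) \<le> measure m E"
    and add: "\<And>A B. A \<in> sets M \<Longrightarrow> B \<in> sets M \<Longrightarrow> A \<inter> B = {} \<Longrightarrow> \<Omega> (A \<union> B) = \<Omega> A + \<Omega> B"
  shows "vector_measure M \<Omega>"
  unfolding vector_measure_def
proof (intro allI impI)
  fix A :: "nat \<Rightarrow> _" assume A: "range A \<subseteq> sets M" "disjoint_family A"
  interpret finite_measure m by fact
  let ?R = "\<lambda>n. \<Union>i\<in>{n..}. A i"
  have split: "(\<Sum>i<n. \<Omega> (A i)) + \<Omega> (?R n) = \<Omega> (\<Union>i. A i)" for n
  proof (induction n)
    case (Suc n)
    have eq: "{n..} = insert n {Suc n..}"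
      by (rule set_eqI) (simp, arith)
    have "?R n = A n \<union> ?R (Suc n)"
      by (subst eq) (simp only: UN_insert)
    moreover have "A n \<inter> A i = {}" if "i \<ge> Suc n" for i
      using A(2) that unfolding disjoint_family_on_def by (metis UNIV_I not_less_eq_eq order_refl)
    then have "A n \<inter> ?R (Suc n) = {}" by blast
    moreover have "?R (Suc n) \<in> sets M" "A n \<in> sets M"
      using A(1) by (auto intro!: sets.countable_UN'')
    ultimately have "\<Omega> (?R n) = \<Omega> (A n) + \<Omega> (?R (Suc n))"
      using add by simp
    then show ?case using Suc by (simp add: algebra_simps)
  next
    case 0
    then show ?case by (simp add: atLeast_0)
  qed
  have "(\<lambda>n. measure m (?R n)) \<longlonglongrightarrow> measure m (\<Inter>n. ?R n)"
  proof (rule finite_Lim_measure_decseq)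
    show "range ?R \<subseteq> sets m" using A(1) m by (auto intro!: sets.countable_UN'')
    show "decseq ?R" unfolding decseq_def by (intro allI impI UN_mono) auto
  qed
  \<comment> \<open>A point of \<open>A i\<close> lies in no later set, hence in no tail starting
    after \<open>i\<close>.\<close>
  moreover have "(\<Inter>n. ?R n) = {}"
  proof (rule ccontr)
    assume "(\<Inter>n. ?R n) \<noteq> {}"
    then obtain x where x: "x \<in> ?R n" for n by blast
    obtain i where "x \<in> A i" using x[of 0] by auto
    moreover obtain j where "j \<ge> Suc i" "x \<in> A j" using x[of "Suc i"] by auto
    moreover from this have "A i \<inter> A j = {}"
      using A(2) unfolding disjoint_family_on_def by (metis UNIV_I not_less_eq_eq order_refl)
    ultimately show False by blast
  qed
  ultimately have "(\<lambda>n. measure m (?R n)) \<longlonglongrightarrow> 0" by simp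
  then have "(\<lambda>n. \<Omega> (?R n)) \<longlonglongrightarrow> 0"
  proof (rule Lim_null_comparison[rotated])
    show "\<forall>\<^sub>F n in sequentially. norm (\<Omega> (?R n)) \<le> measure m (?R n)"
      using A(1) by (intro always_eventually allI dom sets.countable_UN'') auto
  qed
  then have "(\<lambda>n. \<Omega> (\<Union>i. A i) - \<Omega> (?R n)) \<longlonglongrightarrow> \<Omega> (\<Union>i. A i) - 0"
    by (intro tendsto_intros)
  moreover have "\<Omega> (\<Union>i. A i) - \<Omega> (?R n) = (\<Sum>i<n. \<Omega> (A i))" for n
    using split[of n] by (simp add: algebra_simps)
  ultimately show "(\<lambda>n. \<Omega> (A n)) sums \<Omega> (\<Union>n. A n)"
    by (simp add: sums_def)
qed

section \<open>Uniqueness of the integral operator\<close>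

lemma sup_norm_upper:
  assumes "f \<in> bounded_measurable M" "x \<in> space M"
  shows "\<bar>f x\<bar> \<le> sup_norm M f"
proof -
  obtain K where "\<And>x. x \<in> space M \<Longrightarrow> \<bar>f x\<bar> \<le> K"
    using assms(1) by (auto simp: bounded_measurable_def)
  then have "bdd_above (insert 0 ((\<lambda>x. \<bar>f x\<bar>) ` space M))"
    by (auto intro!: bdd_aboveI2)
  then show ?thesis
    unfolding sup_norm_def using assms(2) by (intro cSup_upper) auto
qed

lemma sup_norm_least:
  assumes "0 \<le> K" "\<And>x. x \<in> space M \<Longrightarrow> \<bar>f x\<bar> \<le> K"
  shows "sup_norm M f \<le> K"
  unfolding sup_norm_def using assms by (intro cSup_least) auto

lemma sup_norm_nonneg:
  assumes "f \<in> bounded_measurable M"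
  shows "0 \<le> sup_norm M f"
proof -
  obtain K where "\<And>x. x \<in> space M \<Longrightarrow> \<bar>f x\<bar> \<le> K"
    using assms(1) by (auto simp: bounded_measurable_def)
  then have "bdd_above (insert 0 ((\<lambda>x. \<bar>f x\<bar>) ` space M))"
    by (auto intro!: bdd_aboveI2)
  then show ?thesis
    unfolding sup_norm_def by (intro cSup_upper) auto
qed

lemma bounded_measurable_add:
  assumes "f \<in> bounded_measurable M" "g \<in> bounded_measurable M"
  shows "(\<lambda>x. f x + g x) \<in> bounded_measurable M"
proof -
  obtain K L where KL: "\<And>x. x \<in> space M \<Longrightarrow> \<bar>f x\<bar> \<le> K" "\<And>x. x \<in> space M \<Longrightarrow> \<bar>g x\<bar> \<le> L"
    using assms by (auto simp: bounded_measurable_def)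
  have "\<bar>f x + g x\<bar> \<le> K + L" if "x \<in> space M" for x
    using KL[OF that] by linarith
  then show ?thesis
    using assms by (auto simp: bounded_measurable_def)
qed

lemma bounded_measurable_cmult:
  assumes "f \<in> bounded_measurable M"
  shows "(\<lambda>x. c * f x) \<in> bounded_measurable M"
proof -
  obtain K where K: "\<And>x. x \<in> space M \<Longrightarrow> \<bar>f x\<bar> \<le> K"
    using assms by (auto simp: bounded_measurable_def)
  have "\<bar>c * f x\<bar> \<le> \<bar>c\<bar> * K" if "x \<in> space M" for x
    using K[OF that] by (simp add: abs_mult mult_left_mono)
  then show ?thesis
    using assms by (auto simp: bounded_measurable_def)
qed

lemma bounded_measurable_indicator:
  assumes "E \<in> sets M"
  shows "indicator E \<in> bounded_measurable M"
  using assms by (auto simp: bounded_measurable_def indicator_def intro!: exI[of _ 1])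

text \<open>Rounding down to a grid of mesh \<open>1 / Suc k\<close> is Borel, uniformly close to
  the identity, and has finitely many values on bounded sets. It thus produces simple functions,
  both for the uniqueness of the integral operator and for the coefficients on the fibres.\<close>

definition grid_round :: "nat \<Rightarrow> real \<Rightarrow> real" where
  "grid_round k x = of_int \<lfloor>real (Suc k) * x\<rfloor> / real (Suc k)"

lemma grid_round_error: "\<bar>x - grid_round k x\<bar> \<le> 1 / real (Suc k)"
proof -
  have "\<bar>real (Suc k) * x - of_int \<lfloor>real (Suc k) * x\<rfloor>\<bar> \<le> 1"
    by linarith
  moreover have "x - grid_round k x =
      (real (Suc k) * x - of_int \<lfloor>real (Suc k) * x\<rfloor>) / real (Suc k)"
    by (simp add: grid_round_def field_simps)
  ultimately show ?thesis
    by (simp add: divide_right_mono)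
qed

lemma finite_grid_round:
  assumes "\<And>x. x \<in> S \<Longrightarrow> \<bar>f x\<bar> \<le> K"
  shows "finite ((\<lambda>x. grid_round k (f x)) ` S)"
proof (rule finite_subset)
  let ?n = "\<lceil>real (Suc k) * K\<rceil> + 1"
  show "(\<lambda>x. grid_round k (f x)) ` S \<subseteq> (\<lambda>i. of_int i / real (Suc k)) ` {-?n..?n}"
  proof
    fix y assume "y \<in> (\<lambda>x. grid_round k (f x)) ` S"
    then obtain x where x: "x \<in> S" "y = grid_round k (f x)" by auto
    have "\<bar>real (Suc k) * f x\<bar> \<le> real (Suc k) * K"
      unfolding abs_mult using assms[OF x(1)] by (intro mult_mono) auto
    then have "\<lfloor>real (Suc k) * f x\<rfloor> \<in> {-?n..?n}"
      by simp linarith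
    then show "y \<in> (\<lambda>i. of_int i / real (Suc k)) ` {-?n..?n}"
      unfolding x(2) grid_round_def by blast
  qed
qed auto

lemma simple_function_grid_round:
  assumes "f \<in> bounded_measurable M"
  shows "simple_function M (\<lambda>x. grid_round k (f x))"
proof -
  have "f \<in> borel_measurable M" using assms by (auto simp: bounded_measurable_def)
  then have "(\<lambda>x. grid_round k (f x)) \<in> borel_measurable M"
    unfolding grid_round_def by measurable
  moreover have "finite ((\<lambda>x. grid_round k (f x)) ` space M)"
    using assms by (auto simp: bounded_measurable_def intro: finite_grid_round)
  ultimately show ?thesis
    by (simp add: simple_function_borel_measurable)
qed

lemma bounded_measurable_simple:
  assumes "simple_function M f"
  shows "f \<in> bounded_measurable M"
proof -
  have "finite (f ` space M)" using assms by (rule simple_functionD)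
  then have "\<bar>f x\<bar> \<le> Max (abs ` f ` space M)" if "x \<in> space M" for x
    using that by (intro Max_ge) auto
  then show ?thesis
    using assms by (auto simp: bounded_measurable_def intro: borel_measurable_simple_function)
qed

text \<open>The difference \<open>S\<close> of two such operators is linear and bounded and kills
  indicators, hence simple functions, hence by \<open>grid_round\<close> their uniform
  limits.\<close>

lemma is_integral_operator_eqI:
  assumes T: "is_integral_operator M \<Omega> T" and T': "is_integral_operator M \<Omega> T'"
  shows "T = T'"
proof
  fix f
  define S where "S f = T f - T' f" for f
  obtain C where C: "\<And>f. f \<in> bounded_measurable M \<Longrightarrow> norm (T f) \<le> C * sup_norm M f"
    using T unfolding is_integral_operator_def by blast
  obtain C' where C': "\<And>f. f \<in> bounded_measurable M \<Longrightarrow> norm (T' f) \<le> C' * sup_norm M f"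
    using T' unfolding is_integral_operator_def by blast
  have add: "S (\<lambda>x. f x + g x) = S f + S g"
    if "f \<in> bounded_measurable M" "g \<in> bounded_measurable M" for f g
    using T T' that unfolding is_integral_operator_def S_def by (simp add: algebra_simps)
  have cmult: "S (\<lambda>x. c * f x) = c *\<^sub>R S f" if "f \<in> bounded_measurable M" for f c
    using T T' that unfolding is_integral_operator_def S_def by (simp add: scaleR_diff_right)
  have ind: "S (indicator E) = 0" if "E \<in> sets M" for E
    using T T' that unfolding is_integral_operator_def S_def by simp
  \<comment> \<open>Any pointwise bound \<open>K\<close> may replace the supremum norm. The absolute
    values are there because \<open>C\<close> and \<open>C'\<close> may be negative.\<close>
  have bound: "norm (S f) \<le> (\<bar>C\<bar> + \<bar>C'\<bar>) * K"
    if f: "f \<in> bounded_measurable M" and K: "0 \<le> K" "\<And>x. x \<in> space M \<Longrightarrow> \<bar>f x\<bar> \<le> K" for f K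
  proof -
    have "norm (S f) \<le> C * sup_norm M f + C' * sup_norm M f"
      unfolding S_def using C[OF f] C'[OF f] norm_triangle_ineq4[of "T f" "T' f"] by linarith
    also have "\<dots> \<le> \<bar>C\<bar> * sup_norm M f + \<bar>C'\<bar> * sup_norm M f"
      using sup_norm_nonneg[OF f] by (intro add_mono mult_right_mono) auto
    also have "\<dots> \<le> (\<bar>C\<bar> + \<bar>C'\<bar>) * K"
      using sup_norm_least[of K M f, OF K]
      by (simp add: distrib_right add_mono mult_left_mono)
    finally show ?thesis .
  qed
  \<comment> \<open>Membership is carried along in the induction because additivity of
    \<open>S\<close> is available only on bounded measurable functions.\<close>
  have simple_sum: "(\<lambda>x. \<Sum>v\<in>V. v * indicator (B v) x) \<in> bounded_measurable M \<and>
      S (\<lambda>x. \<Sum>v\<in>V. v * indicator (B v) x) = 0"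
    if "finite V" "\<And>v. B v \<in> sets M" for V :: "real set" and B
    using that(1)
  proof induction
    case empty
    have "(\<lambda>x. 0) = (\<lambda>x. 0 * indicator {} x :: real)" by auto
    then show ?case
      using cmult[OF bounded_measurable_indicator[of "{}" M], of 0]
      by (auto simp: bounded_measurable_def)
  next
    case (insert v V)
    have v: "(\<lambda>x. v * indicator (B v) x) \<in> bounded_measurable M"
      using that by (intro bounded_measurable_cmult bounded_measurable_indicator)
    show ?case
      unfolding sum.insert[OF insert.hyps] add[OF v conjunct1[OF insert.IH]] conjunct2[OF insert.IH]
      using bounded_measurable_add[OF v conjunct1[OF insert.IH]]
        cmult[OF bounded_measurable_indicator[OF that(2)[of v]]] ind[OF that(2)[of v]]
      by auto
  qed
  have simple: "S f = 0" if f: "simple_function M f" for f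
  proof -
    let ?B = "\<lambda>v. f -` {v} \<inter> space M"
    let ?g = "\<lambda>x. \<Sum>v\<in>f ` space M. v * indicator (?B v) x"
    have g: "?g \<in> bounded_measurable M" "S ?g = 0"
      using simple_sum[of "f ` space M" ?B] simple_functionD[OF f] by auto
    have eq: "?g x = f x" if "x \<in> space M" for x
    proof -
      have "?g x = (\<Sum>v\<in>f ` space M. if v = f x then f x else 0)"
        using that by (intro sum.cong) (auto simp: indicator_def)
      then show ?thesis using that simple_functionD[OF f] by simp
    qed
    have bf: "f \<in> bounded_measurable M" using f by (rule bounded_measurable_simple)
    have mg: "(\<lambda>x. (-1) * ?g x) \<in> bounded_measurable M"
      using g(1) by (rule bounded_measurable_cmult)
    \<comment> \<open>\<open>f\<close> and \<open>?g\<close> are known to agree only on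
      \<open>space M\<close>; the bound with \<open>K = 0\<close> still identifies their images
      under \<open>S\<close>.\<close>
    have "norm (S (\<lambda>x. f x + (-1) * ?g x)) \<le> (\<bar>C\<bar> + \<bar>C'\<bar>) * 0"
      using eq by (intro bound bounded_measurable_add bf mg) auto
    then show ?thesis
      using add[OF bf mg] cmult[OF g(1), of "-1"] g(2) by simp
  qed
  show "T f = T' f"
  proof (cases "f \<in> bounded_measurable M")
    case False
    then show ?thesis using T T' by (simp add: is_integral_operator_def)
  next
    case f: True
    have "norm (S f) \<le> (\<bar>C\<bar> + \<bar>C'\<bar>) * (1 / real (Suc k))" for k
    proof -
      let ?g = "\<lambda>x. grid_round k (f x)"
      have g: "simple_function M ?g" by (rule simple_function_grid_round[OF f])
      have mg: "(\<lambda>x. (-1) * ?g x) \<in> bounded_measurable M"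
        using g by (intro bounded_measurable_cmult bounded_measurable_simple)
      have "norm (S (\<lambda>x. f x + (-1) * ?g x)) \<le> (\<bar>C\<bar> + \<bar>C'\<bar>) * (1 / real (Suc k))"
        using grid_round_error[of "f _" k]
        by (intro bound bounded_measurable_add f mg) auto
      then show ?thesis
        using add[OF f mg] cmult[OF bounded_measurable_simple[OF g], of "-1"] simple[OF g] by simp
    qed
    moreover have "(\<lambda>k. (\<bar>C\<bar> + \<bar>C'\<bar>) * (1 / real (Suc k))) \<longlonglongrightarrow> (\<bar>C\<bar> + \<bar>C'\<bar>) * 0"
      using LIMSEQ_inverse_real_of_nat by (intro tendsto_intros) (simp add: inverse_eq_divide)
    ultimately have "norm (S f) \<le> (\<bar>C\<bar> + \<bar>C'\<bar>) * 0"
      by (intro LIMSEQ_le_const) auto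
    then show ?thesis by (simp add: S_def)
  qed
qed

lemma vector_integral_eqI:
  assumes "is_integral_operator M \<Omega> T"
  shows "vector_integral M \<Omega> = T"
  unfolding vector_integral_def using assms by (intro the_equality is_integral_operator_eqI)

section \<open>Polish spaces as Borel retracts of the real line\<close>

text \<open>Base 3 with the digits 0 and 1 only: whatever follows a digit contributes at most half a
  unit of its place, so no carries occur and a code determines its digits.\<close>

definition ternary_code :: "(nat \<Rightarrow> bool) \<Rightarrow> real" where
  "ternary_code c = (\<Sum>i. of_bool (c i) / 3 ^ Suc i)"

definition ternary_digit :: "real \<Rightarrow> nat \<Rightarrow> bool" where
  "ternary_digit t j \<longleftrightarrow> \<lfloor>3 ^ Suc j * t\<rfloor> mod 3 = 1"

lemma summable_ternary: "summable (\<lambda>i. of_bool (c i) / 3 ^ Suc i :: real)"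
proof (rule summable_comparison_test')
  show "summable (\<lambda>i. (1 / 3 :: real) ^ i)" by (rule summable_geometric) simp
  show "norm (of_bool (c i) / 3 ^ Suc i :: real) \<le> (1 / 3) ^ i" if "0 \<le> i" for i
    by (simp add: power_divide divide_simps)
qed

lemma ternary_code_bounds: "0 \<le> ternary_code c" "ternary_code c \<le> 1 / 2"
proof -
  show "0 \<le> ternary_code c"
    unfolding ternary_code_def by (rule suminf_nonneg[OF summable_ternary]) simp
  have "(\<lambda>i. (1 / 3 :: real) * (1 / 3) ^ i) sums ((1 / 3) * (1 / (1 - 1 / 3)))"
    by (intro sums_mult geometric_sums) simp
  then have s: "(\<lambda>i. (1 / 3 :: real) * (1 / 3) ^ i) sums (1 / 2)" by simp
  have "ternary_code c \<le> (\<Sum>i. (1 / 3 :: real) * (1 / 3) ^ i)"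
    unfolding ternary_code_def
    by (rule suminf_le[OF _ summable_ternary sums_summable[OF s]]) (simp add: power_divide divide_simps)
  then show "ternary_code c \<le> 1 / 2" using s by (simp add: sums_iff)
qed

lemma ternary_code_shift: "3 * ternary_code c = of_bool (c 0) + ternary_code (\<lambda>i. c (Suc i))"
proof -
  have "ternary_code c = of_bool (c 0) / 3 + (\<Sum>i. of_bool (c (Suc i)) / 3 ^ Suc (Suc i))"
    unfolding ternary_code_def using suminf_split_head[OF summable_ternary[of c]] by simp
  also have "(\<Sum>i. of_bool (c (Suc i)) / 3 ^ Suc (Suc i)) = ternary_code (\<lambda>i. c (Suc i)) / 3"
    unfolding ternary_code_def suminf_divide[OF summable_ternary, symmetric] by (simp add: mult.commute)
  finally show ?thesis by simp
qed

text \<open>Multiplication by 3 shifts the code by one place. The leading digit then contributes a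
  multiple of 3 to every later floor and disappears modulo 3, while the rest lies in
  \<open>[0, 1/2]\<close> and leaves the floor of the leading digit unchanged.\<close>

lemma ternary_digit_code: "ternary_digit (ternary_code c) j = c j"
proof (induction j arbitrary: c)
  case 0
  have "\<lfloor>of_bool (c 0) + ternary_code (\<lambda>i. c (Suc i))\<rfloor> = (of_bool (c 0) :: int)"
    using ternary_code_bounds[of "\<lambda>i. c (Suc i)"] by (intro floor_unique) (auto simp: of_bool_def)
  then show ?case by (simp add: ternary_digit_def ternary_code_shift of_bool_def)
next
  case (Suc j)
  have "3 ^ Suc (Suc j) * ternary_code c = 3 ^ Suc j * (3 * ternary_code c)" by simp
  also have "\<dots> = 3 ^ Suc j * ternary_code (\<lambda>i. c (Suc i)) + of_int (3 * (3 ^ j * of_bool (c 0)))"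
    unfolding ternary_code_shift by (simp add: algebra_simps)
  finally have "\<lfloor>3 ^ Suc (Suc j) * ternary_code c\<rfloor> =
      \<lfloor>3 ^ Suc j * ternary_code (\<lambda>i. c (Suc i))\<rfloor> + 3 * (3 ^ j * of_bool (c 0))"
    by (simp only: floor_add_int)
  then have "\<lfloor>3 ^ Suc (Suc j) * ternary_code c\<rfloor> mod 3 =
      \<lfloor>3 ^ Suc j * ternary_code (\<lambda>i. c (Suc i))\<rfloor> mod 3"
    by (simp only: mod_mult_self2)
  then show ?case using Suc[of "\<lambda>i. c (Suc i)"] by (simp only: ternary_digit_def)
qed

text \<open>
  A point is encoded by a sequence of indices of ever better approximations from a countable
  dense set; decoding is the limit of these approximations.
\<close>

lemma borel_retract_of_real:
  obtains h :: "'x::polish_space \<Rightarrow> real" and r :: "real \<Rightarrow> 'x"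
  where "h \<in> borel_measurable borel" "r \<in> borel_measurable borel"
    "\<And>x. 0 \<le> h x" "\<And>x. h x \<le> 1" "\<And>x. r (h x) = x"
proof -
  obtain D :: "'x set" where D: "countable D" "\<And>X. open X \<Longrightarrow> X \<noteq> {} \<Longrightarrow> \<exists>d\<in>D. d \<in> X"
    using countable_dense_exists by blast
  have "D \<noteq> {}" using D(2)[of UNIV] by auto
  define d where "d = from_nat_into D"
  have dense: "\<exists>n. dist x (d n) < 1 / real (Suc k)" for x k
  proof -
    have "\<exists>y\<in>D. y \<in> ball x (1 / real (Suc k))" by (intro D(2)) auto
    then show ?thesis
      unfolding d_def using from_nat_into_surj[OF D(1)] by (metis mem_ball)
  qed
  \<comment> \<open>Taking the least index makes the choice of the approximant measurable in
    \<open>x\<close>.\<close>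
  define a where "a k x = (LEAST n. dist x (d n) < 1 / real (Suc k))" for k x
  have a: "dist x (d (a k x)) < 1 / real (Suc k)" for k x
    unfolding a_def by (rule LeastI_ex[OF dense])
  have a_meas [measurable]: "a k \<in> measurable borel (count_space UNIV)" for k
    unfolding a_def by measurable
  \<comment> \<open>The bit at position \<open>prod_encode (n, k)\<close> records whether
    \<open>n\<close> is the index chosen at precision \<open>k\<close>, so a single binary sequence
    stores the whole sequence of indices.\<close>
  define h where "h x = ternary_code (\<lambda>i. fst (prod_decode i) = a (snd (prod_decode i)) x)" for x
  define b where "b k t = d (LEAST n. ternary_digit t (prod_encode (n, k)))" for k t
  \<comment> \<open>Off the range of \<open>h\<close> the decoded points need not converge. A
    constant sequence is substituted where they do not, so that \<open>r\<close> is a pointwise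
    limit everywhere and hence Borel.\<close>
  define b' where "b' k t = (if Cauchy (\<lambda>k. b k t) then b k t else d 0)" for k t
  define r where "r t = lim (\<lambda>k. b' k t)" for t
  have b_h: "b k (h x) = d (a k x)" for k x
    unfolding b_def h_def ternary_digit_code by (simp add: Least_equality)
  have lim_b: "(\<lambda>k. b k (h x)) \<longlonglongrightarrow> x" for x
    unfolding b_h
  proof (rule tendstoI)
    fix e :: real assume "0 < e"
    then obtain N where N: "1 / real (Suc N) < e"
      using reals_Archimedean[of e] by (auto simp: inverse_eq_divide)
    have "dist (d (a k x)) x < e" if "N \<le> k" for k
    proof -
      have "1 / real (Suc k) \<le> 1 / real (Suc N)" using that by (simp add: frac_le)
      then show ?thesis using a[of x k] N by (simp add: dist_commute)
    qed
    then show "\<forall>\<^sub>F k in sequentially. dist (d (a k x)) x < e"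
      by (auto simp: eventually_sequentially)
  qed
  have "h \<in> borel_measurable borel"
    unfolding h_def ternary_code_def by measurable
  moreover have "r \<in> borel_measurable borel"
  proof (rule borel_measurable_LIMSEQ_metric)
    have [measurable]: "Measurable.pred borel (\<lambda>t. ternary_digit t j)" for j
      unfolding ternary_digit_def by measurable
    have [measurable]: "b k \<in> borel_measurable borel" for k
      unfolding b_def by measurable
    show "b' k \<in> borel_measurable borel" for k
      unfolding b'_def by measurable
    have "convergent (\<lambda>k. b' k t)" for t
      unfolding b'_def by (cases "Cauchy (\<lambda>k. b k t)") (auto intro: Cauchy_convergent convergent_const)
    then show "(\<lambda>k. b' k t) \<longlonglongrightarrow> r t" for t
      unfolding r_def by (simp add: convergent_LIMSEQ_iff)
  qed
  moreover have "r (h x) = x" for x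
  proof -
    have "Cauchy (\<lambda>k. b k (h x))" using lim_b by (rule LIMSEQ_imp_Cauchy)
    then have "(\<lambda>k. b' k (h x)) \<longlonglongrightarrow> x" using lim_b[of x] by (simp add: b'_def)
    then show ?thesis unfolding r_def by (rule limI)
  qed
  moreover have "0 \<le> h x" "h x \<le> 1" for x
    using ternary_code_bounds unfolding h_def by (auto intro: order_trans[of _ "1 / 2"])
  ultimately show ?thesis using that by blast
qed

section \<open>Disintegration of scalar measures\<close>

definition unit_uniform :: "real measure" where
  "unit_uniform = uniform_measure lborel {0..1}"

lemma sets_unit_uniform [simp, measurable_cong]: "sets unit_uniform = sets borel"
  and space_unit_uniform [simp]: "space unit_uniform = UNIV"
  by (simp_all add: unit_uniform_def)

lemma emeasure_unit_uniform_UNIV [simp]: "emeasure unit_uniform UNIV = 1"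
  by (simp add: unit_uniform_def emeasure_uniform_measure)

lemma finite_measure_unit_uniform: "finite_measure unit_uniform"
  by (intro finite_measureI) simp

lemma emeasure_unit_uniform_le:
  assumes "c \<le> 1"
  shows "emeasure unit_uniform {u. ennreal u \<le> c} = c"
proof -
  obtain r where r: "c = ennreal r" "0 \<le> r" using assms by (cases c) (auto simp: top_unique)
  then have "r \<le> 1" using assms by (simp add: ennreal_le_1)
  \<comment> \<open>\<open>ennreal\<close> sends negative \<open>u\<close> to 0; intersecting with
    \<open>{0..1}\<close> removes these points.\<close>
  have "{0..1} \<inter> {u. ennreal u \<le> c} = {0..r}"
    using r \<open>r \<le> 1\<close> by (auto simp: ennreal_le_iff)
  moreover have "{u. ennreal u \<le> c} \<in> sets borel" by measurable
  ultimately show ?thesis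
    using r divide_ennreal[of r 1] by (simp add: unit_uniform_def emeasure_uniform_measure)
qed

text \<open>The hypothesis is tested on the set where \<open>g < f\<close>: there
  \<open>f - g\<close> has integral 0. Finiteness of the integral of \<open>g\<close> permits the
  subtraction.\<close>

lemma (in finite_measure) AE_le_of_set_nn_integral_le:
  fixes f g :: "'a \<Rightarrow> ennreal"
  assumes [measurable]: "f \<in> borel_measurable M" "g \<in> borel_measurable M"
    and fin: "(\<integral>\<^sup>+x. g x \<partial>M) < \<infinity>"
    and le: "\<And>A. A \<in> sets M \<Longrightarrow> (\<integral>\<^sup>+x. f x * indicator A x \<partial>M) \<le> (\<integral>\<^sup>+x. g x * indicator A x \<partial>M)"
  shows "AE x in M. f x \<le> g x"
proof -
  define S where "S = {x\<in>space M. g x < f x}"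
  have [measurable]: "S \<in> sets M" unfolding S_def by measurable
  have finS: "(\<integral>\<^sup>+x. g x * indicator S x \<partial>M) < \<infinity>"
    by (rule le_less_trans[OF nn_integral_mono fin]) (auto simp: indicator_def)
  have "(\<integral>\<^sup>+x. f x * indicator S x - g x * indicator S x \<partial>M) =
      (\<integral>\<^sup>+x. f x * indicator S x \<partial>M) - (\<integral>\<^sup>+x. g x * indicator S x \<partial>M)"
    using finS by (intro nn_integral_diff AE_I2) (auto simp: S_def indicator_def)
  also have "\<dots> = 0"
    using le[of S] finS by (intro diff_eq_0_ennreal) (auto intro: le_less_trans)
  finally have "AE x in M. f x * indicator S x - g x * indicator S x = 0"
    by (subst (asm) nn_integral_0_iff_AE) auto
  then show ?thesis
    using AE_space
  proof eventually_elim
    case (elim x)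
    then show ?case
      by (cases "x \<in> S") (auto simp: S_def diff_eq_0_iff_ennreal)
  qed
qed

text \<open>
  A regular version of the conditional upper tails of \<open>h\<close> given \<open>\<phi>\<close>, corrected on a null set so
  that it is monotone everywhere.
\<close>

lemma conditional_tail:
  fixes h :: "'x \<Rightarrow> real"
  assumes "finite_measure M" and \<phi> [measurable]: "\<phi> \<in> measurable M N"
    and h [measurable]: "h \<in> borel_measurable M"
  obtains G :: "real \<Rightarrow> 'y \<Rightarrow> ennreal"
  where "\<And>q. q \<in> \<rat> \<Longrightarrow> G q \<in> borel_measurable N"
    "\<And>q y. q \<in> \<rat> \<Longrightarrow> G q y \<le> 1"
    "\<And>p q y. p \<in> \<rat> \<Longrightarrow> q \<in> \<rat> \<Longrightarrow> p \<le> q \<Longrightarrow> G q y \<le> G p y"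
    "\<And>q A. q \<in> \<rat> \<Longrightarrow> A \<in> sets N \<Longrightarrow>
      (\<integral>\<^sup>+y. G q y * indicator A y \<partial>distr M N \<phi>) = emeasure M {x\<in>space M. \<phi> x \<in> A \<and> q < h x}"
proof -
  interpret finite_measure M by fact
  interpret \<nu>: finite_measure "distr M N \<phi>" by (rule finite_measure_distr) measurable
  \<comment> \<open>\<open>T q\<close> is the image under \<open>\<phi>\<close> of \<open>M\<close>
    restricted to the event \<open>q < h x\<close>; its density with respect to the image of
    \<open>M\<close> is the conditional probability of that event.\<close>
  define T where "T q = distr (density M (indicator {x\<in>space M. q < h x})) N \<phi>" for q
  have T: "emeasure (T q) A = emeasure M {x\<in>space M. \<phi> x \<in> A \<and> q < h x}" if "A \<in> sets N" for q A
  proof -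
    have [measurable]: "A \<in> sets N" by (fact that)
    have "emeasure (T q) A = (\<integral>\<^sup>+x. indicator {x\<in>space M. q < h x} x * indicator (\<phi> -` A \<inter> space M) x \<partial>M)"
      unfolding T_def using that by (subst emeasure_distr) (auto simp: emeasure_density)
    also have "\<dots> = (\<integral>\<^sup>+x. indicator {x\<in>space M. \<phi> x \<in> A \<and> q < h x} x \<partial>M)"
      by (rule nn_integral_cong) (auto simp: indicator_def)
    also have "\<dots> = emeasure M {x\<in>space M. \<phi> x \<in> A \<and> q < h x}"
      by (intro nn_integral_indicator) measurable
    finally show ?thesis .
  qed
  have \<nu>: "emeasure (distr M N \<phi>) A = emeasure M {x\<in>space M. \<phi> x \<in> A}" if "A \<in> sets N" for A
    using that by (subst emeasure_distr) (auto intro!: arg_cong[where f="emeasure M"])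
  have "\<exists>f. f \<in> borel_measurable N \<and> density (distr M N \<phi>) f = T q" for q
  proof -
    have "absolutely_continuous (distr M N \<phi>) (T q)"
      unfolding absolutely_continuous_def
    proof
      fix A assume "A \<in> null_sets (distr M N \<phi>)"
      then have A: "A \<in> sets N" "emeasure M {x\<in>space M. \<phi> x \<in> A} = 0" by (auto simp: null_sets_def \<nu>)
      have "emeasure M {x\<in>space M. \<phi> x \<in> A \<and> q < h x} \<le> emeasure M {x\<in>space M. \<phi> x \<in> A}"
        using A(1) by (intro emeasure_mono) auto
      then show "A \<in> null_sets (T q)" using A T[of A q] by (simp add: null_sets_def) (simp add: T_def)
    qed
    then show ?thesis using \<nu>.Radon_Nikodym[of "T q"] by (auto simp: T_def)
  qed
  then obtain F where F [measurable]: "\<And>q. F q \<in> borel_measurable N"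
    and dF: "\<And>q. density (distr M N \<phi>) (F q) = T q" by metis
  have intF: "(\<integral>\<^sup>+y. F q y * indicator A y \<partial>distr M N \<phi>) = emeasure M {x\<in>space M. \<phi> x \<in> A \<and> q < h x}"
    if A: "A \<in> sets N" for q A
  proof -
    have "emeasure (density (distr M N \<phi>) (F q)) A = (\<integral>\<^sup>+y. F q y * indicator A y \<partial>distr M N \<phi>)"
      using A by (intro emeasure_density) auto
    then show ?thesis using A by (simp add: dF T)
  qed
  have F1: "AE y in distr M N \<phi>. F q y \<le> 1" for q
  proof (rule \<nu>.AE_le_of_set_nn_integral_le)
    fix A assume A: "A \<in> sets (distr M N \<phi>)"
    have "emeasure M {x\<in>space M. \<phi> x \<in> A \<and> q < h x} \<le> emeasure M {x\<in>space M. \<phi> x \<in> A}"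
      using A by (intro emeasure_mono) auto
    then show "(\<integral>\<^sup>+y. F q y * indicator A y \<partial>distr M N \<phi>) \<le> (\<integral>\<^sup>+y. 1 * indicator A y \<partial>distr M N \<phi>)"
      using A by (simp add: intF \<nu>)
  qed (auto simp: less_top[symmetric])
  have F2: "AE y in distr M N \<phi>. F q y \<le> F p y" if "p \<le> q" for p q
  proof (rule \<nu>.AE_le_of_set_nn_integral_le)
    have "(\<integral>\<^sup>+y. F p y \<partial>distr M N \<phi>) = (\<integral>\<^sup>+y. F p y * indicator (space N) y \<partial>distr M N \<phi>)"
      by (rule nn_integral_cong) simp
    also have "\<dots> < \<infinity>" using emeasure_finite by (simp add: intF less_top[symmetric])
    finally show "(\<integral>\<^sup>+y. F p y \<partial>distr M N \<phi>) < \<infinity>" .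
    fix A assume A: "A \<in> sets (distr M N \<phi>)"
    then have A': "A \<in> sets N" by simp
    have "emeasure M {x\<in>space M. \<phi> x \<in> A \<and> q < h x} \<le> emeasure M {x\<in>space M. \<phi> x \<in> A \<and> p < h x}"
      using A' that by (intro emeasure_mono) auto
    then show "(\<integral>\<^sup>+y. F q y * indicator A y \<partial>distr M N \<phi>) \<le> (\<integral>\<^sup>+y. F p y * indicator A y \<partial>distr M N \<phi>)"
      using A' by (simp add: intF)
  qed auto
  \<comment> \<open>Rational thresholds keep the conditions countable, so they hold simultaneously
    almost everywhere and \<open>good\<close> is measurable.\<close>
  define good where "good y \<longleftrightarrow> (\<forall>p\<in>\<rat>. F p y \<le> 1) \<and> (\<forall>p\<in>\<rat>. \<forall>q\<in>\<rat>. p \<le> q \<longrightarrow> F q y \<le> F p y)" for y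
  have [measurable]: "Measurable.pred N good"
    unfolding good_def using countable_rat by measurable
  have good: "AE y in distr M N \<phi>. good y"
  proof -
    have "AE y in distr M N \<phi>. p \<le> q \<longrightarrow> F q y \<le> F p y" for p q
      using F2[of p q] by (cases "p \<le> q") auto
    then show ?thesis
      unfolding good_def using F1 by (simp add: AE_ball_countable[OF countable_rat])
  qed
  \<comment> \<open>The value 0 for all \<open>q\<close> at bad points is again monotone and at most
    1, and it changes no integral.\<close>
  define G where "G q y = (if good y then F q y else 0)" for q y
  show ?thesis
  proof (rule that[of G])
    show "G q \<in> borel_measurable N" for q unfolding G_def by measurable
    show "G q y \<le> 1" if "q \<in> \<rat>" for q y using that by (auto simp: G_def good_def)
    show "G q y \<le> G p y" if "p \<in> \<rat>" "q \<in> \<rat>" "p \<le> q" for p q y using that by (auto simp: G_def good_def)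
    fix q :: real and A assume "A \<in> sets N"
    have "(\<integral>\<^sup>+y. G q y * indicator A y \<partial>distr M N \<phi>) = (\<integral>\<^sup>+y. F q y * indicator A y \<partial>distr M N \<phi>)"
      using good by (intro nn_integral_cong_AE) (auto simp: G_def)
    then show "(\<integral>\<^sup>+y. G q y * indicator A y \<partial>distr M N \<phi>) = emeasure M {x\<in>space M. \<phi> x \<in> A \<and> q < h x}"
      using intF[OF \<open>A \<in> sets N\<close>] by simp
  qed
qed

text \<open>
  Noise outsourcing: \<open>\<Psi> (y, \<sqdot>)\<close> is the quantile function of the conditional law of \<open>h\<close> given \<open>\<phi> = y\<close>,
  so no Lebesgue--Stieltjes measures are needed and joint measurability is immediate.
\<close>

lemma randomization_real:
  fixes h :: "'x \<Rightarrow> real"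
  assumes M: "finite_measure M" and \<phi> [measurable]: "\<phi> \<in> measurable M N"
    and h [measurable]: "h \<in> borel_measurable M"
    and h01: "\<And>x. x \<in> space M \<Longrightarrow> 0 \<le> h x" "\<And>x. x \<in> space M \<Longrightarrow> h x \<le> 1"
  obtains \<Psi> :: "'y \<times> real \<Rightarrow> real"
  where "\<Psi> \<in> borel_measurable (N \<Otimes>\<^sub>M borel)"
    "distr (distr M N \<phi> \<Otimes>\<^sub>M unit_uniform) (N \<Otimes>\<^sub>M borel) (\<lambda>z. (fst z, \<Psi> z)) =
     distr M (N \<Otimes>\<^sub>M borel) (\<lambda>x. (\<phi> x, h x))"
proof -
  interpret finite_measure M by fact
  interpret \<nu>: finite_measure "distr M N \<phi>" by (rule finite_measure_distr) measurable
  interpret U: finite_measure unit_uniform by (rule finite_measure_unit_uniform)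
  let ?K = "distr M N \<phi> \<Otimes>\<^sub>M unit_uniform"
  obtain G :: "real \<Rightarrow> 'y \<Rightarrow> ennreal" where
    G_meas [measurable (raw)]: "\<And>q. q \<in> \<rat> \<Longrightarrow> G q \<in> borel_measurable N"
    and G1: "\<And>q y. q \<in> \<rat> \<Longrightarrow> G q y \<le> 1"
    and G_mono: "\<And>p q y. p \<in> \<rat> \<Longrightarrow> q \<in> \<rat> \<Longrightarrow> p \<le> q \<Longrightarrow> G q y \<le> G p y"
    and G: "\<And>q A. q \<in> \<rat> \<Longrightarrow> A \<in> sets N \<Longrightarrow>
      (\<integral>\<^sup>+y. G q y * indicator A y \<partial>distr M N \<phi>) = emeasure M {x\<in>space M. \<phi> x \<in> A \<and> q < h x}"
    using conditional_tail[OF M \<phi> h] by blast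
  \<comment> \<open>As \<open>h\<close> has values in \<open>[0, 1]\<close>, rational thresholds in
    that interval suffice, and suprema over them are countable and bounded.\<close>
  define Q where "Q = \<rat> \<inter> {0..1::real}"
  have Q: "countable Q" "0 \<in> Q" "1 \<in> Q" "Q \<subseteq> \<rat>"
    unfolding Q_def by (auto simp: countable_rat intro: countable_subset)
  \<comment> \<open>\<open>\<Psi> (y, u)\<close> is to be the supremum of the \<open>q\<close> with
    \<open>u \<le> G q y\<close>. Thresholds that fail contribute 0, so one index set
    \<open>Q\<close> serves all points and \<open>\<Psi>\<close> is a countable supremum of
    measurable functions.\<close>
  define \<psi> where "\<psi> q z = (if ennreal (snd z) \<le> G q (fst z) then q else 0)" for q and z :: "'y \<times> real"
  define \<Psi> where "\<Psi> z = (SUP q\<in>Q. \<psi> q z)" for z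
  have \<psi>01: "0 \<le> \<psi> q z" "\<psi> q z \<le> 1" if "q \<in> Q" for q z
    using that by (auto simp: \<psi>_def Q_def)
  then have bdd: "bdd_above ((\<lambda>q. \<psi> q z) ` Q)" for z by (intro bdd_aboveI2[where M=1])
  \<comment> \<open>A strict inequality below a supremum becomes an existential statement, which is
    why \<open>G\<close> describes the strict events \<open>q < h x\<close>.\<close>
  have less: "t < \<Psi> z \<longleftrightarrow> (\<exists>q\<in>Q. t < q \<and> ennreal (snd z) \<le> G q (fst z))" if "0 \<le> t" for t z
    unfolding \<Psi>_def using Q bdd that by (subst less_cSUP_iff) (auto simp: \<psi>_def)
  have \<Psi>0: "0 \<le> \<Psi> z" for z
    unfolding \<Psi>_def using Q(2) bdd[of z] \<psi>01[OF Q(2), of z] by (metis cSUP_upper2)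
  have \<psi>_meas: "\<psi> q \<in> borel_measurable (N \<Otimes>\<^sub>M borel)" if "q \<in> Q" for q
  proof -
    have [measurable]: "G q \<in> borel_measurable N" using that Q(4) by auto
    show ?thesis unfolding \<psi>_def by measurable
  qed
  have \<Psi>_meas [measurable]: "\<Psi> \<in> borel_measurable (N \<Otimes>\<^sub>M borel)"
    unfolding \<Psi>_def using Q(1) \<psi>_meas bdd by (intro borel_measurable_cSUP) auto
  \<comment> \<open>By Tonelli and the uniform law: for \<open>y\<close> in \<open>A\<close> the
    section of this set has measure exactly \<open>G q y\<close>.\<close>
  have level: "emeasure ?K {z\<in>space ?K. fst z \<in> A \<and> ennreal (snd z) \<le> G q (fst z)} =
      emeasure M {x\<in>space M. \<phi> x \<in> A \<and> q < h x}" if "q \<in> \<rat>" and A [measurable]: "A \<in> sets N" for q A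
  proof -
    have [measurable]: "G q \<in> borel_measurable N" using that by auto
    have "emeasure ?K {z\<in>space ?K. fst z \<in> A \<and> ennreal (snd z) \<le> G q (fst z)} =
       (\<integral>\<^sup>+y. emeasure unit_uniform (Pair y -` {z\<in>space ?K. fst z \<in> A \<and> ennreal (snd z) \<le> G q (fst z)}) \<partial>distr M N \<phi>)"
      by (rule U.emeasure_pair_measure_alt) measurable
    also have "\<dots> = (\<integral>\<^sup>+y. G q y * indicator A y \<partial>distr M N \<phi>)"
    proof (rule nn_integral_cong)
      fix y assume "y \<in> space (distr M N \<phi>)"
      then have "Pair y -` {z\<in>space ?K. fst z \<in> A \<and> ennreal (snd z) \<le> G q (fst z)} =
          (if y \<in> A then {u. ennreal u \<le> G q y} else {})"
        by (auto simp: space_pair_measure)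
      then show "emeasure unit_uniform (Pair y -` {z\<in>space ?K. fst z \<in> A \<and> ennreal (snd z) \<le> G q (fst z)}) =
          G q y * indicator A y"
        using emeasure_unit_uniform_le[OF G1[OF \<open>q \<in> \<rat>\<close>]] by simp
    qed
    finally show ?thesis using G that by simp
  qed
  have tail: "emeasure ?K {z\<in>space ?K. fst z \<in> A \<and> t < \<Psi> z} = emeasure M {x\<in>space M. \<phi> x \<in> A \<and> t < h x}"
    if A [measurable]: "A \<in> sets N" for t A
  proof -
    consider "t < 0" | "1 \<le> t" | "0 \<le> t" "t < 1" by linarith
    then show ?thesis
    proof cases
      case 1
      have "{z\<in>space ?K. fst z \<in> A \<and> t < \<Psi> z} = A \<times> space unit_uniform"
        using \<Psi>0 1 sets.sets_into_space[OF A] by (auto simp: space_pair_measure intro: less_le_trans)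
      moreover have "{x\<in>space M. \<phi> x \<in> A \<and> t < h x} = \<phi> -` A \<inter> space M"
        using h01(1) 1 by (auto intro: less_le_trans)
      ultimately show ?thesis
        by (simp add: U.emeasure_pair_measure_Times emeasure_distr)
    next
      case 2
      have e1: "{z\<in>space ?K. fst z \<in> A \<and> t < \<Psi> z} = {}"
        using 2 less[of t] by (auto simp: Q_def)
      have e2: "{x\<in>space M. \<phi> x \<in> A \<and> t < h x} = {}"
        using h01(2) 2 by force
      show ?thesis unfolding e1 e2 by simp
    next
      case 3
      let ?Qt = "{q\<in>Q. t < q}"
      define e where "e = from_nat_into ?Qt"
      have ne: "?Qt \<noteq> {}" using 3 Q by auto
      have rng: "range e = ?Qt"
        unfolding e_def using ne Q(1) by (intro range_from_nat_into) auto
      \<comment> \<open>The running minimum over an enumeration of the thresholds above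
        \<open>t\<close> is a decreasing sequence. Hence the level sets of both sides increase, and
        continuity from below carries \<open>level\<close> over to the real number
        \<open>t\<close>.\<close>
      define m where "m n = Min (e ` {..n})" for n :: nat
      have m_in: "m n \<in> ?Qt" for n
        using Min_in[of "e ` {..n}"] rng unfolding m_def by blast
      have m_le: "m n \<le> e n" for n unfolding m_def by (intro Min_le) auto
      have m_anti: "m n' \<le> m n" if "n \<le> n'" for n n'
        unfolding m_def using that by (intro Min_antimono) auto
      have mQ: "m n \<in> \<rat>" for n using m_in Q(4) by auto
      note [measurable] = G_meas[OF mQ]
      let ?R = "\<lambda>n. {z\<in>space ?K. fst z \<in> A \<and> ennreal (snd z) \<le> G (m n) (fst z)}"
      let ?S = "\<lambda>n. {x\<in>space M. \<phi> x \<in> A \<and> m n < h x}"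
      have R: "{z\<in>space ?K. fst z \<in> A \<and> t < \<Psi> z} = (\<Union>n. ?R n)"
      proof -
        have "(\<exists>q\<in>Q. t < q \<and> ennreal u \<le> G q y) \<longleftrightarrow> (\<exists>n. ennreal u \<le> G (m n) y)" for u y
        proof
          assume "\<exists>q\<in>Q. t < q \<and> ennreal u \<le> G q y"
          then obtain q where q: "q \<in> ?Qt" "ennreal u \<le> G q y" by auto
          then obtain n where "q = e n" using rng by blast
          then have "G q y \<le> G (m n) y" using m_le[of n] q Q(4) mQ by (intro G_mono) auto
          then show "\<exists>n. ennreal u \<le> G (m n) y" using q(2) by (meson order_trans)
        qed (use m_in in blast)
        then show ?thesis using less[OF 3(1)] by auto
      qed
      have S: "{x\<in>space M. \<phi> x \<in> A \<and> t < h x} = (\<Union>n. ?S n)"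
      proof -
        have "(\<exists>n. m n < h x) \<longleftrightarrow> t < h x" if x: "x \<in> space M" for x
        proof
          assume "t < h x"
          then obtain q where q: "q \<in> \<rat>" "t < q" "q < h x" using Rats_dense_in_real by blast
          then have "q \<in> ?Qt" using 3 h01(2)[OF x] by (auto simp: Q_def)
          then obtain n where "q = e n" using rng by blast
          then show "\<exists>n. m n < h x" using m_le[of n] q by (intro exI[of _ n]) simp
        next
          assume "\<exists>n. m n < h x"
          then obtain n where "m n < h x" by auto
          then show "t < h x" using m_in[of n] by simp
        qed
        then show ?thesis by auto
      qed
      have "(\<lambda>n. emeasure ?K (?R n)) \<longlonglongrightarrow> emeasure ?K (\<Union>n. ?R n)"
      proof (rule Lim_emeasure_incseq)
        show "range ?R \<subseteq> sets ?K" by (intro image_subsetI) measurable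
        show "incseq ?R"
          unfolding incseq_def using G_mono[OF mQ mQ m_anti] by (auto intro: order_trans)
      qed
      moreover have "(\<lambda>n. emeasure M (?S n)) \<longlonglongrightarrow> emeasure M (\<Union>n. ?S n)"
      proof (rule Lim_emeasure_incseq)
        show "range ?S \<subseteq> sets M" by (intro image_subsetI) measurable
        show "incseq ?S"
          unfolding incseq_def using m_anti by (auto intro: le_less_trans)
      qed
      ultimately show ?thesis
        unfolding R S level[OF mQ A] by (rule LIMSEQ_unique)
    qed
  qed
  have rect: "emeasure ?K {z\<in>space ?K. fst z \<in> A \<and> \<Psi> z \<in> B} = emeasure M {x\<in>space M. \<phi> x \<in> A \<and> h x \<in> B}"
    if A [measurable]: "A \<in> sets N" and B [measurable]: "B \<in> sets borel" for A B
  proof -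
    \<comment> \<open>For fixed \<open>A\<close> both sides are finite measures of \<open>B\<close>
      on the line; agreement on half-lines, which is \<open>tail\<close>, makes them equal.\<close>
    let ?D1 = "distr (density ?K (indicator (A \<times> UNIV))) borel \<Psi>"
    let ?D2 = "distr (density M (indicator (\<phi> -` A \<inter> space M))) borel h"
    have [measurable]: "A \<times> UNIV \<in> sets ?K" by (intro pair_measureI) auto
    have D1: "emeasure ?D1 B = emeasure ?K {z\<in>space ?K. fst z \<in> A \<and> \<Psi> z \<in> B}"
      if B [measurable]: "B \<in> sets borel" for B
    proof -
      have "\<Psi> -` B \<inter> space ?K \<in> sets ?K" by (rule measurable_sets[of _ _ borel]) measurable
      then have "emeasure ?D1 B = (\<integral>\<^sup>+z. indicator (A \<times> UNIV) z * indicator (\<Psi> -` B \<inter> space ?K) z \<partial>?K)"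
        by (subst emeasure_distr) (auto simp: emeasure_density)
      also have "\<dots> = (\<integral>\<^sup>+z. indicator {z\<in>space ?K. fst z \<in> A \<and> \<Psi> z \<in> B} z \<partial>?K)"
        by (rule nn_integral_cong) (auto simp: indicator_def)
      also have "\<dots> = emeasure ?K {z\<in>space ?K. fst z \<in> A \<and> \<Psi> z \<in> B}"
        by (intro nn_integral_indicator) measurable
      finally show ?thesis .
    qed
    have D2: "emeasure ?D2 B = emeasure M {x\<in>space M. \<phi> x \<in> A \<and> h x \<in> B}"
      if B [measurable]: "B \<in> sets borel" for B
    proof -
      have "emeasure ?D2 B = (\<integral>\<^sup>+x. indicator (\<phi> -` A \<inter> space M) x * indicator (h -` B \<inter> space M) x \<partial>M)"
        by (subst emeasure_distr) (auto simp: emeasure_density)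
      also have "\<dots> = (\<integral>\<^sup>+x. indicator {x\<in>space M. \<phi> x \<in> A \<and> h x \<in> B} x \<partial>M)"
        by (rule nn_integral_cong) (auto simp: indicator_def)
      also have "\<dots> = emeasure M {x\<in>space M. \<phi> x \<in> A \<and> h x \<in> B}"
        by (intro nn_integral_indicator) measurable
      finally show ?thesis .
    qed
    have "?D1 = ?D2"
    proof (rule measure_eqI_lessThan)
      fix t :: real
      show eq: "emeasure ?D1 {t<..} = emeasure ?D2 {t<..}"
        using tail[OF A, of t] by (simp add: D1 D2)
      show "emeasure ?D1 {t<..} < \<infinity>"
        unfolding eq using emeasure_finite by (simp add: D2 less_top[symmetric])
    qed auto
    then show ?thesis using D1[OF B] D2[OF B] by simp
  qed
  have "distr ?K (N \<Otimes>\<^sub>M borel) (\<lambda>z. (fst z, \<Psi> z)) = distr M (N \<Otimes>\<^sub>M borel) (\<lambda>x. (\<phi> x, h x))"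
    (is "?J1 = ?J2")
  proof (rule measure_eqI_generator_eq[OF Int_stable_pair_measure_generator[of N "borel :: real measure"]])
    let ?E = "{a \<times> b |a b. a \<in> sets N \<and> b \<in> sets (borel :: real measure)}"
    show "?E \<subseteq> Pow (space N \<times> space (borel :: real measure))"
      using sets.space_closed[of N] by auto
    show "sets ?J1 = sigma_sets (space N \<times> space (borel :: real measure)) ?E"
      "sets ?J2 = sigma_sets (space N \<times> space (borel :: real measure)) ?E"
      by (simp_all add: sets_pair_measure)
    show "range (\<lambda>i::nat. space N \<times> (UNIV :: real set)) \<subseteq> ?E"
      by (rule image_subsetI, rule CollectI, rule exI[of _ "space N"], rule exI[of _ UNIV]) simp
    show "(\<Union>i::nat. space N \<times> (UNIV :: real set)) = space N \<times> space (borel :: real measure)" by auto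
    fix X assume "X \<in> ?E"
    then obtain A B where X: "X = A \<times> B" and [measurable]: "A \<in> sets N" "B \<in> sets borel" by auto
    have [measurable]: "(\<lambda>z. (fst z, \<Psi> z)) \<in> measurable ?K (N \<Otimes>\<^sub>M borel)" by measurable
    have "emeasure ?J1 X = emeasure ?K {z\<in>space ?K. fst z \<in> A \<and> \<Psi> z \<in> B}"
      unfolding X by (subst emeasure_distr) (auto intro!: arg_cong[where f="emeasure ?K"])
    moreover have "emeasure ?J2 X = emeasure M {x\<in>space M. \<phi> x \<in> A \<and> h x \<in> B}"
      unfolding X by (subst emeasure_distr) (auto intro!: arg_cong[where f="emeasure M"])
    ultimately show "emeasure ?J1 X = emeasure ?J2 X" using rect by simp
  next
    fix i :: nat
    show "emeasure ?J1 (space N \<times> UNIV) \<noteq> \<infinity>"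
    proof -
      have "finite_measure ?J1"
        using finite_measure_pair_measure[OF U.finite_measure_axioms \<nu>.finite_measure_axioms]
        by (rule finite_measure.finite_measure_distr) measurable
      then show ?thesis by (simp add: finite_measure.emeasure_finite)
    qed
  qed
  with \<Psi>_meas show ?thesis using that by blast
qed

text \<open>The real case is applied to the code \<open>h x\<close> of a point. Decoding by
  \<open>r\<close> turns the joint law with \<open>h x\<close> into the joint law with
  \<open>x\<close>, as \<open>r (h x) = x\<close>.\<close>

lemma randomization:
  fixes M :: "'x::polish_space measure"
  assumes M: "finite_measure M" and [measurable_cong]: "sets M = sets borel"
    and \<phi> [measurable]: "\<phi> \<in> measurable M N"
  obtains \<Psi> :: "'y \<times> real \<Rightarrow> 'x"
  where "\<Psi> \<in> borel_measurable (N \<Otimes>\<^sub>M borel)"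
    "distr (distr M N \<phi> \<Otimes>\<^sub>M unit_uniform) (N \<Otimes>\<^sub>M borel) (\<lambda>z. (fst z, \<Psi> z)) =
     distr M (N \<Otimes>\<^sub>M borel) (\<lambda>x. (\<phi> x, x))"
proof -
  obtain h :: "'x \<Rightarrow> real" and r :: "real \<Rightarrow> 'x"
    where [measurable]: "h \<in> borel_measurable borel" "r \<in> borel_measurable borel"
      and h01: "\<And>x. 0 \<le> h x" "\<And>x. h x \<le> 1" and rh: "\<And>x. r (h x) = x"
    using borel_retract_of_real by blast
  obtain \<Psi> where [measurable]: "\<Psi> \<in> borel_measurable (N \<Otimes>\<^sub>M borel)"
    and law: "distr (distr M N \<phi> \<Otimes>\<^sub>M unit_uniform) (N \<Otimes>\<^sub>M borel) (\<lambda>z. (fst z, \<Psi> z)) =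
      distr M (N \<Otimes>\<^sub>M borel) (\<lambda>x. (\<phi> x, h x))"
    using randomization_real[OF M \<phi>, of h] h01 by (metis measurable_cong_sets[OF \<open>sets M = sets borel\<close> refl] \<open>h \<in> borel_measurable borel\<close>)
  let ?R = "\<lambda>z. (fst z, r (snd z))"
  have [measurable]: "?R \<in> measurable (N \<Otimes>\<^sub>M borel) (N \<Otimes>\<^sub>M borel)" by measurable
  have "distr (distr M N \<phi> \<Otimes>\<^sub>M unit_uniform) (N \<Otimes>\<^sub>M borel) (\<lambda>z. (fst z, r (\<Psi> z))) =
      distr (distr (distr M N \<phi> \<Otimes>\<^sub>M unit_uniform) (N \<Otimes>\<^sub>M borel) (\<lambda>z. (fst z, \<Psi> z))) (N \<Otimes>\<^sub>M borel) ?R"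
    by (subst distr_distr) (auto simp: comp_def)
  also have "\<dots> = distr M (N \<Otimes>\<^sub>M borel) (\<lambda>x. (\<phi> x, x))"
    unfolding law by (subst distr_distr) (auto simp: comp_def rh)
  finally show ?thesis
    by (intro that[of "\<lambda>z. r (\<Psi> z)"]) measurable
qed

text \<open>\<open>\<kappa> y\<close> is the law of \<open>\<Psi> (y, u)\<close> for uniform
  \<open>u\<close>, hence a probability for every \<open>y\<close>, and the integral formulas are
  Tonelli and Fubini on the product with the uniform measure. Concentration on the fibres holds
  because the joint law of \<open>(\<phi> x, x)\<close> lives on the graph of
  \<open>\<phi>\<close>.\<close>

lemma disintegration_kernel:
  fixes M :: "'x::polish_space measure" and \<phi> :: "'x \<Rightarrow> 'y::polish_space"
  assumes M: "finite_measure M" and sets_M [measurable_cong]: "sets M = sets borel"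
    and \<phi>: "\<phi> \<in> borel_measurable borel"
  obtains \<kappa> :: "'y \<Rightarrow> 'x measure"
  where "\<And>y. sets (\<kappa> y) = sets borel" "\<And>y. emeasure (\<kappa> y) UNIV = 1"
    "\<And>F :: 'x \<Rightarrow> ennreal. F \<in> borel_measurable borel \<Longrightarrow> (\<lambda>y. \<integral>\<^sup>+x. F x \<partial>\<kappa> y) \<in> borel_measurable borel"
    "\<And>F :: 'x \<Rightarrow> ennreal. F \<in> borel_measurable borel \<Longrightarrow>
      (\<integral>\<^sup>+y. \<integral>\<^sup>+x. F x \<partial>\<kappa> y \<partial>distr M borel \<phi>) = (\<integral>\<^sup>+x. F x \<partial>M)"
    "\<And>f. f \<in> bounded_measurable borel \<Longrightarrow> (\<lambda>y. \<integral>x. f x \<partial>\<kappa> y) \<in> borel_measurable borel"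
    "\<And>f. f \<in> bounded_measurable borel \<Longrightarrow> (\<integral>y. \<integral>x. f x \<partial>\<kappa> y \<partial>distr M borel \<phi>) = (\<integral>x. f x \<partial>M)"
    "AE y in distr M borel \<phi>. emeasure (\<kappa> y) (UNIV - \<phi> -` {y}) = 0"
proof -
  interpret finite_measure M by fact
  note [measurable] = \<phi>
  have \<phi>M [measurable]: "\<phi> \<in> borel_measurable M" by measurable
  let ?\<nu> = "distr M borel \<phi>"
  interpret \<nu>: finite_measure ?\<nu> by (rule finite_measure_distr) measurable
  interpret U: finite_measure unit_uniform by (rule finite_measure_unit_uniform)
  interpret P: pair_sigma_finite ?\<nu> unit_uniform ..
  let ?K = "?\<nu> \<Otimes>\<^sub>M unit_uniform"
  have K: "finite_measure ?K"
    by (rule finite_measure_pair_measure[OF U.finite_measure_axioms \<nu>.finite_measure_axioms])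
  obtain \<Psi> :: "'y \<times> real \<Rightarrow> 'x" where \<Psi> [measurable]: "\<Psi> \<in> borel_measurable (borel \<Otimes>\<^sub>M borel)"
    and law: "distr ?K (borel \<Otimes>\<^sub>M borel) (\<lambda>z. (fst z, \<Psi> z)) = distr M (borel \<Otimes>\<^sub>M borel) (\<lambda>x. (\<phi> x, x))"
    using randomization[OF M sets_M \<phi>M] by blast
  have \<Psi>K [measurable]: "\<Psi> \<in> borel_measurable ?K" by measurable
  have marginal: "distr ?K borel \<Psi> = M"
  proof -
    have "distr ?K borel \<Psi> = distr (distr ?K (borel \<Otimes>\<^sub>M borel) (\<lambda>z. (fst z, \<Psi> z))) borel snd"
      by (subst distr_distr) (auto simp: comp_def)
    also have "\<dots> = distr M borel (\<lambda>x. x)"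
      unfolding law by (subst distr_distr) (auto simp: comp_def)
    finally show ?thesis using distr_id2[of borel M] sets_M by simp
  qed
  define \<kappa> where "\<kappa> y = distr unit_uniform borel (\<lambda>u. \<Psi> (y, u))" for y
  have \<Psi>y [measurable]: "(\<lambda>u. \<Psi> (y, u)) \<in> borel_measurable unit_uniform" for y by measurable
  have nn: "(\<integral>\<^sup>+x. F x \<partial>\<kappa> y) = (\<integral>\<^sup>+u. F (\<Psi> (y, u)) \<partial>unit_uniform)"
    if "F \<in> borel_measurable borel" for F :: "'x \<Rightarrow> ennreal" and y
    unfolding \<kappa>_def using that by (subst nn_integral_distr) auto
  have re: "(\<integral>x. f x \<partial>\<kappa> y) = (\<integral>u. f (\<Psi> (y, u)) \<partial>unit_uniform)"
    if "f \<in> borel_measurable borel" for f :: "'x \<Rightarrow> real" and y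
    unfolding \<kappa>_def using that by (subst integral_distr) auto
  show ?thesis
  proof (rule that[of \<kappa>])
    show "sets (\<kappa> y) = sets borel" for y by (simp add: \<kappa>_def)
    show "emeasure (\<kappa> y) UNIV = 1" for y by (simp add: \<kappa>_def emeasure_distr)
    show "(\<lambda>y. \<integral>\<^sup>+x. F x \<partial>\<kappa> y) \<in> borel_measurable borel" if [measurable]: "F \<in> borel_measurable borel"
      for F :: "'x \<Rightarrow> ennreal"
      unfolding nn[OF that] by measurable
    show "(\<integral>\<^sup>+y. \<integral>\<^sup>+x. F x \<partial>\<kappa> y \<partial>?\<nu>) = (\<integral>\<^sup>+x. F x \<partial>M)" if [measurable]: "F \<in> borel_measurable borel"
      for F :: "'x \<Rightarrow> ennreal"
    proof -
      have "(\<integral>\<^sup>+y. \<integral>\<^sup>+x. F x \<partial>\<kappa> y \<partial>?\<nu>) = (\<integral>\<^sup>+z. F (\<Psi> z) \<partial>?K)"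
        unfolding nn[OF that] by (rule U.nn_integral_fst) measurable
      also have "\<dots> = (\<integral>\<^sup>+x. F x \<partial>distr ?K borel \<Psi>)"
        by (rule nn_integral_distr[symmetric]) measurable
      finally show ?thesis unfolding marginal .
    qed
    show "(\<lambda>y. \<integral>x. f x \<partial>\<kappa> y) \<in> borel_measurable borel" if "f \<in> bounded_measurable borel" for f
    proof -
      have [measurable]: "f \<in> borel_measurable borel" using that by (simp add: bounded_measurable_def)
      have "(\<lambda>y. \<integral>u. f (\<Psi> (y, u)) \<partial>unit_uniform) \<in> borel_measurable borel"
        by (rule U.borel_measurable_lebesgue_integral) measurable
      then show ?thesis by (simp add: re)
    qed
    show "(\<integral>y. \<integral>x. f x \<partial>\<kappa> y \<partial>?\<nu>) = (\<integral>x. f x \<partial>M)" if f: "f \<in> bounded_measurable borel" for f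
    proof -
      have [measurable]: "f \<in> borel_measurable borel" using that by (simp add: bounded_measurable_def)
      obtain B where "\<And>x. \<bar>f x\<bar> \<le> B" using f by (auto simp: bounded_measurable_def)
      then have "integrable ?K (\<lambda>z. f (\<Psi> z))"
        by (intro finite_measure.integrable_const_bound[OF K, where B=B]) auto
      then have "(\<integral>y. \<integral>x. f x \<partial>\<kappa> y \<partial>?\<nu>) = (\<integral>z. f (\<Psi> z) \<partial>?K)"
        using P.integral_fst'[of "\<lambda>z. f (\<Psi> z)"] by (simp add: re)
      also have "\<dots> = (\<integral>x. f x \<partial>distr ?K borel \<Psi>)"
        by (rule integral_distr[symmetric]) measurable
      finally show ?thesis unfolding marginal .
    qed
    \<comment> \<open>The pairs off the graph of \<open>\<phi>\<close>, written with
      \<open>dist\<close> to exhibit the set as measurable for the product algebra. The joint law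
      does not charge it, so almost every section is null for the uniform measure.\<close>
    let ?off = "{z :: 'y \<times> 'x. dist (\<phi> (snd z)) (fst z) \<noteq> 0}"
    have off [measurable]: "?off \<in> sets (borel \<Otimes>\<^sub>M borel)"
    proof -
      have "(\<lambda>z :: 'y \<times> 'x. dist (\<phi> (snd z)) (fst z)) \<in> borel_measurable (borel \<Otimes>\<^sub>M borel)"
        by measurable
      from measurable_sets[OF this, of "- {0}"] show ?thesis
        by (simp add: space_pair_measure vimage_def)
    qed
    have "emeasure (distr ?K (borel \<Otimes>\<^sub>M borel) (\<lambda>z. (fst z, \<Psi> z))) ?off = 0"
      unfolding law using off by (subst emeasure_distr) auto
    then have "emeasure ?K ((\<lambda>z. (fst z, \<Psi> z)) -` ?off \<inter> space ?K) = 0"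
      using off by (subst (asm) emeasure_distr) auto
    moreover have offK: "(\<lambda>z. (fst z, \<Psi> z)) -` ?off \<inter> space ?K \<in> sets ?K"
      by (rule measurable_sets[OF _ off]) measurable
    ultimately have "(\<integral>\<^sup>+y. emeasure unit_uniform (Pair y -` ((\<lambda>z. (fst z, \<Psi> z)) -` ?off \<inter> space ?K)) \<partial>?\<nu>) = 0"
      by (simp add: U.emeasure_pair_measure_alt)
    then have "AE y in ?\<nu>. emeasure unit_uniform (Pair y -` ((\<lambda>z. (fst z, \<Psi> z)) -` ?off \<inter> space ?K)) = 0"
      by (subst (asm) nn_integral_0_iff_AE) (use U.measurable_emeasure_Pair[OF offK] in auto)
    then show "AE y in ?\<nu>. emeasure (\<kappa> y) (UNIV - \<phi> -` {y}) = 0"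
    proof eventually_elim
      case (elim y)
      have "\<phi> -` {y} \<in> sets borel" using measurable_sets[OF \<phi>, of "{y}"] by simp
      then have "UNIV - \<phi> -` {y} \<in> sets borel" by auto
      then have "emeasure (\<kappa> y) (UNIV - \<phi> -` {y}) =
          emeasure unit_uniform ((\<lambda>u. \<Psi> (y, u)) -` (UNIV - \<phi> -` {y}))"
        unfolding \<kappa>_def by (subst emeasure_distr) auto
      also have "(\<lambda>u. \<Psi> (y, u)) -` (UNIV - \<phi> -` {y}) = Pair y -` ((\<lambda>z. (fst z, \<Psi> z)) -` ?off \<inter> space ?K)"
        by (auto simp: space_pair_measure)
      finally show ?case using elim by simp
    qed
  qed
qed

section \<open>Approximate densities from the Radon--Nikodym property\<close>

text \<open>In a nonseparable space the difference of two Borel maps need not be Borel. Here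
  \<open>s\<close> has finitely many values, and on each of its fibres \<open>f\<close> is merely
  composed with the continuous map \<open>norm (w - v)\<close>.\<close>

lemma borel_measurable_norm_diff_simple:
  fixes f s :: "'y \<Rightarrow> 'b::real_normed_vector"
  assumes f: "f \<in> borel_measurable N" and s: "simple_function N s"
  shows "(\<lambda>y. ennreal (norm (f y - s y))) \<in> borel_measurable N"
proof (rule measurable_compose_countable'[where f="\<lambda>v y. ennreal (norm (f y - v))"])
  show "countable (s ` space N)"
    using simple_functionD(1)[OF s] by (rule countable_finite)
  show "s \<in> measurable N (count_space (s ` space N))"
    using simple_functionD[OF s] by (subst measurable_count_space_eq2) auto
  fix v :: 'b
  have "continuous_on UNIV (\<lambda>w. norm (w - v))" by (intro continuous_intros)
  then have "(\<lambda>w. norm (w - v)) \<in> borel_measurable borel"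
    by (rule borel_measurable_continuous_onI)
  from measurable_compose[OF f this]
  show "(\<lambda>y. ennreal (norm (f y - v))) \<in> borel_measurable N" by measurable
qed

lemma simple_function_completion:
  "simple_function M s \<Longrightarrow> simple_function (completion M) s"
  by (auto simp: simple_function_def)

lemma norm_simple_bochner_integral_le:
  fixes s :: "'y \<Rightarrow> 'b::real_normed_vector"
  assumes "Bochner_Integration.simple_bochner_integrable \<nu> s"
  shows "ennreal (norm (Bochner_Integration.simple_bochner_integral \<nu> s)) \<le> (\<integral>\<^sup>+y. norm (s y) \<partial>\<nu>)"
proof -
  have "Bochner_Integration.simple_bochner_integrable \<nu> (\<lambda>y. norm (s y))"
    using assms by (intro simple_bochner_integrable_compose2[where p="\<lambda>x y. norm x" and f=s and g=s]) auto
  then show ?thesis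
    using simple_bochner_integral_norm_bound[OF assms]
      simple_bochner_integral_eq_nn_integral[of \<nu> "\<lambda>y. norm (s y)"]
    by (metis ennreal_leI norm_ge_zero)
qed

text \<open>The estimate on which later comparisons with Bochner integrals rest: \<open>t\<close> is
  compared with the approximating sequence of \<open>f\<close>, where only integrals of simple maps
  occur, and the limit is taken.\<close>

lemma norm_Bochner_integral_diff_simple:
  assumes f: "has_Bochner_integral_strong \<nu> f v"
    and t: "Bochner_Integration.simple_bochner_integrable \<nu> t"
  shows "ennreal (norm (v - Bochner_Integration.simple_bochner_integral \<nu> t)) \<le>
    (\<integral>\<^sup>+y. norm (f y - t y) \<partial>completion \<nu>)"
proof -
  let ?I = "Bochner_Integration.simple_bochner_integral \<nu>"
  obtain s where s: "\<And>n. Bochner_Integration.simple_bochner_integrable \<nu> (s n)"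
    and lim0: "(\<lambda>n. \<integral>\<^sup>+ y. ennreal (norm (f y - s n y)) \<partial>completion \<nu>) \<longlonglongrightarrow> 0"
    and limv: "(\<lambda>n. ?I (s n)) \<longlonglongrightarrow> v"
    using f unfolding has_Bochner_integral_strong_def by blast
  have meas: "f \<in> borel_measurable (completion \<nu>)"
    using f unfolding has_Bochner_integral_strong_def strongly_measurable_def by blast
  have norm_meas: "(\<lambda>y. ennreal (norm (f y - u y))) \<in> borel_measurable (completion \<nu>)"
    if "Bochner_Integration.simple_bochner_integrable \<nu> u" for u
    using that
    by (intro borel_measurable_norm_diff_simple[OF meas] simple_function_completion)
       (auto elim: Bochner_Integration.simple_bochner_integrable.cases)
  have le: "ennreal (norm (?I (s n) - ?I t)) \<le>
    (\<integral>\<^sup>+y. norm (f y - s n y) \<partial>completion \<nu>) + (\<integral>\<^sup>+y. norm (f y - t y) \<partial>completion \<nu>)" for n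
  proof -
    have d: "Bochner_Integration.simple_bochner_integrable \<nu> (\<lambda>y. s n y - t y)"
      using s[of n] t by (intro simple_bochner_integrable_compose2[where p="\<lambda>x y. x - y"]) auto
    have "ennreal (norm (?I (s n) - ?I t)) = ennreal (norm (?I (\<lambda>y. s n y - t y)))"
      using simple_bochner_integral_diff[OF s t] by simp
    also have "\<dots> \<le> (\<integral>\<^sup>+y. norm (s n y - t y) \<partial>\<nu>)"
      by (rule norm_simple_bochner_integral_le[OF d])
    also have "\<dots> = (\<integral>\<^sup>+y. norm (s n y - t y) \<partial>completion \<nu>)"
      by (simp add: nn_integral_completion)
    also have "\<dots> \<le> (\<integral>\<^sup>+y. ennreal (norm (f y - s n y)) + ennreal (norm (f y - t y)) \<partial>completion \<nu>)"
    proof (rule nn_integral_mono)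
      fix y
      have "norm (s n y - t y) \<le> norm (f y - s n y) + norm (f y - t y)"
        using norm_triangle_ineq4[of "f y - t y" "f y - s n y"] by simp
      then show "ennreal (norm (s n y - t y)) \<le> ennreal (norm (f y - s n y)) + ennreal (norm (f y - t y))"
        by (simp flip: ennreal_plus add: ennreal_leI)
    qed
    also have "\<dots> = (\<integral>\<^sup>+y. norm (f y - s n y) \<partial>completion \<nu>) + (\<integral>\<^sup>+y. norm (f y - t y) \<partial>completion \<nu>)"
      by (intro nn_integral_add norm_meas s t)
    finally show ?thesis .
  qed
  have "(\<lambda>n. ennreal (norm (?I (s n) - ?I t))) \<longlonglongrightarrow> ennreal (norm (v - ?I t))"
    using limv by (intro tendsto_intros) auto
  moreover have "(\<lambda>n. (\<integral>\<^sup>+y. norm (f y - s n y) \<partial>completion \<nu>) + (\<integral>\<^sup>+y. norm (f y - t y) \<partial>completion \<nu>))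
      \<longlonglongrightarrow> (\<integral>\<^sup>+y. norm (f y - t y) \<partial>completion \<nu>)"
    using tendsto_add[OF lim0 tendsto_const] by simp
  ultimately show ?thesis
    by (rule LIMSEQ_le) (use le in blast)
qed

lemma simple_bochner_integrable_finite_measure:
  assumes "finite_measure M" "simple_function M s"
  shows "Bochner_Integration.simple_bochner_integrable M s"
  using assms finite_measure.emeasure_finite[OF assms(1)]
  by (auto intro: Bochner_Integration.simple_bochner_integrable.intros)

lemma simple_function_restrict:
  fixes s :: "'x \<Rightarrow> 'b::real_vector"
  assumes "simple_function M s" "A \<in> sets M"
  shows "simple_function M (\<lambda>x. indicator A x *\<^sub>R s x)"
  using simple_function_compose1[OF simple_function_Pair[OF simple_function_indicator[OF assms(2)] assms(1)],
      of "\<lambda>(a, b). a *\<^sub>R b"] by simp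

text \<open>
  Replacing an approximant of the density by its averages \<open>\<Omega> A / \<mu> A\<close> over its own fibres at most
  doubles the \<open>L\<^sup>1\<close> error, and makes it bounded by 1.
\<close>

lemma density_approx_by_averages:
  fixes \<Omega> :: "'x set \<Rightarrow> 'b::banach" and e :: real
  assumes M: "finite_measure M"
    and dom: "\<And>E. E \<in> sets M \<Longrightarrow> norm (\<Omega> E) \<le> measure M E"
    and g: "has_Bochner_integral_strong M g v"
    and dens: "\<And>E. E \<in> sets M \<Longrightarrow> has_Bochner_integral_strong M (\<lambda>x. indicator E x *\<^sub>R g x) (\<Omega> E)"
    and e: "0 < e"
  obtains s where "simple_function M s" "\<And>x. norm (s x) \<le> 1"
    "(\<integral>\<^sup>+x. norm (g x - s x) \<partial>completion M) < ennreal e"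
proof -
  interpret finite_measure M by fact
  let ?I = "Bochner_Integration.simple_bochner_integral M"
  obtain S where S: "\<And>n. Bochner_Integration.simple_bochner_integrable M (S n)"
    and lim0: "(\<lambda>n. \<integral>\<^sup>+ y. ennreal (norm (g y - S n y)) \<partial>completion M) \<longlonglongrightarrow> 0"
    using g unfolding has_Bochner_integral_strong_def by blast
  \<comment> \<open>The other half of \<open>e\<close> is reserved for the passage from the
    approximant to its averages.\<close>
  have "0 < ennreal (e / 2)" using e by simp
  from order_tendstoD(2)[OF lim0 this] obtain n where
    n: "(\<integral>\<^sup>+ y. ennreal (norm (g y - S n y)) \<partial>completion M) < ennreal (e / 2)"
    by (auto simp: eventually_sequentially)
  define t where "t = S n"
  have t: "simple_function M t"
    using S[of n] unfolding t_def by (auto elim: Bochner_Integration.simple_bochner_integrable.cases)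
  have g_meas: "g \<in> borel_measurable (completion M)"
    using g unfolding has_Bochner_integral_strong_def strongly_measurable_def by blast
  have gt_meas: "(\<lambda>x. ennreal (norm (g x - t x))) \<in> borel_measurable (completion M)"
    by (intro borel_measurable_norm_diff_simple g_meas simple_function_completion t)
  define A where "A w = t -` {w} \<inter> space M" for w
  have A [measurable]: "A w \<in> sets M" for w
    unfolding A_def using simple_functionD(2)[OF t] .
  \<comment> \<open>On null pieces the inverse of 0 is 0, so the average is 0 there and the bound by
    1 persists.\<close>
  define c where "c w = \<Omega> (A w) /\<^sub>R measure M (A w)" for w
  define s where "s x = c (t x)" for x
  have s: "simple_function M s" unfolding s_def using t by (rule simple_function_compose1)
  have c1: "norm (c w) \<le> 1" for w
  proof (cases "measure M (A w) = 0")
    case False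
    then have "0 < measure M (A w)" using measure_nonneg[of M "A w"] by linarith
    then show ?thesis using dom[OF A, of w] by (simp add: c_def divide_simps mult.commute)
  qed (simp add: c_def)
  have fin: "finite (t ` space M)" using t by (rule simple_functionD)
  \<comment> \<open>\<open>measure M (A w)\<close> times \<open>w - c w\<close> is the integral of
    \<open>t - g\<close> over \<open>A w\<close>, so its norm is at most the error of
    \<open>t\<close> on that piece. On a null piece \<open>\<Omega>\<close> vanishes by
    \<open>dom\<close>.\<close>
  have piece: "ennreal (norm (w - c w)) * emeasure M (A w) \<le>
      (\<integral>\<^sup>+x. ennreal (norm (g x - t x)) * indicator (A w) x \<partial>completion M)" for w
  proof -
    have ti: "Bochner_Integration.simple_bochner_integrable M (\<lambda>x. indicator (A w) x *\<^sub>R t x)"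
      by (intro simple_bochner_integrable_finite_measure M simple_function_restrict t A)
    have eq: "(\<lambda>x. indicator (A w) x *\<^sub>R t x) = (\<lambda>x. indicator (A w) x *\<^sub>R w)"
      by (auto simp: A_def indicator_def)
    have "?I (\<lambda>x. indicator (A w) x *\<^sub>R t x) = simple_int M (\<lambda>_. w) (indicator (A w))"
      unfolding eq by (rule simple_bochner_integral_indicator[OF M _ A, where s="\<lambda>_. w"]) simp
    also have "\<dots> = measure M (A w) *\<^sub>R w"
    proof (cases "space M = {}")
      case True
      then show ?thesis by (simp add: simple_int_def A_def)
    next
      case False
      have "(\<integral>x. indicator ((\<lambda>_. w) -` {w}) x * indicator (A w) x \<partial>M) = measure M (A w)"
        using emeasure_finite[of "A w"] by (simp add: less_top[symmetric])
      then show ?thesis using False by (simp add: simple_int_def image_constant_conv)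
    qed
    finally have I: "?I (\<lambda>x. indicator (A w) x *\<^sub>R t x) = measure M (A w) *\<^sub>R w" .
    have "measure M (A w) *\<^sub>R (w - c w) = measure M (A w) *\<^sub>R w - \<Omega> (A w)"
    proof (cases "measure M (A w) = 0")
      case True
      then show ?thesis using dom[OF A, of w] by simp
    next
      case False
      then show ?thesis by (simp add: c_def scaleR_diff_right)
    qed
    then have "measure M (A w) * norm (w - c w) = norm (\<Omega> (A w) - measure M (A w) *\<^sub>R w)"
      by (metis abs_of_nonneg measure_nonneg norm_minus_commute norm_scaleR)
    then have "ennreal (norm (w - c w)) * emeasure M (A w) =
        ennreal (norm (\<Omega> (A w) - measure M (A w) *\<^sub>R w))"
      by (simp add: emeasure_eq_measure mult.commute flip: ennreal_mult)
    also have "\<dots> \<le> (\<integral>\<^sup>+x. ennreal (norm (indicator (A w) x *\<^sub>R g x - indicator (A w) x *\<^sub>R t x)) \<partial>completion M)"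
      using norm_Bochner_integral_diff_simple[OF dens[OF A] ti] unfolding I .
    also have "\<dots> = (\<integral>\<^sup>+x. ennreal (norm (g x - t x)) * indicator (A w) x \<partial>completion M)"
      by (intro nn_integral_cong) (auto simp: indicator_def)
    finally show ?thesis .
  qed
  have sumA: "(\<Sum>w\<in>t ` space M. F w * indicator (A w) x) = F (t x)" if "x \<in> space M" for x and F :: "'b \<Rightarrow> ennreal"
  proof -
    have "(\<Sum>w\<in>t ` space M. F w * indicator (A w) x) = (\<Sum>w\<in>t ` space M. if w = t x then F w else (0::ennreal))"
      using that by (intro sum.cong) (auto simp: A_def indicator_def)
    then show ?thesis using that fin by simp
  qed
  have "(\<integral>\<^sup>+x. norm (t x - s x) \<partial>completion M) =
      (\<integral>\<^sup>+x. (\<Sum>w\<in>t ` space M. ennreal (norm (w - c w)) * indicator (A w) x) \<partial>M)"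
    unfolding nn_integral_completion
    by (intro nn_integral_cong) (simp add: sumA[of _ "\<lambda>w. ennreal (norm (w - c w))"] s_def)
  also have "\<dots> = (\<Sum>w\<in>t ` space M. ennreal (norm (w - c w)) * emeasure M (A w))"
    by (subst nn_integral_sum) (auto simp: nn_integral_cmult)
  also have "\<dots> \<le> (\<Sum>w\<in>t ` space M. \<integral>\<^sup>+x. ennreal (norm (g x - t x)) * indicator (A w) x \<partial>completion M)"
    by (intro sum_mono piece)
  also have "\<dots> = (\<integral>\<^sup>+x. (\<Sum>w\<in>t ` space M. ennreal (norm (g x - t x)) * indicator (A w) x) \<partial>completion M)"
    using gt_meas A by (intro nn_integral_sum[symmetric] borel_measurable_times_ennreal borel_measurable_indicator) auto
  also have "\<dots> = (\<integral>\<^sup>+x. ennreal (norm (g x - t x)) \<partial>completion M)"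
    by (intro nn_integral_cong) (rule sumA[of _ "\<lambda>_. _"], simp)
  finally have ts: "(\<integral>\<^sup>+x. norm (t x - s x) \<partial>completion M) \<le> (\<integral>\<^sup>+x. norm (g x - t x) \<partial>completion M)" .
  have t_meas: "(\<lambda>x. ennreal (norm (t x - s x))) \<in> borel_measurable (completion M)"
    by (intro borel_measurable_norm_diff_simple borel_measurable_simple_function simple_function_completion s t)
  have "(\<integral>\<^sup>+x. norm (g x - s x) \<partial>completion M) \<le>
      (\<integral>\<^sup>+x. ennreal (norm (g x - t x)) + ennreal (norm (t x - s x)) \<partial>completion M)"
  proof (rule nn_integral_mono)
    fix x
    have "norm (g x - s x) \<le> norm (g x - t x) + norm (t x - s x)"
      using norm_triangle_ineq[of "g x - t x" "t x - s x"] by simp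
    then show "ennreal (norm (g x - s x)) \<le> ennreal (norm (g x - t x)) + ennreal (norm (t x - s x))"
      by (simp flip: ennreal_plus add: ennreal_leI)
  qed
  also have "\<dots> = (\<integral>\<^sup>+x. norm (g x - t x) \<partial>completion M) + (\<integral>\<^sup>+x. norm (t x - s x) \<partial>completion M)"
    by (intro nn_integral_add gt_meas t_meas)
  also have "\<dots> \<le> (\<integral>\<^sup>+x. norm (g x - t x) \<partial>completion M) + (\<integral>\<^sup>+x. norm (g x - t x) \<partial>completion M)"
    using ts by (intro add_left_mono)
  also have "\<dots> < ennreal (e / 2) + ennreal (e / 2)"
    using n unfolding t_def by (intro add_strict_mono)
  also have "\<dots> = ennreal e" using e by (simp flip: ennreal_plus)
  finally show ?thesis using that[of s] s c1 unfolding s_def by blast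
qed

text \<open>The density itself disappears from the conclusion. What survives is a sequence of simple
  maps, which can also be integrated against the fibre measures.\<close>

lemma radon_nikodym_simple_sequence:
  fixes M :: "'u measure" and \<Omega> :: "'u set \<Rightarrow> 'b::banach"
  assumes rnp: "radon_nikodym_property_on TYPE('u) TYPE('b)" and M: "finite_measure M"
    and \<Omega>: "vector_measure M \<Omega>" and dom: "\<And>E. E \<in> sets M \<Longrightarrow> norm (\<Omega> E) \<le> measure M E"
  obtains s :: "nat \<Rightarrow> 'u \<Rightarrow> 'b"
  where "\<And>n. simple_function M (s n)" "\<And>n x. norm (s n x) \<le> 1"
    "\<And>n. (\<integral>\<^sup>+x. norm (s n x - s (Suc n) x) \<partial>M) \<le> ennreal ((1 / 2) ^ n)"
    "\<And>E. E \<in> sets M \<Longrightarrow> (\<lambda>n. simple_int M (s n) (indicator E)) \<longlonglongrightarrow> \<Omega> E"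
proof -
  interpret finite_measure M by fact
  let ?I = "Bochner_Integration.simple_bochner_integral M"
  have "variation M \<Omega> (space M) \<le> emeasure M (space M)"
    using dom by (intro dominated_variation_le) (auto simp: emeasure_eq_measure)
  then have bv: "bounded_variation M \<Omega>"
    unfolding bounded_variation_def using emeasure_finite[of "space M"]
    by (auto simp: less_top[symmetric] top_unique)
  have null: "\<Omega> N = 0" if "N \<in> null_sets M" for N
    using dom[of N] that by (auto simp: null_sets_def measure_def)
  have "\<exists>g. (\<exists>v. has_Bochner_integral_strong M g v) \<and>
      (\<forall>E\<in>sets M. has_Bochner_integral_strong M (\<lambda>x. indicator E x *\<^sub>R g x) (\<Omega> E))"
    using null
    by (intro rnp[unfolded radon_nikodym_property_on_def, rule_format]
        sigma_finite_measure_axioms \<Omega> bv) simp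
  then obtain g v where g: "has_Bochner_integral_strong M g v"
    and dens: "\<And>E. E \<in> sets M \<Longrightarrow> has_Bochner_integral_strong M (\<lambda>x. indicator E x *\<^sub>R g x) (\<Omega> E)"
    by blast
  have g_meas: "g \<in> borel_measurable (completion M)"
    using g unfolding has_Bochner_integral_strong_def strongly_measurable_def by blast
  \<comment> \<open>With errors \<open>(1/2)^(n+1)\<close>, two consecutive ones add up to at most
    \<open>(1/2)^n\<close>, the required increment.\<close>
  have "\<exists>s. simple_function M s \<and> (\<forall>x. norm (s x) \<le> 1) \<and>
      (\<integral>\<^sup>+x. norm (g x - s x) \<partial>completion M) < ennreal ((1 / 2) ^ Suc n)" for n
    by (rule density_approx_by_averages[OF M dom g dens, of "(1 / 2) ^ Suc n"]) auto
  then obtain s where s: "\<And>n. simple_function M (s n)" and s1: "\<And>n x. norm (s n x) \<le> 1"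
    and close: "\<And>n. (\<integral>\<^sup>+x. norm (g x - s n x) \<partial>completion M) < ennreal ((1 / 2) ^ Suc n)"
    by metis
  have gs_meas: "(\<lambda>x. ennreal (norm (g x - s n x))) \<in> borel_measurable (completion M)" for n
    by (intro borel_measurable_norm_diff_simple g_meas simple_function_completion s)
  show ?thesis
  proof (rule that[OF s s1])
    fix n
    have "(\<integral>\<^sup>+x. norm (s n x - s (Suc n) x) \<partial>M) = (\<integral>\<^sup>+x. norm (s n x - s (Suc n) x) \<partial>completion M)"
      by (simp add: nn_integral_completion)
    also have "\<dots> \<le> (\<integral>\<^sup>+x. ennreal (norm (g x - s n x)) + ennreal (norm (g x - s (Suc n) x)) \<partial>completion M)"
    proof (rule nn_integral_mono)
      fix x
      have "norm (s n x - s (Suc n) x) \<le> norm (g x - s n x) + norm (g x - s (Suc n) x)"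
        using norm_triangle_ineq4[of "g x - s (Suc n) x" "g x - s n x"] by simp
      then show "ennreal (norm (s n x - s (Suc n) x)) \<le> ennreal (norm (g x - s n x)) + ennreal (norm (g x - s (Suc n) x))"
        by (simp flip: ennreal_plus add: ennreal_leI)
    qed
    also have "\<dots> = (\<integral>\<^sup>+x. norm (g x - s n x) \<partial>completion M) + (\<integral>\<^sup>+x. norm (g x - s (Suc n) x) \<partial>completion M)"
      by (intro nn_integral_add gs_meas)
    also have "\<dots> \<le> ennreal ((1 / 2) ^ Suc n) + ennreal ((1 / 2) ^ Suc (Suc n))"
      using close[of n] close[of "Suc n"] by (intro add_mono) auto
    also have "\<dots> = ennreal ((1 / 2) ^ Suc n + (1 / 2) ^ Suc (Suc n))"
      by (simp flip: ennreal_plus)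
    also have "\<dots> \<le> ennreal ((1 / 2) ^ n)"
      by (intro ennreal_leI) simp
    finally show "(\<integral>\<^sup>+x. norm (s n x - s (Suc n) x) \<partial>M) \<le> ennreal ((1 / 2) ^ n)" .
  next
    fix E assume E: "E \<in> sets M"
    have "\<forall>n. norm (simple_int M (s n) (indicator E) - \<Omega> E) \<le> (1 / 2) ^ Suc n"
    proof
      fix n
      have ti: "Bochner_Integration.simple_bochner_integrable M (\<lambda>x. indicator E x *\<^sub>R s n x)"
        by (intro simple_bochner_integrable_finite_measure M simple_function_restrict s E)
      have "ennreal (norm (\<Omega> E - simple_int M (s n) (indicator E))) \<le>
        (\<integral>\<^sup>+x. norm (indicator E x *\<^sub>R g x - indicator E x *\<^sub>R s n x) \<partial>completion M)"
        using norm_Bochner_integral_diff_simple[OF dens[OF E] ti]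
        unfolding simple_bochner_integral_indicator[OF M s E] .
      also have "\<dots> \<le> (\<integral>\<^sup>+x. norm (g x - s n x) \<partial>completion M)"
        by (intro nn_integral_mono) (auto simp: indicator_def)
      also have "\<dots> \<le> ennreal ((1 / 2) ^ Suc n)" using close[of n] by simp
      finally show "norm (simple_int M (s n) (indicator E) - \<Omega> E) \<le> (1 / 2) ^ Suc n"
        by (simp add: norm_minus_commute)
    qed
    then have "(\<lambda>n. simple_int M (s n) (indicator E) - \<Omega> E) \<longlonglongrightarrow> 0"
    proof (rule Lim_null_comparison[OF always_eventually])
      show "(\<lambda>n. (1 / 2 :: real) ^ Suc n) \<longlonglongrightarrow> 0"
        by (rule LIMSEQ_Suc[OF LIMSEQ_realpow_zero]) auto
    qed
    then show "(\<lambda>n. simple_int M (s n) (indicator E)) \<longlonglongrightarrow> \<Omega> E"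
      by (simp add: LIM_zero_iff)
  qed
qed

section \<open>Transfer of the approximants from the line to Polish spaces\<close>

lemma simple_int_superset:
  assumes "finite V" "s ` space m \<subseteq> V"
  shows "simple_int m s f = (\<Sum>v\<in>V. (\<integral>x. indicator (s -` {v}) x * f x \<partial>m) *\<^sub>R v)"
  unfolding simple_int_def
proof (rule sum.mono_neutral_left[OF assms], rule ballI)
  fix v assume "v \<in> V - s ` space m"
  then have "(\<integral>x. indicator (s -` {v}) x * f x \<partial>m) = (\<integral>x. 0 \<partial>m)"
    by (intro Bochner_Integration.integral_cong) (auto simp: indicator_def)
  then show "(\<integral>x. indicator (s -` {v}) x * f x \<partial>m) *\<^sub>R v = 0" by simp
qed

lemma simple_int_distr:
  assumes h: "h \<in> measurable M N" and s: "simple_function N s" and f: "f \<in> borel_measurable N"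
  shows "simple_int (distr M N h) s f = simple_int M (\<lambda>x. s (h x)) (\<lambda>x. f (h x))"
proof -
  have "(\<integral>x. indicator (s -` {v}) x * f x \<partial>distr M N h) =
      (\<integral>x. indicator ((\<lambda>x. s (h x)) -` {v}) x * f (h x) \<partial>M)" for v
  proof -
    have "s -` {v} \<inter> space N \<in> sets N" using s by (rule simple_functionD)
    then have "(\<lambda>x. indicator (s -` {v} \<inter> space N) x * f x) \<in> borel_measurable N"
      using f by measurable
    then have "(\<lambda>x. indicator (s -` {v}) x * f x) \<in> borel_measurable N"
      by (rule measurable_cong[THEN iffD1, rotated]) (auto simp: indicator_def)
    from integral_distr[OF h this] show ?thesis by (simp add: indicator_def)
  qed
  moreover have "(\<lambda>x. s (h x)) ` space M \<subseteq> s ` space N"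
    using measurable_space[OF h] by auto
  ultimately show ?thesis
    using simple_functionD(1)[OF s]
    by (subst simple_int_superset[of "s ` space N" "\<lambda>x. s (h x)"]) (auto simp: simple_int_def)
qed

text \<open>Every Borel set \<open>E\<close> is the preimage under \<open>h\<close> of the preimage
  of \<open>E\<close> under \<open>r\<close>. Hence the image of \<open>\<Omega>\<close> on the line
  loses no information: approximants found there, composed with \<open>h\<close>, converge to
  \<open>\<Omega>\<close> on all Borel sets.\<close>

lemma radon_nikodym_simple_sequence_polish:
  fixes M :: "'x::polish_space measure" and \<Omega> :: "'x set \<Rightarrow> 'b::banach"
  assumes rnp: "radon_nikodym_property TYPE('b)"
    and M: "finite_measure M" and sets_M [measurable_cong]: "sets M = sets borel"
    and \<Omega>: "vector_measure M \<Omega>" and dom: "\<And>E. E \<in> sets M \<Longrightarrow> norm (\<Omega> E) \<le> measure M E"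
  obtains s :: "nat \<Rightarrow> 'x \<Rightarrow> 'b"
  where "\<And>n. simple_function M (s n)" "\<And>n x. norm (s n x) \<le> 1"
    "\<And>n. (\<integral>\<^sup>+x. norm (s n x - s (Suc n) x) \<partial>M) \<le> ennreal ((1 / 2) ^ n)"
    "\<And>E. E \<in> sets M \<Longrightarrow> (\<lambda>n. simple_int M (s n) (indicator E)) \<longlonglongrightarrow> \<Omega> E"
proof -
  interpret finite_measure M by fact
  obtain h :: "'x \<Rightarrow> real" and r :: "real \<Rightarrow> 'x"
    where h: "h \<in> borel_measurable borel" and r: "r \<in> borel_measurable borel"
      and rh: "\<And>x. r (h x) = x"
    using borel_retract_of_real by metis
  have [measurable]: "h \<in> borel_measurable M"
    using h by (simp add: measurable_cong_sets[OF sets_M refl])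
  have sp: "space M = UNIV" using sets_eq_imp_space_eq[OF sets_M] by simp
  have pre: "h -` B \<in> sets M" if "B \<in> sets borel" for B
    using measurable_sets[OF \<open>h \<in> borel_measurable M\<close> that] sp by simp
  define M' where "M' = distr M borel h"
  define \<Omega>' where "\<Omega>' B = \<Omega> (h -` B)" for B
  have M': "finite_measure M'" unfolding M'_def by (rule finite_measure_distr) measurable
  have \<Omega>': "vector_measure M' \<Omega>'"
    unfolding vector_measure_def \<Omega>'_def vimage_UN
  proof (intro allI impI \<Omega>[unfolded vector_measure_def, rule_format])
    fix A :: "nat \<Rightarrow> real set" assume A: "range A \<subseteq> sets M'" "disjoint_family A"
    show "range (\<lambda>n. h -` A n) \<subseteq> sets M" using A(1) pre by (auto simp: M'_def)
    show "disjoint_family (\<lambda>n. h -` A n)" using A(2) by (rule disjoint_family_on_vimageI)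
  qed
  have dom': "norm (\<Omega>' B) \<le> measure M' B" if "B \<in> sets M'" for B
    using dom[OF pre, of B] that by (simp add: M'_def \<Omega>'_def measure_distr sp)
  obtain s where s: "\<And>n. simple_function M' (s n)" and s1: "\<And>n x. norm (s n x) \<le> 1"
    and close: "\<And>n. (\<integral>\<^sup>+x. norm (s n x - s (Suc n) x) \<partial>M') \<le> ennreal ((1 / 2) ^ n)"
    and lim: "\<And>E. E \<in> sets M' \<Longrightarrow> (\<lambda>n. simple_int M' (s n) (indicator E)) \<longlonglongrightarrow> \<Omega>' E"
    using radon_nikodym_simple_sequence[OF rnp[unfolded radon_nikodym_property_def] M' \<Omega>' dom'] by blast
  have sb: "simple_function borel (s n)" for n
    using s[of n] by (simp add: M'_def simple_function_def)
  show ?thesis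
  proof (rule that[of "\<lambda>n x. s n (h x)"])
    show "simple_function M (\<lambda>x. s n (h x))" for n
      unfolding simple_function_def
    proof (intro conjI ballI)
      have "finite (s n ` UNIV)" using simple_functionD(1)[OF sb[of n]] by simp
      then show "finite ((\<lambda>x. s n (h x)) ` space M)" by (rule rev_finite_subset) auto
      fix v
      have "s n -` {v} \<in> sets borel" using simple_functionD(2)[OF sb[of n], of "{v}"] by simp
      from pre[OF this] show "(\<lambda>x. s n (h x)) -` {v} \<inter> space M \<in> sets M" by (simp add: sp vimage_comp[symmetric] comp_def vimage_def)
    qed
    show "norm (s n (h x)) \<le> 1" for n x by (rule s1)
    fix n
    have "simple_function borel (\<lambda>x. s n x - s (Suc n) x)"
      using simple_function_compose1[OF simple_function_Pair[OF sb[of n] sb[of "Suc n"]], of "\<lambda>(a, b). a - b"] by simp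
    then have "simple_function borel (\<lambda>x. ennreal (norm (s n x - s (Suc n) x)))"
      by (rule simple_function_compose1)
    then have "(\<lambda>x. ennreal (norm (s n x - s (Suc n) x))) \<in> borel_measurable borel"
      by (rule borel_measurable_simple_function)
    then show "(\<integral>\<^sup>+x. norm (s n (h x) - s (Suc n) (h x)) \<partial>M) \<le> ennreal ((1 / 2) ^ n)"
      using close[of n] unfolding M'_def by (subst (asm) nn_integral_distr) auto
  next
    fix E assume "E \<in> sets M"
    then have E: "r -` E \<in> sets borel" using measurable_sets[OF r, of E] by (simp add: sets_M)
    have "h -` r -` E = E" by (auto simp: rh)
    moreover have "simple_int M' (s n) (indicator (r -` E)) = simple_int M (\<lambda>x. s n (h x)) (indicator E)" for n
      unfolding M'_def using E
      by (subst simple_int_distr[OF _ sb]) (auto simp: indicator_def rh intro!: arg_cong[where f="simple_int M _"])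
    ultimately show "(\<lambda>n. simple_int M (\<lambda>x. s n (h x)) (indicator E)) \<longlonglongrightarrow> \<Omega> E"
      using lim[of "r -` E"] E by (simp add: M'_def \<Omega>'_def)
  qed
qed

text \<open>The sequence \<open>s\<close> stays fixed while \<open>m\<close> varies over
  \<open>\<mu>\<close> and the fibre measures. The limit acts as the integral of \<open>f\<close>
  against a density that is never named as a function.\<close>

definition density_int :: "(nat \<Rightarrow> 'x \<Rightarrow> 'b::real_normed_vector) \<Rightarrow> 'x measure \<Rightarrow> ('x \<Rightarrow> real) \<Rightarrow> 'b" where
  "density_int s m f = lim (\<lambda>n. simple_int m (s n) f)"

text \<open>\<open>M\<close> fixes the algebra for which the maps are simple, and \<open>m\<close>
  is the measure to integrate against. Summable increments make all the limits exist; the bound 1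
  makes the resulting vector measure dominated by \<open>m\<close>.\<close>

locale simple_density =
  fixes M :: "'x measure" and s :: "nat \<Rightarrow> 'x \<Rightarrow> 'b::banach" and m :: "'x measure"
  assumes simple_M: "\<And>n. simple_function M (s n)"
    and norm_s: "\<And>n x. norm (s n x) \<le> 1"
    and finite_m: "finite_measure m"
    and sets_m: "sets m = sets M"
    and summable_m: "(\<Sum>n. \<integral>\<^sup>+x. norm (s n x - s (Suc n) x) \<partial>m) < \<infinity>"
begin

sublocale finite_measure m by (rule finite_m)

lemma space_m: "space m = space M"
  using sets_m by (rule sets_eq_imp_space_eq)

lemma simple: "simple_function m (s n)"
  using simple_M simple_function_cong_algebra[OF sets_m[symmetric] space_m[symmetric]] by blast

lemma simple_diff: "simple_function m (\<lambda>x. s n x - s (Suc n) x)"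
  using simple_function_compose1[OF simple_function_Pair[OF simple[of n] simple[of "Suc n"]], of "\<lambda>(a, b). a - b"]
  by simp

lemma integrable_bounded_measurable:
  assumes "f \<in> bounded_measurable M"
  shows "integrable m f"
proof -
  obtain K where "\<And>x. x \<in> space M \<Longrightarrow> \<bar>f x\<bar> \<le> K" and "f \<in> borel_measurable M"
    using assms by (auto simp: bounded_measurable_def)
  then show ?thesis
    by (intro integrable_const_bound[where B=K]) (auto simp: space_m measurable_cong_sets[OF sets_m refl])
qed

lemma norm_simple_int_bound:
  assumes f: "f \<in> bounded_measurable M"
  shows "norm (simple_int m (s n) f) \<le> (\<integral>x. \<bar>f x\<bar> \<partial>m)"
proof -
  note i = integrable_bounded_measurable[OF f]
  have "norm (simple_int m (s n) f) \<le> (\<integral>x. \<bar>f x\<bar> * norm (s n x) \<partial>m)"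
    by (rule norm_simple_int_le[OF simple i])
  also have "\<dots> \<le> (\<integral>x. \<bar>f x\<bar> \<partial>m)"
    using i norm_s by (intro integral_mono integrable_mult_simple_norm simple) (auto simp: mult_left_le)
  finally show ?thesis .
qed

text \<open>The increments of the integrals are at most \<open>K\<close> times those of the maps in
  \<open>L\<^sup>1(m)\<close>, so their series is absolutely summable and telescopes to a limit by
  completeness.\<close>

lemma density_int_limit:
  assumes f: "f \<in> bounded_measurable M"
  shows "(\<lambda>n. simple_int m (s n) f) \<longlonglongrightarrow> density_int s m f"
proof -
  let ?x = "\<lambda>n. simple_int m (s n) f"
  let ?a = "\<lambda>n. \<integral>x. norm (s n x - s (Suc n) x) \<partial>m"
  note i = integrable_bounded_measurable[OF f]
  obtain K where K: "\<And>x. x \<in> space M \<Longrightarrow> \<bar>f x\<bar> \<le> K"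
    using f by (auto simp: bounded_measurable_def)
  have ia: "integrable m (\<lambda>x. norm (s n x - s (Suc n) x))" for n
    using integrable_mult_simple_norm[OF simple_diff, of "\<lambda>_. 1"] by simp
  have "(\<integral>\<^sup>+x. norm (s n x - s (Suc n) x) \<partial>m) = ennreal (?a n)" for n
    by (intro nn_integral_eq_integral ia) simp
  then have "summable ?a"
    using summable_m by (intro summable_suminf_not_top) auto
  have "norm (?x (Suc n) - ?x n) \<le> K * ?a n" for n
  proof -
    have "norm (?x (Suc n) - ?x n) = norm (simple_int m (\<lambda>x. s n x - s (Suc n) x) f)"
      by (subst norm_minus_commute) (simp only: simple_int_diff[OF simple simple i])
    also have "\<dots> \<le> (\<integral>x. \<bar>f x\<bar> * norm (s n x - s (Suc n) x) \<partial>m)"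
      by (rule norm_simple_int_le[OF simple_diff i])
    also have "\<dots> \<le> (\<integral>x. K * norm (s n x - s (Suc n) x) \<partial>m)"
      using K by (intro integral_mono integrable_mult_simple_norm simple_diff i integrable_mult_right ia)
        (auto simp: space_m intro!: mult_right_mono)
    finally show ?thesis by simp
  qed
  then have "summable (\<lambda>n. ?x (Suc n) - ?x n)"
    by (rule summable_comparison_test'[OF summable_mult[OF \<open>summable ?a\<close>]])
  then have "convergent (\<lambda>n. ?x n - ?x 0)"
    unfolding summable_iff_convergent sum_lessThan_telescope[of ?x] .
  then have "convergent (\<lambda>n. (?x n - ?x 0) + ?x 0)"
    by (rule convergent_add[OF _ convergent_const])
  then show ?thesis
    unfolding density_int_def by (simp add: convergent_LIMSEQ_iff)
qed

lemma norm_density_int: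
  assumes f: "f \<in> bounded_measurable M"
  shows "norm (density_int s m f) \<le> (\<integral>x. \<bar>f x\<bar> \<partial>m)"
  using tendsto_norm[OF density_int_limit[OF f]] norm_simple_int_bound[OF f]
  by (intro LIMSEQ_le_const2[where a="\<integral>x. \<bar>f x\<bar> \<partial>m"]) auto

lemma density_int_add:
  assumes f: "f \<in> bounded_measurable M" and g: "g \<in> bounded_measurable M"
  shows "density_int s m (\<lambda>x. f x + g x) = density_int s m f + density_int s m g"
proof -
  have "(\<lambda>n. simple_int m (s n) (\<lambda>x. f x + g x)) \<longlonglongrightarrow> density_int s m f + density_int s m g"
    using tendsto_add[OF density_int_limit[OF f] density_int_limit[OF g]]
      simple_int_add[OF simple integrable_bounded_measurable[OF f] integrable_bounded_measurable[OF g]]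
    by simp
  then show ?thesis
    using LIMSEQ_unique density_int_limit[OF bounded_measurable_add[OF f g]] by blast
qed

lemma density_int_cmult:
  assumes f: "f \<in> bounded_measurable M"
  shows "density_int s m (\<lambda>x. c * f x) = c *\<^sub>R density_int s m f"
proof -
  have "(\<lambda>n. simple_int m (s n) (\<lambda>x. c * f x)) \<longlonglongrightarrow> c *\<^sub>R density_int s m f"
    using tendsto_scaleR[OF tendsto_const density_int_limit[OF f], of c]
    by (simp add: simple_int_cmult)
  then show ?thesis
    using LIMSEQ_unique density_int_limit[OF bounded_measurable_cmult[OF f]] by blast
qed

lemma norm_density_int_indicator:
  assumes E: "E \<in> sets M"
  shows "norm (density_int s m (indicator E)) \<le> measure m E"
  using norm_density_int[OF bounded_measurable_indicator[OF E]] E sets_m by simp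

text \<open>Linearity gives finite additivity, and domination by \<open>m\<close> upgrades it to
  countable additivity.\<close>

lemma vector_measure_density_int: "vector_measure M (\<lambda>E. density_int s m (indicator E))"
proof (rule dominated_vector_measure[OF finite_m sets_m norm_density_int_indicator])
  fix A B assume A: "A \<in> sets M" and B: "B \<in> sets M" and "A \<inter> B = {}"
  then have "indicator (A \<union> B) = (\<lambda>x. indicator A x + indicator B x :: real)"
    by (intro ext) (auto simp: indicator_def)
  then show "density_int s m (indicator (A \<union> B)) = density_int s m (indicator A) + density_int s m (indicator B)"
    using density_int_add[OF bounded_measurable_indicator[OF A] bounded_measurable_indicator[OF B]] by simp
qed

lemma variation_density_int_le:
  assumes "E \<in> sets M"
  shows "variation M (\<lambda>E. density_int s m (indicator E)) E \<le> emeasure m E"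
proof (rule dominated_variation_le[OF sets_m _ assms])
  fix E assume "E \<in> sets M"
  then show "ennreal (norm (density_int s m (indicator E))) \<le> emeasure m E"
    using norm_density_int_indicator by (simp add: emeasure_eq_measure)
qed

lemma bounded_variation_density_int: "bounded_variation M (\<lambda>E. density_int s m (indicator E))"
  unfolding bounded_variation_def
  using variation_density_int_le[OF sets.top] by (rule le_less_trans) (simp add: emeasure_eq_measure)

text \<open>The functional is linear, bounded by the mass of \<open>m\<close>, and correct on
  indicators, so uniqueness of the operator applies. As \<open>\<Omega>\<close> is constrained on
  \<open>sets M\<close> only, this covers the given measure as well as the constructed ones.\<close>

lemma vector_integral_density_int:
  assumes \<Omega>: "\<And>E. E \<in> sets M \<Longrightarrow> \<Omega> E = density_int s m (indicator E)" and f: "f \<in> bounded_measurable M"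
  shows "vector_integral M \<Omega> f = density_int s m f"
proof -
  let ?T = "\<lambda>f. if f \<in> bounded_measurable M then density_int s m f else 0"
  have "is_integral_operator M \<Omega> ?T"
    unfolding is_integral_operator_def
  proof (intro conjI ballI allI impI exI)
    fix f assume f: "f \<in> bounded_measurable M"
    show "norm (?T f) \<le> measure m (space M) * sup_norm M f"
    proof -
      have "norm (density_int s m f) \<le> (\<integral>x. \<bar>f x\<bar> \<partial>m)" by (rule norm_density_int[OF f])
      also have "\<dots> \<le> (\<integral>x. sup_norm M f \<partial>m)"
        using sup_norm_upper[OF f] integrable_bounded_measurable[OF f]
        by (intro integral_mono) (auto simp: space_m)
      finally show ?thesis using f by (simp add: space_m)
    qed
  qed (auto simp: \<Omega> density_int_add density_int_cmult bounded_measurable_add bounded_measurable_cmult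
      bounded_measurable_indicator)
  then show ?thesis using f by (simp add: vector_integral_eqI)
qed

end

section \<open>Vector measures with densities on the fibres\<close>

text \<open>Reduces a vector-valued integral to scalar ones, which can then be compared with the
  integrals of the fibre coefficients.\<close>

lemma simple_bochner_integral_sum_scaleR:
  fixes a :: "'v \<Rightarrow> 'y \<Rightarrow> real" and w :: "'v \<Rightarrow> 'b::real_normed_vector"
  assumes \<nu>: "finite_measure \<nu>" and V: "finite V" and a: "\<And>v. v \<in> V \<Longrightarrow> simple_function \<nu> (a v)"
  shows "simple_function \<nu> (\<lambda>y. \<Sum>v\<in>V. a v y *\<^sub>R w v)"
    and "Bochner_Integration.simple_bochner_integral \<nu> (\<lambda>y. \<Sum>v\<in>V. a v y *\<^sub>R w v) =
      (\<Sum>v\<in>V. (\<integral>y. a v y \<partial>\<nu>) *\<^sub>R w v)"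
proof -
  have av: "simple_function \<nu> (\<lambda>y. a v y *\<^sub>R w v)" if "v \<in> V" for v
    using a[OF that] by (rule simple_function_compose1)
  then show "simple_function \<nu> (\<lambda>y. \<Sum>v\<in>V. a v y *\<^sub>R w v)"
    by (rule simple_function_sum)
  show "Bochner_Integration.simple_bochner_integral \<nu> (\<lambda>y. \<Sum>v\<in>V. a v y *\<^sub>R w v) =
      (\<Sum>v\<in>V. (\<integral>y. a v y \<partial>\<nu>) *\<^sub>R w v)"
    using V a
  proof (induction V rule: finite_induct)
    case empty
    have "(\<lambda>y. 0 :: 'b) ` space \<nu> \<subseteq> {0}" by auto
    then show ?case
      unfolding Bochner_Integration.simple_bochner_integral_def by (auto intro!: sum.neutral)
  next
    case (insert v V)
    have si: "Bochner_Integration.simple_bochner_integrable \<nu> (a v)"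
      using insert.prems by (intro simple_bochner_integrable_finite_measure \<nu>) simp
    have 1: "Bochner_Integration.simple_bochner_integrable \<nu> (\<lambda>y. a v y *\<^sub>R w v)"
      using simple_function_compose1[OF insert.prems[of v], of "\<lambda>r. r *\<^sub>R w v"]
      by (intro simple_bochner_integrable_finite_measure \<nu>) simp
    have 2: "Bochner_Integration.simple_bochner_integrable \<nu> (\<lambda>y. \<Sum>v\<in>V. a v y *\<^sub>R w v)"
      using insert.prems
      by (intro simple_bochner_integrable_finite_measure \<nu> simple_function_sum)
        (auto intro!: simple_function_compose1[of \<nu> "a _" "\<lambda>r. r *\<^sub>R w _"])
    have "Bochner_Integration.simple_bochner_integral \<nu> (\<lambda>y. a v y *\<^sub>R w v) =
        Bochner_Integration.simple_bochner_integral \<nu> (a v) *\<^sub>R w v"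
      by (rule simple_bochner_integral_linear[OF _ si])
         (simp add: bounded_linear.linear bounded_linear_scaleR_left)
    then show ?case
      using simple_bochner_integral_add[OF 1 2] insert
      by (simp add: simple_bochner_integrable_eq_integral[OF si])
  qed
qed

lemma norm_Bochner_integral_le:
  fixes f :: "'y \<Rightarrow> 'b::banach"
  assumes "has_Bochner_integral_strong \<nu> f v"
  shows "ennreal (norm v) \<le> (\<integral>\<^sup>+y. norm (f y) \<partial>\<nu>)"
proof -
  have 0: "Bochner_Integration.simple_bochner_integrable \<nu> (\<lambda>_. 0)"
    by (auto intro: Bochner_Integration.simple_bochner_integrable.intros)
  have "Bochner_Integration.simple_bochner_integral \<nu> (\<lambda>_. 0 :: 'b) = 0"
    unfolding Bochner_Integration.simple_bochner_integral_def by (auto intro!: sum.neutral)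
  then show ?thesis
    using norm_Bochner_integral_diff_simple[OF assms 0] by (simp add: nn_integral_completion)
qed

text \<open>Total mass at most 1, rather than equal to 1, admits the null measure on exceptional
  fibres. The conditions on \<open>\<kappa> y\<close> hold for every \<open>y\<close>, so the limits
  on the fibres exist without exception.\<close>

locale density_kernel =
  fixes M :: "'x measure" and s :: "nat \<Rightarrow> 'x \<Rightarrow> 'b::banach"
    and \<mu> :: "'x measure" and \<nu> :: "'y measure" and \<kappa> :: "'y \<Rightarrow> 'x measure"
  assumes \<mu>: "simple_density M s \<mu>" and \<kappa>: "\<And>y. simple_density M s (\<kappa> y)"
    and finite_\<nu>: "finite_measure \<nu>"
    and \<kappa>_le_1: "\<And>y. emeasure (\<kappa> y) (space M) \<le> 1"
    and kernel_measurable: "\<And>f. f \<in> bounded_measurable M \<Longrightarrow> (\<lambda>y. \<integral>x. f x \<partial>\<kappa> y) \<in> borel_measurable \<nu>"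
    and kernel_integral: "\<And>f. f \<in> bounded_measurable M \<Longrightarrow> (\<integral>x. f x \<partial>\<mu>) = (\<integral>y. \<integral>x. f x \<partial>\<kappa> y \<partial>\<nu>)"
begin

sublocale \<nu>: finite_measure \<nu> by (rule finite_\<nu>)
sublocale \<mu>: simple_density M s \<mu> by (rule \<mu>)
sublocale \<kappa>: simple_density M s "\<kappa> y" for y by (rule \<kappa>)

context
  fixes f :: "'x \<Rightarrow> real" and K :: real
  assumes f: "f \<in> bounded_measurable M" and K: "\<And>x. x \<in> space M \<Longrightarrow> \<bar>f x\<bar> \<le> K" "0 \<le> K"
begin

definition fibre_coeff :: "nat \<Rightarrow> 'b \<Rightarrow> 'y \<Rightarrow> real" where
  "fibre_coeff n v y = (\<integral>x. indicator (s n -` {v}) x * f x \<partial>\<kappa> y)"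

text \<open>Chosen so that rounding all coefficients of \<open>s n\<close> moves the vector sum by
  at most \<open>1 / Suc n\<close>: each coefficient errs by at most
  \<open>1 / Suc (mesh n)\<close>, weighted by the norm of its vector.\<close>

definition mesh :: "nat \<Rightarrow> nat" where
  "mesh n = nat \<lceil>real (Suc n) * (\<Sum>v\<in>s n ` space M. norm v)\<rceil>"

text \<open>As a function of \<open>y\<close>, \<open>simple_int (\<kappa> y) (s n) f\<close>
  involves finitely many vectors, but its coefficients may take infinitely many values. Rounding
  them yields the simple maps of \<open>y\<close> that strong measurability and the Bochner integral
  ask for.\<close>

definition rounded :: "nat \<Rightarrow> 'y \<Rightarrow> 'b" where
  "rounded n y = (\<Sum>v\<in>s n ` space M. grid_round (mesh n) (fibre_coeff n v y) *\<^sub>R v)"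

lemma finite_range_s: "finite (s n ` space M)"
  using \<mu>.simple_M by (rule simple_functionD)

lemma mesh: "(\<Sum>v\<in>s n ` space M. 1 / real (Suc (mesh n)) * norm v) \<le> 1 / real (Suc n)"
proof -
  have "real (Suc n) * (\<Sum>v\<in>s n ` space M. norm v) \<le> real (Suc (mesh n))"
    unfolding mesh_def by linarith
  then have "(\<Sum>v\<in>s n ` space M. norm v) / real (Suc (mesh n)) \<le> 1 / real (Suc n)"
    by (simp add: field_simps)
  then show ?thesis by (simp add: sum_divide_distrib)
qed

lemma fibre_bounded_measurable: "(\<lambda>x. indicator (s n -` {v}) x * f x) \<in> bounded_measurable M"
proof -
  have "s n -` {v} \<inter> space M \<in> sets M" using \<mu>.simple_M by (rule simple_functionD)
  moreover have "f \<in> borel_measurable M" using f by (simp add: bounded_measurable_def)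
  ultimately have "(\<lambda>x. indicator (s n -` {v} \<inter> space M) x * f x) \<in> borel_measurable M"
    by measurable
  then have "(\<lambda>x. indicator (s n -` {v}) x * f x) \<in> borel_measurable M"
    by (rule measurable_cong[THEN iffD1, rotated]) (auto simp: indicator_def)
  then show ?thesis
    using K unfolding bounded_measurable_def by (auto simp: indicator_def intro!: exI[of _ K])
qed

lemma integral_abs_f_le: "(\<integral>x. \<bar>f x\<bar> \<partial>\<kappa> y) \<le> K"
proof -
  have "measure (\<kappa> y) (space M) \<le> 1"
    using \<kappa>_le_1[of y] by (simp add: \<kappa>.emeasure_eq_measure)
  then have "K * measure (\<kappa> y) (space M) \<le> K" using K(2) by (simp add: mult_left_le)
  moreover have "(\<integral>x. \<bar>f x\<bar> \<partial>\<kappa> y) \<le> (\<integral>x. K \<partial>\<kappa> y)"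
    using K(1) \<kappa>.integrable_bounded_measurable[OF f] by (intro integral_mono) (auto simp: \<kappa>.space_m)
  ultimately show ?thesis by (simp add: \<kappa>.space_m mult.commute)
qed

lemma fibre_coeff_bound: "\<bar>fibre_coeff n v y\<bar> \<le> K"
proof -
  note i = \<kappa>.integrable_bounded_measurable[OF fibre_bounded_measurable]
  have "\<bar>fibre_coeff n v y\<bar> \<le> (\<integral>x. \<bar>indicator (s n -` {v}) x * f x\<bar> \<partial>\<kappa> y)"
    unfolding fibre_coeff_def by (rule integral_abs_bound)
  also have "\<dots> \<le> (\<integral>x. \<bar>f x\<bar> \<partial>\<kappa> y)"
    using \<kappa>.integrable_bounded_measurable[OF f]
    by (intro integral_mono integrable_abs i) (auto simp: indicator_def)
  also have "\<dots> \<le> K" by (rule integral_abs_f_le)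
  finally show ?thesis .
qed

lemma simple_function_rounded_coeff: "simple_function \<nu> (\<lambda>y. grid_round (mesh n) (fibre_coeff n v y))"
proof (rule simple_function_grid_round)
  show "fibre_coeff n v \<in> bounded_measurable \<nu>"
    using fibre_coeff_bound kernel_measurable[OF fibre_bounded_measurable]
    unfolding bounded_measurable_def fibre_coeff_def by auto
qed

lemma simple_function_rounded: "simple_function \<nu> (rounded n)"
  unfolding rounded_def
  using simple_bochner_integral_sum_scaleR(1)[OF finite_\<nu> finite_range_s simple_function_rounded_coeff] .

lemma norm_rounded_error: "norm (simple_int (\<kappa> y) (s n) f - rounded n y) \<le> 1 / real (Suc n)"
proof -
  have "simple_int (\<kappa> y) (s n) f - rounded n y =
    (\<Sum>v\<in>s n ` space M. (fibre_coeff n v y - grid_round (mesh n) (fibre_coeff n v y)) *\<^sub>R v)"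
    unfolding simple_int_def rounded_def fibre_coeff_def
    by (simp add: \<kappa>.space_m scaleR_diff_left sum_subtractf)
  also have "norm \<dots> \<le> (\<Sum>v\<in>s n ` space M. 1 / real (Suc (mesh n)) * norm v)"
    by (intro sum_norm_le) (simp only: norm_scaleR mult_right_mono[OF grid_round_error norm_ge_zero])
  finally show ?thesis using mesh[of n] by linarith
qed

lemma rounded_limit: "(\<lambda>n. rounded n y) \<longlonglongrightarrow> density_int s (\<kappa> y) f"
proof -
  have "(\<lambda>n. simple_int (\<kappa> y) (s n) f - rounded n y) \<longlonglongrightarrow> 0"
  proof (rule Lim_null_comparison[OF always_eventually])
    show "\<forall>n. norm (simple_int (\<kappa> y) (s n) f - rounded n y) \<le> 1 / real (Suc n)"
      using norm_rounded_error by blast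
    show "(\<lambda>n. 1 / real (Suc n)) \<longlonglongrightarrow> 0"
      using LIMSEQ_inverse_real_of_nat by (simp add: inverse_eq_divide)
  qed
  from tendsto_diff[OF \<kappa>.density_int_limit[OF f, of y] this] show ?thesis by simp
qed

lemma simple_bochner_integrable_rounded: "Bochner_Integration.simple_bochner_integrable \<nu> (rounded n)"
  by (intro simple_bochner_integrable_finite_measure finite_\<nu> simple_function_rounded)

lemma borel_measurable_fibre_int: "(\<lambda>y. density_int s (\<kappa> y) f) \<in> borel_measurable \<nu>"
  by (rule borel_measurable_LIMSEQ_metric[OF borel_measurable_simple_function[OF simple_function_rounded]])
     (rule rounded_limit)

lemma strongly_measurable_fibre_int: "strongly_measurable \<nu> (\<lambda>y. density_int s (\<kappa> y) f)"
  unfolding strongly_measurable_def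
  using borel_measurable_fibre_int simple_bochner_integrable_rounded rounded_limit
  by (intro conjI measurable_completion exI[of _ rounded]) auto

lemma L1_rounded:
  "(\<lambda>n. \<integral>\<^sup>+y. ennreal (norm (density_int s (\<kappa> y) f - rounded n y)) \<partial>completion \<nu>) \<longlonglongrightarrow> 0"
  unfolding nn_integral_completion
proof -
  have "(\<lambda>n. \<integral>\<^sup>+y. ennreal (norm (density_int s (\<kappa> y) f - rounded n y)) \<partial>\<nu>) \<longlonglongrightarrow> (\<integral>\<^sup>+y. 0 \<partial>\<nu>)"
  \<comment> \<open>The constant collects \<open>K\<close> for the limit, \<open>K\<close> for
    \<open>simple_int\<close>, and 1 for the rounding error.\<close>
  proof (rule nn_integral_dominated_convergence[where w="\<lambda>_. ennreal (2 * K + 1)"])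
    show "(\<lambda>y. ennreal (norm (density_int s (\<kappa> y) f - rounded n y))) \<in> borel_measurable \<nu>" for n
      by (rule borel_measurable_norm_diff_simple[OF borel_measurable_fibre_int simple_function_rounded])
    show "(\<integral>\<^sup>+y. ennreal (2 * K + 1) \<partial>\<nu>) < \<infinity>"
      by (simp add: \<nu>.emeasure_eq_measure ennreal_mult_less_top)
    have "norm (density_int s (\<kappa> y) f - rounded n y) \<le> 2 * K + 1" for n y
    proof -
      have "density_int s (\<kappa> y) f - rounded n y =
        density_int s (\<kappa> y) f - simple_int (\<kappa> y) (s n) f + (simple_int (\<kappa> y) (s n) f - rounded n y)"
        by simp
      also have "norm \<dots> \<le> norm (density_int s (\<kappa> y) f) + norm (simple_int (\<kappa> y) (s n) f) +
          norm (simple_int (\<kappa> y) (s n) f - rounded n y)"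
        by (intro norm_triangle_mono norm_triangle_ineq4) simp
      also have "\<dots> \<le> K + K + 1"
      proof (intro add_mono)
        show "norm (density_int s (\<kappa> y) f) \<le> K"
          using \<kappa>.norm_density_int[OF f, of y] integral_abs_f_le[of y] by linarith
        show "norm (simple_int (\<kappa> y) (s n) f) \<le> K"
          using \<kappa>.norm_simple_int_bound[OF f, of y n] integral_abs_f_le[of y] by linarith
        have "1 / real (Suc n) \<le> 1" by simp
        then show "norm (simple_int (\<kappa> y) (s n) f - rounded n y) \<le> 1"
          using norm_rounded_error[of y n] by linarith
      qed
      finally show ?thesis by simp
    qed
    then show "AE y in \<nu>. ennreal (norm (density_int s (\<kappa> y) f - rounded n y)) \<le> ennreal (2 * K + 1)" for n
      by (intro AE_I2 ennreal_leI)
    have "(\<lambda>n. ennreal (norm (density_int s (\<kappa> y) f - rounded n y))) \<longlonglongrightarrow> 0" for y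
    proof -
      have "(\<lambda>n. density_int s (\<kappa> y) f - rounded n y) \<longlonglongrightarrow> 0"
        using tendsto_diff[OF tendsto_const rounded_limit[of y], of "density_int s (\<kappa> y) f"] by simp
      from tendsto_ennrealI[OF tendsto_norm[OF this]] show ?thesis by simp
    qed
    then show "AE y in \<nu>. (\<lambda>n. ennreal (norm (density_int s (\<kappa> y) f - rounded n y))) \<longlonglongrightarrow> 0"
      by (intro AE_I2)
  qed auto
  then show "(\<lambda>n. \<integral>\<^sup>+y. ennreal (norm (density_int s (\<kappa> y) f - rounded n y)) \<partial>\<nu>) \<longlonglongrightarrow> 0" by simp
qed

text \<open>The kernel identity, applied to each fibre coefficient, writes
  \<open>simple_int \<mu> (s n) f\<close> through integrals of unrounded coefficients over
  \<open>\<nu>\<close>. What remains is the rounding error, at most the mass of \<open>\<nu>\<close>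
  divided by \<open>Suc n\<close>.\<close>

lemma integral_rounded_limit:
  "(\<lambda>n. Bochner_Integration.simple_bochner_integral \<nu> (rounded n)) \<longlonglongrightarrow> density_int s \<mu> f"
proof -
  let ?I = "\<lambda>n. Bochner_Integration.simple_bochner_integral \<nu> (rounded n)"
  let ?c = "measure \<nu> (space \<nu>)"
  have err: "norm (simple_int \<mu> (s n) f - ?I n) \<le> ?c * (1 / real (Suc n))" for n
  proof -
    let ?g = "\<lambda>v y. grid_round (mesh n) (fibre_coeff n v y)"
    have ia: "integrable \<nu> (fibre_coeff n v)" for v
      using kernel_measurable[OF fibre_bounded_measurable] fibre_coeff_bound
      unfolding fibre_coeff_def by (intro \<nu>.integrable_const_bound[where B=K]) auto
    have ig: "integrable \<nu> (?g v)" for v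
      using simple_bochner_integrable_finite_measure[OF finite_\<nu> simple_function_rounded_coeff]
      by (rule integrableI_simple_bochner_integrable)
    have "simple_int \<mu> (s n) f - ?I n =
      (\<Sum>v\<in>s n ` space M. (\<integral>y. fibre_coeff n v y \<partial>\<nu>) *\<^sub>R v) - (\<Sum>v\<in>s n ` space M. (\<integral>y. ?g v y \<partial>\<nu>) *\<^sub>R v)"
      unfolding rounded_def
        simple_bochner_integral_sum_scaleR(2)[OF finite_\<nu> finite_range_s simple_function_rounded_coeff]
      by (simp add: simple_int_def \<mu>.space_m fibre_coeff_def kernel_integral[OF fibre_bounded_measurable])
    also have "\<dots> = (\<Sum>v\<in>s n ` space M. (\<integral>y. fibre_coeff n v y - ?g v y \<partial>\<nu>) *\<^sub>R v)"
      using ia ig by (simp add: scaleR_diff_left sum_subtractf)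
    also have "norm \<dots> \<le> (\<Sum>v\<in>s n ` space M. ?c * (1 / real (Suc (mesh n)) * norm v))"
    proof (rule sum_norm_le)
      fix v
      have "\<bar>\<integral>y. fibre_coeff n v y - ?g v y \<partial>\<nu>\<bar> \<le> (\<integral>y. \<bar>fibre_coeff n v y - ?g v y\<bar> \<partial>\<nu>)"
        by (rule integral_abs_bound)
      also have "\<dots> \<le> (\<integral>y. 1 / real (Suc (mesh n)) \<partial>\<nu>)"
        using ia ig grid_round_error by (intro integral_mono) auto
      finally have "\<bar>\<integral>y. fibre_coeff n v y - ?g v y \<partial>\<nu>\<bar> \<le> ?c * (1 / real (Suc (mesh n)))"
        by simp
      from mult_right_mono[OF this norm_ge_zero[of v]]
      show "norm ((\<integral>y. fibre_coeff n v y - ?g v y \<partial>\<nu>) *\<^sub>R v) \<le> ?c * (1 / real (Suc (mesh n)) * norm v)"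
        by (simp add: mult.assoc)
    qed
    also have "\<dots> = ?c * (\<Sum>v\<in>s n ` space M. 1 / real (Suc (mesh n)) * norm v)"
      by (simp only: sum_distrib_left)
    also have "\<dots> \<le> ?c * (1 / real (Suc n))"
      by (rule mult_left_mono[OF mesh measure_nonneg])
    finally show ?thesis .
  qed
  have "(\<lambda>n. simple_int \<mu> (s n) f - ?I n) \<longlonglongrightarrow> 0"
  proof (rule Lim_null_comparison[OF always_eventually])
    show "\<forall>n. norm (simple_int \<mu> (s n) f - ?I n) \<le> ?c * (1 / real (Suc n))" using err by blast
    have "(\<lambda>n. 1 / real (Suc n)) \<longlonglongrightarrow> 0"
      using LIMSEQ_inverse_real_of_nat by (simp add: inverse_eq_divide)
    from tendsto_mult_right_zero[OF this]
    show "(\<lambda>n. ?c * (1 / real (Suc n))) \<longlonglongrightarrow> 0" .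
  qed
  from tendsto_diff[OF \<mu>.density_int_limit[OF f] this] show ?thesis by simp
qed

lemma has_Bochner_integral_fibre_int_bounded:
  "has_Bochner_integral_strong \<nu> (\<lambda>y. density_int s (\<kappa> y) f) (density_int s \<mu> f)"
  unfolding has_Bochner_integral_strong_def
  using strongly_measurable_fibre_int simple_bochner_integrable_rounded L1_rounded integral_rounded_limit
  by blast

end

lemma has_Bochner_integral_fibre_int:
  assumes f: "f \<in> bounded_measurable M"
  shows "has_Bochner_integral_strong \<nu> (\<lambda>y. density_int s (\<kappa> y) f) (density_int s \<mu> f)"
  using has_Bochner_integral_fibre_int_bounded[OF f, of "sup_norm M f"]
    sup_norm_upper[OF f] sup_norm_nonneg[OF f] by blast

lemma borel_measurable_density_int:
  assumes f: "f \<in> bounded_measurable M"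
  shows "(\<lambda>y. density_int s (\<kappa> y) f) \<in> borel_measurable \<nu>"
  using borel_measurable_fibre_int[OF f, of "sup_norm M f"]
    sup_norm_upper[OF f] sup_norm_nonneg[OF f] by blast

end

section \<open>Lower bound for the variation of the fibre measures\<close>

context density_kernel
begin

text \<open>
  Since \<open>\<parallel>\<Omega> A\<parallel> \<le> \<integral> \<parallel>\<Omega>\<^sub>y A\<parallel> d\<nu>\<close>, countably many partitions that exhaust the variation of \<open>\<Omega>\<close> force
  the fibre measures to have variation at least 1 almost everywhere. This avoids the measurability
  of \<open>y \<mapsto> \<parallel>\<Omega>\<^sub>y\<parallel>\<close>.
\<close>

lemma AE_variation_ge_1:
  assumes \<Omega>: "\<And>E. E \<in> sets M \<Longrightarrow> \<Omega> E = density_int s \<mu> (indicator E)"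
    and mass: "variation M \<Omega> (space M) = emeasure \<nu> (space \<nu>)"
  shows "AE y in \<nu>. 1 \<le> variation M (\<lambda>E. density_int s (\<kappa> y) (indicator E)) (space M)"
proof -
  define D where "D y E = density_int s (\<kappa> y) (indicator E)" for y E
  let ?\<P> = "{P. finite P \<and> P \<subseteq> sets M \<and> partition_on (space M) P}"
  let ?S = "\<lambda>P. \<Sum>A\<in>P. ennreal (norm (\<Omega> A))"
  have "?\<P> \<noteq> {}"
  proof (cases "space M = {}")
    case True
    then have "{} \<in> ?\<P>" by (simp add: partition_on_empty)
    then show ?thesis by blast
  next
    case False
    then have "{space M} \<in> ?\<P>" by (simp add: partition_on_space)
    then show ?thesis by blast
  qed
  \<comment> \<open>The supremum is already reached along a sequence of partitions, so the supremum
    \<open>W\<close> of the corresponding fibre sums is measurable while staying below the fibre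
    variation.\<close>
  from ennreal_SUP_countable_SUP[OF this, of ?S]
  obtain S :: "nat \<Rightarrow> ennreal" where S: "range S \<subseteq> ?S ` ?\<P> \<and> Sup (?S ` ?\<P>) = Sup (range S)"
    by (rule exE)
  have sup: "variation M \<Omega> (space M) = (SUP k. S k)"
    unfolding variation_def using S by (rule conjunct2)
  have "\<exists>P. P \<in> ?\<P> \<and> S k = ?S P" for k
  proof -
    have "S k \<in> ?S ` ?\<P>" using conjunct1[OF S] by (rule subsetD) (rule rangeI)
    then show ?thesis by (rule imageE) (rule exI, rule conjI)
  qed
  then obtain P where P: "\<And>k. P k \<in> ?\<P>" and SP: "\<And>k. S k = ?S (P k)" by metis
  define V where "V k y = (\<Sum>A\<in>P k. ennreal (norm (D y A)))" for k y
  have D_meas: "(\<lambda>y. ennreal (norm (D y A))) \<in> borel_measurable \<nu>" if "A \<in> sets M" for A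
    using borel_measurable_norm_diff_simple[OF borel_measurable_density_int[OF bounded_measurable_indicator[OF that]],
        of "\<lambda>_. 0"]
    by (simp add: D_def)
  have V_meas [measurable]: "V k \<in> borel_measurable \<nu>" for k
    unfolding V_def using P[of k] D_meas by (intro borel_measurable_sum) auto
  have V_le: "V k y \<le> variation M (D y) (space M)" for k y
    unfolding V_def using P[of k] by (intro variation_upper) auto
  have var_le: "variation M (D y) (space M) \<le> 1" for y
    unfolding D_def using \<kappa>.variation_density_int_le[of "space M" y] \<kappa>_le_1[of y] by simp
  define W where "W y = (SUP k. V k y)" for y
  have W_meas [measurable]: "W \<in> borel_measurable \<nu>" unfolding W_def by measurable
  have W1: "W y \<le> 1" for y
    unfolding W_def using V_le var_le by (intro SUP_least) (meson order_trans)
  have "emeasure \<nu> (space \<nu>) \<le> (\<integral>\<^sup>+y. W y \<partial>\<nu>)"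
    unfolding mass[symmetric] sup
  proof (rule SUP_least)
    fix k :: nat
    have "S k \<le> (\<Sum>A\<in>P k. \<integral>\<^sup>+y. ennreal (norm (D y A)) \<partial>\<nu>)"
      unfolding SP
    proof (rule sum_mono)
      fix A assume "A \<in> P k"
      then have A: "A \<in> sets M" using P[of k] by auto
      show "ennreal (norm (\<Omega> A)) \<le> (\<integral>\<^sup>+y. ennreal (norm (D y A)) \<partial>\<nu>)"
        unfolding \<Omega>[OF A] D_def
        by (rule norm_Bochner_integral_le[OF has_Bochner_integral_fibre_int[OF bounded_measurable_indicator[OF A]]])
    qed
    also have "\<dots> = (\<integral>\<^sup>+y. V k y \<partial>\<nu>)"
      unfolding V_def using P[of k] D_meas by (intro nn_integral_sum[symmetric]) auto
    also have "\<dots> \<le> (\<integral>\<^sup>+y. W y \<partial>\<nu>)"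
      unfolding W_def by (intro nn_integral_mono SUP_upper) auto
    finally show "S k \<le> (\<integral>\<^sup>+y. W y \<partial>\<nu>)" .
  qed
  \<comment> \<open>\<open>W \<le> 1\<close> has an integral no smaller than that of 1; since the
    mass is finite, \<open>W = 1\<close> almost everywhere.\<close>
  then have ge: "(\<integral>\<^sup>+y. 1 \<partial>\<nu>) \<le> (\<integral>\<^sup>+y. W y \<partial>\<nu>)" by simp
  have finW: "(\<integral>\<^sup>+y. W y \<partial>\<nu>) \<noteq> \<infinity>"
  proof -
    have "(\<integral>\<^sup>+y. W y \<partial>\<nu>) \<le> (\<integral>\<^sup>+y. 1 \<partial>\<nu>)" using W1 by (intro nn_integral_mono)
    also have "\<dots> < \<infinity>" by (simp add: \<nu>.emeasure_eq_measure)
    finally show ?thesis by simp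
  qed
  have "(\<integral>\<^sup>+y. 1 - W y \<partial>\<nu>) = (\<integral>\<^sup>+y. 1 \<partial>\<nu>) - (\<integral>\<^sup>+y. W y \<partial>\<nu>)"
    using W1 finW by (intro nn_integral_diff AE_I2) auto
  also have "\<dots> = 0"
    using ge by (intro diff_eq_0_ennreal) (simp_all add: \<nu>.emeasure_eq_measure)
  finally have "AE y in \<nu>. 1 - W y = 0"
    by (subst (asm) nn_integral_0_iff_AE) auto
  then show ?thesis
  proof eventually_elim
    case (elim y)
    then have "1 \<le> W y" by (simp add: diff_eq_0_iff_ennreal)
    also have "\<dots> \<le> variation M (D y) (space M)"
      unfolding W_def using V_le by (intro SUP_least)
    finally show ?case unfolding D_def .
  qed
qed

end

section \<open>Construction of the disintegration\<close>

theorem theorem5p9: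
  fixes \<phi> :: "'x::polish_space \<Rightarrow> 'y::polish_space"
    and \<Omega> :: "'x set \<Rightarrow> 'b::banach"
  assumes "\<phi> \<in> borel_measurable borel"
    and "radon_nikodym_property TYPE('b)"
    and "vector_measure borel \<Omega>"
    and "bounded_variation borel \<Omega>"
  shows "\<exists>\<Omega>\<^sub>y :: 'y \<Rightarrow> 'x set \<Rightarrow> 'b. is_disintegration borel borel \<phi> \<Omega> \<Omega>\<^sub>y"
proof -
  note \<phi> = assms(1) and \<Omega> = assms(3) and bv = assms(4)
  define \<mu> where "\<mu> = variation_measure borel \<Omega>"
  have sets_\<mu> [measurable_cong]: "sets \<mu> = sets borel" by (simp add: \<mu>_def sets_variation_measure)
  have space_\<mu>: "space \<mu> = UNIV" using sets_eq_imp_space_eq[OF sets_\<mu>] by simp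
  have fin_\<mu>: "finite_measure \<mu>" unfolding \<mu>_def by (rule finite_measure_variation_measure[OF \<Omega> bv])
  have dom: "norm (\<Omega> E) \<le> measure \<mu> E" if "E \<in> sets \<mu>" for E
    using norm_le_measure_variation[OF \<Omega> bv, of E] that by (simp add: \<mu>_def sets_variation_measure)
  have \<Omega>\<mu>: "vector_measure \<mu> \<Omega>" using \<Omega> by (simp add: vector_measure_def sets_\<mu>)
  obtain s :: "nat \<Rightarrow> 'x \<Rightarrow> 'b" where s: "\<And>n. simple_function \<mu> (s n)" and s1: "\<And>n x. norm (s n x) \<le> 1"
    and close: "\<And>n. (\<integral>\<^sup>+x. norm (s n x - s (Suc n) x) \<partial>\<mu>) \<le> ennreal ((1 / 2) ^ n)"
    and lim: "\<And>E. E \<in> sets \<mu> \<Longrightarrow> (\<lambda>n. simple_int \<mu> (s n) (indicator E)) \<longlonglongrightarrow> \<Omega> E"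
    using radon_nikodym_simple_sequence_polish[OF assms(2) fin_\<mu> sets_\<mu> \<Omega>\<mu> dom] by blast
  have sb: "simple_function borel (s n)" for n
    using s[of n] by (simp add: simple_function_def sets_\<mu> space_\<mu>)
  have \<phi>\<mu> [measurable]: "\<phi> \<in> borel_measurable \<mu>" using \<phi> by measurable
  define \<nu> where "\<nu> = distr \<mu> borel \<phi>"
  have sets_\<nu> [measurable_cong, simp]: "sets \<nu> = sets borel" by (simp add: \<nu>_def)
  have fin_\<nu>: "finite_measure \<nu>"
    unfolding \<nu>_def by (rule finite_measure.finite_measure_distr[OF fin_\<mu>]) measurable
  obtain \<kappa>0 :: "'y \<Rightarrow> 'x measure" where
    sets_\<kappa>0: "\<And>y. sets (\<kappa>0 y) = sets borel" and prob_\<kappa>0: "\<And>y. emeasure (\<kappa>0 y) UNIV = 1"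
    and nn_meas: "\<And>F :: 'x \<Rightarrow> ennreal. F \<in> borel_measurable borel \<Longrightarrow>
      (\<lambda>y. \<integral>\<^sup>+x. F x \<partial>\<kappa>0 y) \<in> borel_measurable borel"
    and nn_int: "\<And>F :: 'x \<Rightarrow> ennreal. F \<in> borel_measurable borel \<Longrightarrow>
      (\<integral>\<^sup>+y. \<integral>\<^sup>+x. F x \<partial>\<kappa>0 y \<partial>\<nu>) = (\<integral>\<^sup>+x. F x \<partial>\<mu>)"
    and re_meas: "\<And>f. f \<in> bounded_measurable borel \<Longrightarrow> (\<lambda>y. \<integral>x. f x \<partial>\<kappa>0 y) \<in> borel_measurable borel"
    and re_int: "\<And>f. f \<in> bounded_measurable borel \<Longrightarrow> (\<integral>y. \<integral>x. f x \<partial>\<kappa>0 y \<partial>\<nu>) = (\<integral>x. f x \<partial>\<mu>)"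
    and fibre: "AE y in \<nu>. emeasure (\<kappa>0 y) (UNIV - \<phi> -` {y}) = 0"
    using disintegration_kernel[OF fin_\<mu> sets_\<mu> \<phi>] unfolding \<nu>_def by blast
  define gap where "gap n x = ennreal (norm (s n x - s (Suc n) x))" for n x
  have gap [measurable]: "gap n \<in> borel_measurable borel" for n
    unfolding gap_def
    by (rule borel_measurable_norm_diff_simple[OF borel_measurable_simple_function[OF sb] sb])
  define good where "good y \<longleftrightarrow> (\<Sum>n. \<integral>\<^sup>+x. gap n x \<partial>\<kappa>0 y) < \<infinity>" for y
  note nn_meas[OF gap, measurable]
  have good_meas [measurable]: "Measurable.pred borel good" unfolding good_def by measurable
  have sum_gap: "(\<Sum>n. \<integral>\<^sup>+x. gap n x \<partial>\<mu>) < \<infinity>"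
  proof -
    have "(\<Sum>n. \<integral>\<^sup>+x. gap n x \<partial>\<mu>) \<le> (\<Sum>n. ennreal ((1 / 2) ^ n))"
      using close unfolding gap_def by (intro suminf_le) auto
    also have "\<dots> = ennreal (\<Sum>n. (1 / 2) ^ n)"
      by (intro suminf_ennreal2 summable_geometric) auto
    finally show ?thesis by (auto intro: le_less_trans)
  qed
  \<comment> \<open>The kernel identity turns the fibrewise sums of increments into the finite sum
    over \<open>\<mu>\<close>, so almost every fibre is good.\<close>
  have "(\<integral>\<^sup>+y. (\<Sum>n. \<integral>\<^sup>+x. gap n x \<partial>\<kappa>0 y) \<partial>\<nu>) = (\<Sum>n. \<integral>\<^sup>+x. gap n x \<partial>\<mu>)"
    by (subst nn_integral_suminf) (auto simp: nn_int)
  then have good: "AE y in \<nu>. good y"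
    unfolding good_def less_top[symmetric] infinity_ennreal_def
    using sum_gap by (intro nn_integral_noteq_infinite[unfolded infinity_ennreal_def]) auto
  \<comment> \<open>With the null measure on bad fibres the increments are summable for every
    \<open>y\<close>, and the fibre measure is 0 there. Measurability of \<open>good\<close> keeps
    the modified kernel measurable.\<close>
  define \<kappa> where "\<kappa> y = (if good y then \<kappa>0 y else null_measure borel)" for y
  have sets_\<kappa>: "sets (\<kappa> y) = sets borel" for y by (simp add: \<kappa>_def sets_\<kappa>0)
  have \<kappa>1: "emeasure (\<kappa> y) UNIV \<le> 1" for y by (simp add: \<kappa>_def prob_\<kappa>0)
  have int_\<kappa>: "(\<integral>x. f x \<partial>\<kappa> y) = (if good y then \<integral>x. f x \<partial>\<kappa>0 y else 0)" for f :: "'x \<Rightarrow> real" and y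
    by (simp add: \<kappa>_def)
  interpret density_kernel borel s \<mu> \<nu> \<kappa>
  proof (intro density_kernel.intro simple_density.intro)
    show "simple_function borel (s n)" for n by (rule sb)
    show "norm (s n x) \<le> 1" for n x by (rule s1)
    show "finite_measure \<mu>" by (rule fin_\<mu>)
    show "sets \<mu> = sets borel" by (rule sets_\<mu>)
    show "(\<Sum>n. \<integral>\<^sup>+x. norm (s n x - s (Suc n) x) \<partial>\<mu>) < \<infinity>" 
      using sum_gap unfolding gap_def .
    show "sets (\<kappa> y) = sets borel" for y by (rule sets_\<kappa>)
    show "finite_measure (\<kappa> y)" for y
    proof
      show "emeasure (\<kappa> y) (space (\<kappa> y)) \<noteq> \<infinity>"
        using \<kappa>1[of y] sets_eq_imp_space_eq[OF sets_\<kappa>, of y] by (auto simp: top_unique)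
    qed
    show "(\<Sum>n. \<integral>\<^sup>+x. norm (s n x - s (Suc n) x) \<partial>\<kappa> y) < \<infinity>" for y
    proof (cases "good y")
      case True
      then show ?thesis unfolding good_def gap_def by (simp add: \<kappa>_def \<open>good y\<close>)
    qed (simp add: \<kappa>_def)
    show "finite_measure \<nu>" by (rule fin_\<nu>)
    show "emeasure (\<kappa> y) (space borel) \<le> 1" for y using \<kappa>1 by simp
    fix f :: "'x \<Rightarrow> real" assume f: "f \<in> bounded_measurable borel"
    note re_meas[OF f, measurable]
    show meas: "(\<lambda>y. \<integral>x. f x \<partial>\<kappa> y) \<in> borel_measurable \<nu>"
      unfolding int_\<kappa> by measurable
    show "(\<integral>x. f x \<partial>\<mu>) = (\<integral>y. \<integral>x. f x \<partial>\<kappa> y \<partial>\<nu>)"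
      unfolding re_int[OF f, symmetric]
    proof (rule integral_cong_AE)
      show "(\<lambda>y. \<integral>x. f x \<partial>\<kappa>0 y) \<in> borel_measurable \<nu>" by measurable
      show "AE y in \<nu>. (\<integral>x. f x \<partial>\<kappa>0 y) = (\<integral>x. f x \<partial>\<kappa> y)"
        using good by eventually_elim (simp add: int_\<kappa>)
    qed (rule meas)
  qed (use sb s1 in auto)
  \<comment> \<open>The given measure is thus the same limit as the fibre measures, only taken with
    respect to \<open>\<mu>\<close> in place of \<open>\<kappa> y\<close>.\<close>
  have \<Omega>_eq: "\<Omega> E = density_int s \<mu> (indicator E)" if "E \<in> sets borel" for E
    using LIMSEQ_unique[OF lim \<mu>.density_int_limit[OF bounded_measurable_indicator[OF that]]] that sets_\<mu>
    by simp
  define D where "D y E = density_int s (\<kappa> y) (indicator E)" for y E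
  \<comment> \<open>Pushing forward preserves total mass; this is the normalisation that the lower
    bound on the fibre variation requires.\<close>
  have mass: "variation borel \<Omega> (space borel) = emeasure \<nu> (space \<nu>)"
  proof -
    have "emeasure \<nu> (space \<nu>) = emeasure \<mu> (space \<mu>)"
      unfolding \<nu>_def by (subst emeasure_distr) auto
    also have "\<dots> = variation borel \<Omega> UNIV"
      using emeasure_variation_measure[OF \<Omega>, of UNIV] by (simp add: space_\<mu>) (simp add: \<mu>_def)
    finally show ?thesis by simp
  qed
  have integral_D: "vector_integral borel (D y) f = density_int s (\<kappa> y) f"
    if "f \<in> bounded_measurable borel" for y f
    using that by (intro \<kappa>.vector_integral_density_int) (simp_all add: D_def)
  have integral_\<Omega>: "vector_integral borel \<Omega> f = density_int s \<mu> f"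
    if "f \<in> bounded_measurable borel" for f
    using that by (intro \<mu>.vector_integral_density_int \<Omega>_eq)
  have bochner: "has_Bochner_integral_strong \<nu> (\<lambda>y. vector_integral borel (D y) f) (vector_integral borel \<Omega> f)"
    if "f \<in> bounded_measurable borel" for f
    using has_Bochner_integral_fibre_int[OF that] that by (simp add: integral_D integral_\<Omega>)
  have ge_1: "AE y in \<nu>. 1 \<le> variation borel (D y) (space borel)"
    unfolding D_def by (rule AE_variation_ge_1[OF _ mass]) (rule \<Omega>_eq)
  have AE: "AE y in \<nu>. variation borel (D y) (space borel) = 1 \<and> {y} \<in> sets borel \<and>
      variation borel (D y) (space borel - \<phi> -` {y}) = 0"
    using ge_1 good fibre
  proof eventually_elim
    case (elim y)
    \<comment> \<open>Domination by \<open>\<kappa> y\<close> gives the upper bound 1 and, for good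
      \<open>y\<close>, where \<open>\<kappa> y = \<kappa>0 y\<close>, also concentration on the
      fibre.\<close>
    have var_le: "variation borel (D y) E \<le> emeasure (\<kappa> y) E" if "E \<in> sets borel" for E
      unfolding D_def using \<kappa>.variation_density_int_le[OF that] .
    have "variation borel (D y) (space borel) = 1"
    proof (rule antisym)
      show "variation borel (D y) (space borel) \<le> 1"
        using order_trans[OF var_le[OF sets.top] \<kappa>_le_1] .
      show "1 \<le> variation borel (D y) (space borel)"
        by (rule elim(1))
    qed
    moreover have "variation borel (D y) (space borel - \<phi> -` {y}) = 0"
    proof -
      have "\<phi> -` {y} \<in> sets borel" using measurable_sets[OF \<phi>, of "{y}"] by simp
      then have "space borel - \<phi> -` {y} \<in> sets borel" by auto
      from var_le[OF this] show ?thesis using elim(2,3) by (simp add: \<kappa>_def)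
    qed
    ultimately show ?case by simp
  qed
  have "is_disintegration borel borel \<phi> \<Omega> D"
    unfolding is_disintegration_def Let_def \<mu>_def[symmetric] \<nu>_def[symmetric]
  proof (intro conjI ballI)
    show "vector_measure borel (D y)" for y
      unfolding D_def by (rule \<kappa>.vector_measure_density_int)
    show "bounded_variation borel (D y)" for y
      unfolding D_def by (rule \<kappa>.bounded_variation_density_int)
    show "AE y in \<nu>. variation borel (D y) (space borel) = 1 \<and> {y} \<in> sets borel \<and>
        variation borel (D y) (space borel - \<phi> -` {y}) = 0"
      by (rule AE)
    fix f :: "'x \<Rightarrow> real" assume f: "f \<in> bounded_measurable borel"
    show "has_Bochner_integral_strong \<nu> (\<lambda>y. vector_integral borel (D y) f) (vector_integral borel \<Omega> f)"
      by (rule bochner[OF f])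
    then show "strongly_measurable \<nu> (\<lambda>y. vector_integral borel (D y) f)"
      by (simp add: has_Bochner_integral_strong_def)
  qed
  then show ?thesis by blast
qed

end
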